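(* Let $u\in C^2[0,\pi]$ with $u(x)>0$ for all $x\in[0,\pi]$, let $p,q\in\mathbb{N}^+$ with $\gcd(p,q)=1$ and $p$ even, $T=2\pi p/q$, $\Omega=(0,T)\times(0,\pi)$, and let $f\in C(\Omega\times\mathbb{R},\mathbb{R})$ be $T$-periodic in $t$. Put $\hat f(t,x,y)=f(t,x,y)/u(x)$ and assume that for every $R>0$ there is $h_R\in L^2(\Omega)$ with $|\hat f(t,x,y)|\le h_R(t,x)$ for $|y|\le R$. Let $\underline{\lambda}<\bar{\lambda}$ be two consecutive elements of $\Lambda(L_o)$, and let $\alpha,\beta\in\mathcal{M}_e\cap L^\infty(\Omega)$ satisfy $\underline{\lambda}\le\alpha(t,x)\le\beta(t,x)\le\bar{\lambda}$ for a.e. $(t,x)\in\Omega$, $\int_\Omega(\alpha-\underline{\lambda})v^2\,dt\,dx>0$ for all $v\in\ker(L_o-\underline{\lambda}I)\setminus\{0\}$, and $\int_\Omega(\bar{\lambda}-\beta)w^2\,dt\,dx>0$ for all $w\in\ker(L_o-\bar{\lambda}I)\setminus\{0\}$. Suppose $\hat f=\hat f_1+\hat f_2$, where $$\hat f_1(t,x,y)=\hat f_1(t+T/2,x,y),\quad \hat f_1(t,x,y)=-\hat f_1(t,x,-y),\qquad \hat f_2(t,x,y)=-\hat f_2(t+T/2,x,y),\quad \hat f_2(t,x,y)=\hat f_2(t,x,-y),$$ and $$\lim_{|y|\to+\infty}\frac{\hat f_2(t,x,y)}{y}=0,\qquad \alpha(t,x)\le\liminf_{|y|\to+\infty}\frac{\hat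 f_1(t,x,y)}{y}\le\limsup_{|y|\to+\infty}\frac{\hat f_1(t,x,y)}{y}\le\beta(t,x),$$ both uniformly for a.e. $(t,x)\in\Omega$. Then the problem $u(x)y_{tt}-(u(x)y_x)_x=f(t,x,y)$ in $\Omega$, $y(0,x)=y(T,x)$, $y_t(0,x)=y_t(T,x)$, $y(t,0)=y(t,\pi)=0$ has at least one (weak) periodic solution lying in $\mathcal{M}_o$.
   Context: Functions on $\Omega$ are identified with their $T$-periodic extensions in $t$. $L^2(\Omega)$ is the space of real measurable $y$ with $\int_\Omega u|y|^2dt\,dx<\infty$, inner product $\langle y,z\rangle=\int_\Omega u\,y\,z\,dt\,dx$. A weak solution of the problem is $y\in L^2(\Omega)$ with $\int_\Omega y(u\psi_{tt}-(u\psi_x)_x)\,dt\,dx-\int_\Omega f(t,x,y)\psi\,dt\,dx=0$ for all $\psi\in C^\infty(\Omega)$ with $\psi(t,0)=\psi(t,\pi)=0$, $\psi(0,x)=\psi(T,x)$, $\psi_t(0,x)=\psi_t(T,x)$. Let $\lambda_1^2<\lambda_2^2<\cdots$ be the eigenvalues of $(u\varphi')'=-\lambda^2u\varphi$, $\varphi(0)=\varphi(\pi)=0$, with eigenfunctions $\varphi_n$, $\int_0^\pi u\varphi_n^2=1$. With $T_0=1/\sqrt T$, $T_m=\sqrt{2/T}$ ($m\ge1$), the functions $T_m\varphi_n\cos\frac{q}{p}mt$, $T_m\varphi_n\sin\frac{q}{p}mt$ ($m\in\mathbb{N}$, $n\in\mathbb{N}^+$) form a complete orthonormal system, $y=\sum_{n,m}T_m\varphi_n(a_{mn}\cos\frac{q}{p}mt+b_{mn}\sin\frac{q}{p}mt)$.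 Put $\mu_{mn}=\lambda_n^2-(\frac{q}{p}m)^2$, $\mathcal{D}(L)=\{y:\sum\mu_{mn}^2(a_{mn}^2+b_{mn}^2)<\infty\}$, $Ly=\sum\mu_{mn}T_m\varphi_n(a_{mn}\cos\frac{q}{p}mt+b_{mn}\sin\frac{q}{p}mt)$. $\mathcal{M}_o=\{y\in L^2(\Omega): y(t,x)=-y(t+T/2,x)\}$, $\mathcal{M}_e=\{y\in L^2(\Omega): y(t,x)=y(t+T/2,x)\}$. $L_o$ is the restriction of $L$ to $\mathcal{D}(L)\cap\mathcal{M}_o$; $\Lambda(L_o)=\{\mu_{mn}: m\text{ odd}, n\in\mathbb{N}^+\}$; consecutive means no element of $\Lambda(L_o)$ lies strictly between; $\ker(L_o-\lambda I)=\{y\in\mathcal{D}(L)\cap\mathcal{M}_o: Ly=\lambda y\}$. *)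

theory Defs
  imports "HOL-Analysis.Analysis"
begin

definition Omega :: "real \<Rightarrow> (real \<times> real) set" where
  "Omega T = {0<..<T} \<times> {0<..<pi}"

definition C2_on :: "real set \<Rightarrow> (real \<Rightarrow> real) \<Rightarrow> bool" where
  "C2_on S u \<longleftrightarrow> (\<exists>u' u''. (\<forall>x\<in>S. (u has_real_derivative u' x) (at x within S))
      \<and> (\<forall>x\<in>S. (u' has_real_derivative u'' x) (at x within S)) \<and> continuous_on S u'')"

definition SL_eigenpair :: "(real \<Rightarrow> real) \<Rightarrow> real \<Rightarrow> (real \<Rightarrow> real) \<Rightarrow> bool" where
  "SL_eigenpair u \<mu> \<phi> \<longleftrightarrow> (\<exists>\<phi>'.
      (\<forall>x\<in>{0..pi}. (\<phi> has_real_derivative \<phi>' x) (at x within {0..pi}))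
    \<and> (\<forall>x\<in>{0..pi}. ((\<lambda>s. u s * \<phi>' s) has_real_derivative (- \<mu> * u x * \<phi> x)) (at x within {0..pi}))
    \<and> \<phi> 0 = 0 \<and> \<phi> pi = 0 \<and> (\<exists>x\<in>{0..pi}. \<phi> x \<noteq> 0))"

text \<open>lam2 n = lambda_n^2 (n >= 1) is the increasing enumeration of all eigenvalues, and
  phi n is a corresponding eigenfunction normalised by int_0^pi u phi_n^2 = 1.\<close>
definition SL_system :: "(real \<Rightarrow> real) \<Rightarrow> (nat \<Rightarrow> real) \<Rightarrow> (nat \<Rightarrow> real \<Rightarrow> real) \<Rightarrow> bool" where
  "SL_system u lam2 phi \<longleftrightarrow>
     (\<forall>n\<ge>1. SL_eigenpair u (lam2 n) (phi n)
             \<and> (LBINT x=0..pi. u x * (phi n x)\<^sup>2) = 1)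
   \<and> (\<forall>n m. 1 \<le> n \<longrightarrow> n < m \<longrightarrow> lam2 n < lam2 m)
   \<and> (\<forall>\<mu> \<phi>. SL_eigenpair u \<mu> \<phi> \<longrightarrow> (\<exists>n\<ge>1. \<mu> = lam2 n))"

definition L2 :: "(real \<Rightarrow> real) \<Rightarrow> real \<Rightarrow> (real \<times> real \<Rightarrow> real) set" where
  "L2 u T = {y. y \<in> borel_measurable lborel
              \<and> (\<forall>t x. y (t + T, x) = y (t, x))
              \<and> set_integrable lborel (Omega T) (\<lambda>z. u (snd z) * (y z)\<^sup>2)}"

definition M_o :: "(real \<Rightarrow> real) \<Rightarrow> real \<Rightarrow> (real \<times> real \<Rightarrow> real) set" where
  "M_o u T = {y \<in> L2 u T. AE z in lborel. z \<in> Omega T \<longrightarrow> y z = - y (fst z + T/2, snd z)}"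

definition M_e :: "(real \<Rightarrow> real) \<Rightarrow> real \<Rightarrow> (real \<times> real \<Rightarrow> real) set" where
  "M_e u T = {y \<in> L2 u T. AE z in lborel. z \<in> Omega T \<longrightarrow> y z = y (fst z + T/2, snd z)}"

definition Linfty :: "real \<Rightarrow> (real \<times> real \<Rightarrow> real) set" where
  "Linfty T = {y. y \<in> borel_measurable lborel \<and>
                 (\<exists>C. AE z in lborel. z \<in> Omega T \<longrightarrow> \<bar>y z\<bar> \<le> C)}"

definition L2_nonzero :: "real \<Rightarrow> (real \<times> real \<Rightarrow> real) \<Rightarrow> bool" where
  "L2_nonzero T y \<longleftrightarrow> \<not> (AE z in lborel. z \<in> Omega T \<longrightarrow> y z = 0)"

definition Tcoef :: "real \<Rightarrow> nat \<Rightarrow> real" where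
  "Tcoef T m = (if m = 0 then 1 / sqrt T else sqrt (2 / T))"

definition freq :: "nat \<Rightarrow> nat \<Rightarrow> nat \<Rightarrow> real" where
  "freq p q m = real q / real p * real m"

definition cosb :: "nat \<Rightarrow> nat \<Rightarrow> real \<Rightarrow> (nat \<Rightarrow> real \<Rightarrow> real) \<Rightarrow> nat \<Rightarrow> nat \<Rightarrow> real \<times> real \<Rightarrow> real" where
  "cosb p q T phi m n z = Tcoef T m * phi n (snd z) * cos (freq p q m * fst z)"

definition sinb :: "nat \<Rightarrow> nat \<Rightarrow> real \<Rightarrow> (nat \<Rightarrow> real \<Rightarrow> real) \<Rightarrow> nat \<Rightarrow> nat \<Rightarrow> real \<times> real \<Rightarrow> real" where
  "sinb p q T phi m n z = Tcoef T m * phi n (snd z) * sin (freq p q m * fst z)"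

definition coef_a where
  "coef_a u p q T phi y m n = (LINT z:Omega T|lborel. u (snd z) * y z * cosb p q T phi m n z)"

definition coef_b where
  "coef_b u p q T phi y m n = (LINT z:Omega T|lborel. u (snd z) * y z * sinb p q T phi m n z)"

definition mu :: "(nat \<Rightarrow> real) \<Rightarrow> nat \<Rightarrow> nat \<Rightarrow> nat \<Rightarrow> nat \<Rightarrow> real" where
  "mu lam2 p q m n = lam2 n - (freq p q m)\<^sup>2"

definition Idx :: "(nat \<times> nat) set" where
  "Idx = UNIV \<times> {1..}"

definition domL where
  "domL u p q T lam2 phi = {y \<in> L2 u T.
     (\<lambda>(m,n). (mu lam2 p q m n)\<^sup>2 * ((coef_a u p q T phi y m n)\<^sup>2 + (coef_b u p q T phi y m n)\<^sup>2))
       summable_on Idx}"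

definition series_L2 where
  "series_L2 u p q T phi c d g \<longleftrightarrow>
     ((\<lambda>F. LINT z:Omega T|lborel. u (snd z) *
          (g z - (\<Sum>(m,n)\<in>F. c m n * cosb p q T phi m n z + d m n * sinb p q T phi m n z))\<^sup>2)
       \<longlongrightarrow> 0) (finite_subsets_at_top Idx)"

definition L_eq where
  "L_eq u p q T lam2 phi y g \<longleftrightarrow> y \<in> domL u p q T lam2 phi \<and>
     series_L2 u p q T phi
       (\<lambda>m n. mu lam2 p q m n * coef_a u p q T phi y m n)
       (\<lambda>m n. mu lam2 p q m n * coef_b u p q T phi y m n) g"

definition spec_Lo :: "(nat \<Rightarrow> real) \<Rightarrow> nat \<Rightarrow> nat \<Rightarrow> real set" where
  "spec_Lo lam2 p q = {mu lam2 p q m n | m n. odd m \<and> 1 \<le> n}"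

definition ker_Lo where
  "ker_Lo u p q T lam2 phi lam =
     {y \<in> domL u p q T lam2 phi \<inter> M_o u T. L_eq u p q T lam2 phi y (\<lambda>z. lam * y z)}"

text \<open>C^infinity functions on R^2: coinductively, continuous, differentiable with
  partial derivatives that are again C^infinity.\<close>
coinductive smooth2 :: "(real \<times> real \<Rightarrow> real) \<Rightarrow> bool" where
  "continuous_on UNIV f \<Longrightarrow>
   (\<And>z. (f has_derivative (\<lambda>h. fst h * ft z + snd h * fx z)) (at z)) \<Longrightarrow>
   smooth2 ft \<Longrightarrow> smooth2 fx \<Longrightarrow> smooth2 f"

definition pdt :: "(real \<times> real \<Rightarrow> real) \<Rightarrow> real \<times> real \<Rightarrow> real" where
  "pdt \<psi> z = deriv (\<lambda>t. \<psi> (t, snd z)) (fst z)"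

definition pdx :: "(real \<times> real \<Rightarrow> real) \<Rightarrow> real \<times> real \<Rightarrow> real" where
  "pdx \<psi> z = deriv (\<lambda>x. \<psi> (fst z, x)) (snd z)"

definition test_fun :: "real \<Rightarrow> (real \<times> real \<Rightarrow> real) \<Rightarrow> bool" where
  "test_fun T \<psi> \<longleftrightarrow> smooth2 \<psi>
     \<and> (\<forall>t\<in>{0..T}. \<psi> (t, 0) = 0 \<and> \<psi> (t, pi) = 0)
     \<and> (\<forall>x\<in>{0..pi}. \<psi> (0, x) = \<psi> (T, x) \<and> pdt \<psi> (0, x) = pdt \<psi> (T, x))"

definition wave_op :: "(real \<Rightarrow> real) \<Rightarrow> (real \<times> real \<Rightarrow> real) \<Rightarrow> real \<times> real \<Rightarrow> real" where
  "wave_op u \<psi> z = u (snd z) * pdt (pdt \<psi>) z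
                   - deriv (\<lambda>x. u x * pdx \<psi> (fst z, x)) (snd z)"

definition weak_solution where
  "weak_solution u T f y \<longleftrightarrow> y \<in> L2 u T \<and>
     (\<forall>\<psi>. test_fun T \<psi> \<longrightarrow>
        set_integrable lborel (Omega T) (\<lambda>z. f (fst z) (snd z) (y z) * \<psi> z) \<and>
        (LINT z:Omega T|lborel. y z * wave_op u \<psi> z)
        - (LINT z:Omega T|lborel. f (fst z) (snd z) (y z) * \<psi> z) = 0)"

end

(*
  Galerkin approximation replaces degree theory. Since p is even and q is odd, the frequencies
  (q/p) m with m odd keep a positive distance from the integers, whereas large sqrt(lambda_n^2)
  approach integers (Liouville substitution); hence |mu_mn| tends to infinity along the modes
  that span M_o. Write y = y_+ + y_- for the parts of y on the modes with mu at least the upper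
  and at most the lower of the two consecutive eigenvalues. The nonresonance conditions give
  <L y - N(y), y_+ - y_-> >= delta |y|^2 - C |y| for the superposition operator N of f/u, so Brouwer's
  theorem solves the projected equation on every finite span of modes within a fixed ball. As
  L y = P N(y) stays bounded and |mu_mn| tends to infinity, a subsequence converges strongly and
  almost everywhere, and the limit satisfies the equation against every odd mode; against even
  modes both sides vanish by T/2-antiperiodicity. Test functions are L^2 limits of combinations of
  modes: the quadratic form of the Green operator, maximised over the complement of the first N
  eigenfunctions, is attained at an eigenfunction, so eigenfunction expansions converge with
  rate 1/lambda_{N+1}^2, and in time Stone-Weierstrass applies.
*)
theory Submission
  imports Defs "HOL-Complex_Analysis.Complex_Analysis"
begin

section \<open>Square integrable functions\<close>

text \<open>Compactness is the obstacle. For \<open>u = 1\<close> one has \<open>lam2 n\<close> =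
  n^2, and the even indices m = p k with n = q k give \<open>mu\<close> = 0 for every k \<ge> 1, so
  over all modes an eigenvalue can have infinite multiplicity. On \<open>M_o\<close> this cannot
  happen, and \<open>M_o\<close> fits the nonlinearity because both pairs of symmetries say the
  same: f/u at (t + T/2, x, -v) is the negative of f/u at (t, x, v). The multiplier y_+ - y_-
  answers the indefiniteness of L. Pointwise N(y) = a y + rho with \<alpha> - \<epsilon> \<le> a
  \<le> \<beta> + \<epsilon> and |rho| \<le> h, while y (y_+ - y_-) = y_+^2 - y_-^2 has no mixed
  term. So a may be replaced by \<beta> + \<epsilon> on y_+ and by \<alpha> - \<epsilon> on y_-, and
  the estimate splits into two one-sided ones, each using nonresonance at one end of the gap. All
  norms are taken in L2 with density u, where the modes are orthonormal and L is diagonal.\<close>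

lemma discriminant_le:
  fixes a b c :: real
  assumes "\<And>t. 0 \<le> a + 2 * b * t + c * t\<^sup>2" and "0 \<le> c"
  shows "b\<^sup>2 \<le> a * c"
proof (cases "c = 0")
  case True
  have "b = 0"
  proof (rule ccontr)
    assume "b \<noteq> 0"
    \<comment> \<open>At this value of t the affine function equals -1.\<close>
    then show False using assms(1)[of "- (a + 1) / (2 * b)"] True by simp
  qed
  then show ?thesis using True by simp
next
  case False
  with assms(2) have c: "c > 0" by simp
  have "0 \<le> a + 2 * b * (- b / c) + c * (- b / c)\<^sup>2" by (rule assms(1))
  also have "\<dots> = a - b\<^sup>2 / c" using c by (simp add: field_simps power2_eq_square)
  finally show ?thesis using c by (simp add: field_simps)
qed

text \<open>Functions rather than classes modulo null sets: the superposition operator and the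
  half-period symmetry act on representatives.\<close>

definition sq_int :: "'a measure \<Rightarrow> ('a \<Rightarrow> real) \<Rightarrow> bool" where
  "sq_int M f \<longleftrightarrow> f \<in> borel_measurable M \<and> integrable M (\<lambda>x. (f x)\<^sup>2)"

definition ip :: "'a measure \<Rightarrow> ('a \<Rightarrow> real) \<Rightarrow> ('a \<Rightarrow> real) \<Rightarrow> real" where
  "ip M f g = (LINT x|M. f x * g x)"

definition nrm :: "'a measure \<Rightarrow> ('a \<Rightarrow> real) \<Rightarrow> real" where
  "nrm M f = sqrt (ip M f f)"

lemma sq_int_bound:
  assumes "sq_int M g" "f \<in> borel_measurable M" "AE x in M. \<bar>f x\<bar> \<le> \<bar>g x\<bar>"
  shows "sq_int M f"
  unfolding sq_int_def
proof (intro conjI assms(2))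
  show "integrable M (\<lambda>x. (f x)\<^sup>2)"
  proof (rule Bochner_Integration.integrable_bound[of M "\<lambda>x. (g x)\<^sup>2"])
    show "AE x in M. norm ((f x)\<^sup>2) \<le> norm ((g x)\<^sup>2)"
      using assms(3) by eventually_elim (simp add: abs_le_square_iff)
  qed (use assms in \<open>auto simp: sq_int_def\<close>)
qed

lemma integrable_mult_sq_int:
  assumes "sq_int M f" "sq_int M g"
  shows "integrable M (\<lambda>x. f x * g x)"
proof (rule Bochner_Integration.integrable_bound[of M "\<lambda>x. (f x)\<^sup>2 + (g x)\<^sup>2"])
  show "AE x in M. norm (f x * g x) \<le> norm ((f x)\<^sup>2 + (g x)\<^sup>2)"
  proof (rule AE_I2)
    fix x
    have "2 * (\<bar>f x\<bar> * \<bar>g x\<bar>) \<le> \<bar>f x\<bar>\<^sup>2 + \<bar>g x\<bar>\<^sup>2"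
      using zero_le_power2[of "\<bar>f x\<bar> - \<bar>g x\<bar>"] unfolding power2_diff by linarith
    moreover have "0 \<le> \<bar>f x\<bar> * \<bar>g x\<bar>" by simp
    ultimately have "\<bar>f x\<bar> * \<bar>g x\<bar> \<le> \<bar>f x\<bar>\<^sup>2 + \<bar>g x\<bar>\<^sup>2" by linarith
    then show "norm (f x * g x) \<le> norm ((f x)\<^sup>2 + (g x)\<^sup>2)"
      by (simp add: abs_mult)
  qed
qed (use assms in \<open>auto simp: sq_int_def\<close>)

lemma sq_int_add [intro]:
  assumes "sq_int M f" "sq_int M g" shows "sq_int M (\<lambda>x. f x + g x)"
proof -
  have "integrable M (\<lambda>x. (f x)\<^sup>2 + (g x)\<^sup>2 + 2 * (f x * g x))"
    using assms integrable_mult_sq_int[OF assms] by (auto simp: sq_int_def)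
  then show ?thesis
    using assms by (auto simp: sq_int_def power2_sum mult.assoc)
qed

lemma sq_int_cmult [intro]: "sq_int M f \<Longrightarrow> sq_int M (\<lambda>x. c * f x)"
  by (auto simp: sq_int_def power_mult_distrib)

lemma sq_int_diff [intro]:
  assumes "sq_int M f" "sq_int M g" shows "sq_int M (\<lambda>x. f x - g x)"
  using sq_int_add[OF assms(1) sq_int_cmult[OF assms(2), of "-1"]] by simp

lemma sq_int_abs [intro]: "sq_int M f \<Longrightarrow> sq_int M (\<lambda>x. \<bar>f x\<bar>)"
  by (auto simp: sq_int_def)

lemma sq_int_zero [simp]: "sq_int M (\<lambda>x. 0)"
  by (simp add: sq_int_def)

lemma sq_int_sum [intro]:
  "(\<And>i. i \<in> F \<Longrightarrow> sq_int M (f i)) \<Longrightarrow> sq_int M (\<lambda>x. \<Sum>i\<in>F. f i x)"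
  by (induction F rule: infinite_finite_induct) auto

lemma (in finite_measure) sq_int_bounded:
  assumes "f \<in> borel_measurable M" "AE x in M. \<bar>f x\<bar> \<le> B"
  shows "sq_int M f"
proof (rule sq_int_bound[of M "\<lambda>_. B"])
  show "AE x in M. \<bar>f x\<bar> \<le> \<bar>B\<bar>" using assms(2) by eventually_elim simp
qed (use assms in \<open>auto simp: sq_int_def\<close>)

lemma ip_commute: "ip M f g = ip M g f"
  by (simp add: ip_def mult.commute)

lemma ip_add_left:
  "sq_int M f \<Longrightarrow> sq_int M g \<Longrightarrow> sq_int M h \<Longrightarrow> ip M (\<lambda>x. f x + g x) h = ip M f h + ip M g h"
  unfolding ip_def distrib_right
  by (intro Bochner_Integration.integral_add integrable_mult_sq_int)

lemma ip_diff_left: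
  "sq_int M f \<Longrightarrow> sq_int M g \<Longrightarrow> sq_int M h \<Longrightarrow> ip M (\<lambda>x. f x - g x) h = ip M f h - ip M g h"
  unfolding ip_def left_diff_distrib
  by (intro Bochner_Integration.integral_diff integrable_mult_sq_int)

lemma ip_cmult_left: "ip M (\<lambda>x. c * f x) h = c * ip M f h"
  unfolding ip_def by (simp add: mult.assoc)

lemma ip_add_right:
  "sq_int M f \<Longrightarrow> sq_int M g \<Longrightarrow> sq_int M h \<Longrightarrow> ip M h (\<lambda>x. f x + g x) = ip M h f + ip M h g"
  unfolding ip_commute[of M h] by (rule ip_add_left)

lemma ip_diff_right:
  "sq_int M f \<Longrightarrow> sq_int M g \<Longrightarrow> sq_int M h \<Longrightarrow> ip M h (\<lambda>x. f x - g x) = ip M h f - ip M h g"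
  unfolding ip_commute[of M h] by (rule ip_diff_left)

lemma ip_cmult_right: "ip M h (\<lambda>x. c * f x) = c * ip M h f"
  unfolding ip_commute[of M h] by (rule ip_cmult_left)

lemma ip_sum_left:
  assumes "\<And>i. i \<in> F \<Longrightarrow> sq_int M (f i)" "sq_int M h"
  shows "ip M (\<lambda>x. \<Sum>i\<in>F. f i x) h = (\<Sum>i\<in>F. ip M (f i) h)"
  unfolding ip_def sum_distrib_right
  by (intro Bochner_Integration.integral_sum integrable_mult_sq_int assms)

lemma ip_nonneg [simp]: "0 \<le> ip M f f"
  by (simp add: ip_def)

lemma nrm_nonneg [simp]: "0 \<le> nrm M f"
  by (simp add: nrm_def)

lemma nrm_square: "(nrm M f)\<^sup>2 = ip M f f"
  by (simp add: nrm_def)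

lemma ip_self_add:
  assumes "sq_int M f" "sq_int M g"
  shows "ip M (\<lambda>x. f x + g x) (\<lambda>x. f x + g x) = ip M f f + 2 * ip M f g + ip M g g"
  using assms by (simp add: ip_add_left ip_add_right sq_int_add ip_commute[of M g f])

lemma Cauchy_Schwarz_ip:
  assumes "sq_int M f" "sq_int M g"
  shows "\<bar>ip M f g\<bar> \<le> nrm M f * nrm M g"
proof -
  have "(ip M f g)\<^sup>2 \<le> ip M f f * ip M g g"
  proof (rule discriminant_le)
    fix t
    have "0 \<le> ip M (\<lambda>x. f x + t * g x) (\<lambda>x. f x + t * g x)" by simp
    also have "\<dots> = ip M f f + 2 * ip M f (\<lambda>x. t * g x) + ip M (\<lambda>x. t * g x) (\<lambda>x. t * g x)"
      using assms by (intro ip_self_add) auto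
    finally show "0 \<le> ip M f f + 2 * ip M f g * t + ip M g g * t\<^sup>2"
      by (simp add: ip_cmult_right ip_cmult_left power2_eq_square ac_simps)
  qed simp
  also have "\<dots> = (nrm M f * nrm M g)\<^sup>2"
    by (simp add: power_mult_distrib nrm_square)
  finally have "\<bar>ip M f g\<bar>\<^sup>2 \<le> (nrm M f * nrm M g)\<^sup>2" by simp
  then show ?thesis by (rule power2_le_imp_le) simp
qed

lemma nrm_triangle:
  assumes "sq_int M f" "sq_int M g"
  shows "nrm M (\<lambda>x. f x + g x) \<le> nrm M f + nrm M g"
proof (rule power2_le_imp_le)
  show "(nrm M (\<lambda>x. f x + g x))\<^sup>2 \<le> (nrm M f + nrm M g)\<^sup>2"
    using Cauchy_Schwarz_ip[OF assms] ip_self_add[OF assms]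
    by (simp add: nrm_square power2_sum mult.assoc)
qed simp

lemma nrm_cmult: "nrm M (\<lambda>x. c * f x) = \<bar>c\<bar> * nrm M f"
  by (simp add: nrm_def ip_cmult_left ip_cmult_right real_sqrt_mult)

lemma nrm_abs [simp]: "nrm M (\<lambda>x. \<bar>f x\<bar>) = nrm M f"
  by (simp add: nrm_def ip_def)

lemma nrm_mono:
  assumes "sq_int M g" "f \<in> borel_measurable M" "AE x in M. \<bar>f x\<bar> \<le> \<bar>g x\<bar>"
  shows "nrm M f \<le> nrm M g"
  unfolding nrm_def ip_def
proof (intro real_sqrt_le_mono integral_mono_AE)
  show "integrable M (\<lambda>x. f x * f x)" "integrable M (\<lambda>x. g x * g x)"
    using sq_int_bound[OF assms] assms(1) by (auto intro: integrable_mult_sq_int)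
  show "AE x in M. f x * f x \<le> g x * g x"
    using assms(3) by eventually_elim (simp add: abs_le_square_iff power2_eq_square)
qed

lemma nrm_sum_le:
  assumes "\<And>i. i \<in> F \<Longrightarrow> sq_int M (f i)"
  shows "nrm M (\<lambda>x. \<Sum>i\<in>F. f i x) \<le> (\<Sum>i\<in>F. nrm M (f i))"
  using assms
proof (induction F rule: infinite_finite_induct)
  case (insert i F)
  have "nrm M (\<lambda>x. f i x + (\<Sum>i\<in>F. f i x)) \<le> nrm M (f i) + nrm M (\<lambda>x. \<Sum>i\<in>F. f i x)"
    using insert.prems by (intro nrm_triangle) auto
  with insert show ?case by fastforce
qed (simp_all add: nrm_def ip_def)

text \<open>Superposition operators pass to the limit only under domination, hence the bound \<open>G\<close> besides
  the Riesz--Fischer limit.\<close>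
lemma L2_fast_Cauchy:
  assumes sq: "\<And>k. sq_int M (Y k)"
    and fast: "\<And>k. nrm M (\<lambda>x. Y (Suc k) x - Y k x) \<le> (1/2)^k"
  obtains G where "sq_int M G" "AE x in M. convergent (\<lambda>k. Y k x)" "AE x in M. \<forall>k. \<bar>Y k x\<bar> \<le> G x"
proof -
  have [measurable]: "Y k \<in> borel_measurable M" for k using sq[of k] by (simp add: sq_int_def)
  \<comment> \<open>Sums of absolute increments dominate every \<open>Y k\<close> and increase
    towards the majorant sought.\<close>
  define S where "S = (\<lambda>n x. \<bar>Y 0 x\<bar> + (\<Sum>k<n. \<bar>Y (Suc k) x - Y k x\<bar>))"
  have [measurable]: "S n \<in> borel_measurable M" for n by (simp add: S_def)
  have S0: "0 \<le> S n x" for n x by (simp add: S_def sum_nonneg)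
  have sqS: "sq_int M (S n)" for n
    unfolding S_def by (intro sq_int_add sq_int_sum sq_int_abs sq_int_diff sq)
  define B where "B = nrm M (Y 0) + 2"
  have nS: "nrm M (S n) \<le> B" for n
  proof -
    have "nrm M (S n) \<le> nrm M (\<lambda>x. \<bar>Y 0 x\<bar>) + nrm M (\<lambda>x. \<Sum>k<n. \<bar>Y (Suc k) x - Y k x\<bar>)"
      unfolding S_def by (intro nrm_triangle sq_int_sum sq_int_abs sq_int_diff sq)
    also have "nrm M (\<lambda>x. \<Sum>k<n. \<bar>Y (Suc k) x - Y k x\<bar>) \<le> (\<Sum>k<n. nrm M (\<lambda>x. \<bar>Y (Suc k) x - Y k x\<bar>))"
      by (intro nrm_sum_le sq_int_abs sq_int_diff sq)
    also have "\<dots> \<le> (\<Sum>k<n. (1/2)^k)"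
      using fast by (intro sum_mono) simp
    also have "\<dots> \<le> 2"
    proof -
      have "(\<Sum>k<n. (1/2::real)^k) = 2 - 2 * (1/2)^n" by (induction n) (auto simp: field_simps)
      then show ?thesis by simp
    qed
    finally show ?thesis by (simp add: B_def)
  qed
  \<comment> \<open>Taken in \<open>ennreal\<close>, since before the integral is bounded nothing
    excludes an infinite supremum; \<open>enn2real\<close> then changes it on a null set
    only.\<close>
  define H where "H = (\<lambda>x. SUP n. ennreal ((S n x)\<^sup>2))"
  have [measurable]: "H \<in> borel_measurable M" unfolding H_def by measurable
  have inc: "incseq (\<lambda>n x. ennreal ((S n x)\<^sup>2))"
    by (intro incseq_SucI le_funI ennreal_leI power_mono) (auto simp: S_def sum_nonneg)
  have "(\<integral>\<^sup>+x. H x \<partial>M) = (SUP n. \<integral>\<^sup>+x. ennreal ((S n x)\<^sup>2) \<partial>M)"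
    unfolding H_def by (rule nn_integral_monotone_convergence_SUP[OF inc]) measurable
  also have "\<dots> \<le> ennreal (B\<^sup>2)"
  proof (rule SUP_least)
    fix n
    have "(\<integral>\<^sup>+x. ennreal ((S n x)\<^sup>2) \<partial>M) = ennreal (ip M (S n) (S n))"
      using sqS[of n] by (subst nn_integral_eq_integral) (auto simp: sq_int_def ip_def power2_eq_square)
    also have "\<dots> \<le> ennreal (B\<^sup>2)"
      unfolding nrm_square[symmetric] using nS[of n] by (intro ennreal_leI power_mono) auto
    finally show "(\<integral>\<^sup>+x. ennreal ((S n x)\<^sup>2) \<partial>M) \<le> ennreal (B\<^sup>2)" .
  qed
  finally have HB: "(\<integral>\<^sup>+x. H x \<partial>M) \<le> ennreal (B\<^sup>2)" .
  then have fin: "AE x in M. H x \<noteq> \<infinity>"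
    by (intro nn_integral_noteq_infinite) (auto simp: top_unique)
  define G where "G = (\<lambda>x. sqrt (enn2real (H x)))"
  have [measurable]: "G \<in> borel_measurable M" unfolding G_def by measurable
  have sqG: "sq_int M G"
    unfolding sq_int_def
  proof (intro conjI integrableI_nonneg)
    have "(\<integral>\<^sup>+x. ennreal ((G x)\<^sup>2) \<partial>M) \<le> (\<integral>\<^sup>+x. H x \<partial>M)"
      by (intro nn_integral_mono) (simp add: G_def ennreal_enn2real_if)
    also have "\<dots> \<le> ennreal (B\<^sup>2)" by (rule HB)
    also have "\<dots> < \<infinity>" by simp
    finally show "(\<integral>\<^sup>+x. ennreal ((G x)\<^sup>2) \<partial>M) < \<infinity>" .
  qed auto
  have SG: "AE x in M. \<forall>n. S n x \<le> G x"
    using fin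
  proof eventually_elim
    case (elim x)
    show ?case
    proof
      fix n
      have "ennreal ((S n x)\<^sup>2) \<le> H x" unfolding H_def by (rule SUP_upper) simp
      also have "H x = ennreal ((G x)\<^sup>2)"
        using elim by (simp add: G_def ennreal_enn2real_if)
      finally have "(S n x)\<^sup>2 \<le> (G x)\<^sup>2" by simp
      then show "S n x \<le> G x" by (rule power2_le_imp_le) (simp add: G_def)
    qed
  qed
  have "AE x in M. convergent (\<lambda>k. Y k x)"
    using SG
  proof eventually_elim
    case (elim x)
    have "summable (\<lambda>k. \<bar>Y (Suc k) x - Y k x\<bar>)"
    proof (rule summableI_nonneg_bounded[of _ "G x"])
      fix n
      show "(\<Sum>k<n. \<bar>Y (Suc k) x - Y k x\<bar>) \<le> G x"
        using elim[rule_format, of n] by (simp add: S_def)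
    qed simp
    then have "summable (\<lambda>k. Y (Suc k) x - Y k x)"
      by (rule summable_rabs_cancel)
    then have "(\<lambda>n. \<Sum>k<n. Y (Suc k) x - Y k x) \<longlonglongrightarrow> (\<Sum>k. Y (Suc k) x - Y k x)"
      by (rule summable_LIMSEQ)
    then have "(\<lambda>n. Y n x - Y 0 x) \<longlonglongrightarrow> (\<Sum>k. Y (Suc k) x - Y k x)"
      by (simp add: sum_lessThan_telescope[of "\<lambda>k. Y k x"])
    from tendsto_add[OF this tendsto_const[of "Y 0 x"]] show ?case
      by (auto simp: convergent_def)
  qed
  moreover have "AE x in M. \<forall>k. \<bar>Y k x\<bar> \<le> G x"
    using SG
  proof eventually_elim
    case (elim x)
    have "\<bar>Y k x\<bar> \<le> S k x" for k
      by (induction k) (auto simp: S_def)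
    with elim show ?case by (meson order_trans)
  qed
  ultimately show ?thesis using sqG that by blast
qed

section \<open>Finite expansions in an orthonormal system\<close>

locale orthonormal =
  fixes M :: "'a measure" and I :: "'i set" and e :: "'i \<Rightarrow> 'a \<Rightarrow> real"
  assumes sq_e: "i \<in> I \<Longrightarrow> sq_int M (e i)"
    and ip_e: "i \<in> I \<Longrightarrow> j \<in> I \<Longrightarrow> ip M (e i) (e j) = (if i = j then 1 else 0)"
begin

definition comb :: "'i set \<Rightarrow> ('i \<Rightarrow> real) \<Rightarrow> 'a \<Rightarrow> real" where
  "comb F c = (\<lambda>x. \<Sum>i\<in>F. c i * e i x)"

lemma sq_comb: "F \<subseteq> I \<Longrightarrow> sq_int M (comb F c)"
  unfolding comb_def by (intro sq_int_sum sq_int_cmult sq_e) auto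

lemma ip_comb_left:
  assumes "F \<subseteq> I" "sq_int M g"
  shows "ip M (comb F c) g = (\<Sum>i\<in>F. c i * ip M (e i) g)"
proof -
  have "ip M (\<lambda>x. \<Sum>i\<in>F. c i * e i x) g = (\<Sum>i\<in>F. ip M (\<lambda>x. c i * e i x) g)"
    using assms by (intro ip_sum_left sq_int_cmult sq_e) auto
  then show ?thesis by (simp add: comb_def ip_cmult_left)
qed

lemma ip_comb_e:
  assumes "F \<subseteq> I" "finite F" "i \<in> I"
  shows "ip M (comb F c) (e i) = (if i \<in> F then c i else 0)"
proof -
  have "ip M (comb F c) (e i) = (\<Sum>j\<in>F. c j * (if j = i then 1 else 0))"
    using assms by (subst ip_comb_left) (auto intro!: sum.cong sq_e simp: ip_e subset_iff)
  also have "\<dots> = (if i \<in> F then c i else 0)"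
    using assms(2) by (simp add: if_distrib[of "\<lambda>t. _ * t"] cong: if_cong)
  finally show ?thesis .
qed

lemma ip_comb_comb:
  assumes "F \<subseteq> I" "finite F"
  shows "ip M (comb F c) (comb F d) = (\<Sum>i\<in>F. c i * d i)"
proof -
  have "ip M (comb F c) (comb F d) = (\<Sum>i\<in>F. c i * ip M (e i) (comb F d))"
    using assms by (intro ip_comb_left sq_comb)
  also have "\<dots> = (\<Sum>i\<in>F. c i * d i)"
    using assms by (intro sum.cong) (auto simp: ip_commute[of M "e _"] ip_comb_e subset_iff)
  finally show ?thesis .
qed

lemma nrm_comb: "F \<subseteq> I \<Longrightarrow> finite F \<Longrightarrow> (nrm M (comb F c))\<^sup>2 = (\<Sum>i\<in>F. (c i)\<^sup>2)"
  by (simp only: nrm_square ip_comb_comb) (simp add: power2_eq_square)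

text \<open>Completing the square in the coefficients. The last sum is the only term that depends on
  \<open>c\<close>, so the Fourier coefficients are optimal, and Bessel's inequality is the case
  where it vanishes.\<close>

lemma distance_to_comb:
  assumes "F \<subseteq> I" "finite F" "sq_int M g"
  shows "(nrm M (\<lambda>x. g x - comb F c x))\<^sup>2
    = ip M g g - (\<Sum>i\<in>F. (ip M g (e i))\<^sup>2) + (\<Sum>i\<in>F. (c i - ip M g (e i))\<^sup>2)"
proof -
  have "(nrm M (\<lambda>x. g x - comb F c x))\<^sup>2 = ip M g g - 2 * ip M (comb F c) g + ip M (comb F c) (comb F c)"
    using assms
    by (simp add: nrm_square ip_diff_left ip_diff_right sq_int_diff sq_comb ip_commute[of M g "comb F c"])
  also have "\<dots> = ip M g g - 2 * (\<Sum>i\<in>F. c i * ip M g (e i)) + (\<Sum>i\<in>F. c i * c i)"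
    using assms by (simp add: ip_comb_left ip_comb_comb ip_commute[of M g "e _"])
  finally show ?thesis
    by (simp add: power2_diff sum.distrib sum_subtractf sum_distrib_left power2_eq_square algebra_simps)
qed

lemma Bessel:
  assumes "F \<subseteq> I" "finite F" "sq_int M g"
  shows "(\<Sum>i\<in>F. (ip M g (e i))\<^sup>2) \<le> (nrm M g)\<^sup>2"
proof -
  have "0 \<le> (nrm M (\<lambda>x. g x - comb F (\<lambda>i. ip M g (e i)) x))\<^sup>2" by simp
  also have "\<dots> = ip M g g - (\<Sum>i\<in>F. (ip M g (e i))\<^sup>2)"
    by (subst distance_to_comb[OF assms]) simp
  finally show ?thesis by (simp add: nrm_square)
qed

text \<open>Enlarging the index set and passing to Fourier coefficients both reduce the distance.
  This allows approximants found on different index sets to be replaced by projections on one common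
  set.\<close>

lemma best_approximation:
  assumes "F \<subseteq> F'" "F' \<subseteq> I" "finite F'" "sq_int M g"
  shows "nrm M (\<lambda>x. g x - comb F' (\<lambda>i. ip M g (e i)) x) \<le> nrm M (\<lambda>x. g x - comb F c x)"
proof -
  have fin: "F \<subseteq> I" "finite F"
    using assms(1,2) finite_subset[OF assms(1,3)] by simp_all
  have "(\<Sum>i\<in>F. (ip M g (e i))\<^sup>2) \<le> (\<Sum>i\<in>F'. (ip M g (e i))\<^sup>2)"
    by (rule sum_mono2[OF assms(3,1)]) simp
  moreover have "0 \<le> (\<Sum>i\<in>F. (c i - ip M g (e i))\<^sup>2)" by (rule sum_nonneg) simp
  moreover note distance_to_comb[OF fin assms(4), of c]
    distance_to_comb[OF assms(2-4), of "\<lambda>i. ip M g (e i)"]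
  ultimately have "(nrm M (\<lambda>x. g x - comb F' (\<lambda>i. ip M g (e i)) x))\<^sup>2 \<le> (nrm M (\<lambda>x. g x - comb F c x))\<^sup>2"
    by simp
  then show ?thesis by (rule power2_le_imp_le) simp
qed

definition lincombs :: "('a \<Rightarrow> real) set" where
  "lincombs = {comb F c |F c. finite F \<and> F \<subseteq> I}"

lemma lincombs_e: "i \<in> I \<Longrightarrow> e i \<in> lincombs"
  unfolding lincombs_def by (rule CollectI, intro exI[of _ "{i}"] exI[of _ "\<lambda>_. 1"]) (auto simp: comb_def)

lemma lincombs_zero: "(\<lambda>x. 0) \<in> lincombs"
  unfolding lincombs_def by (rule CollectI, intro exI[of _ "{}"]) (auto simp: comb_def)

lemma lincombs_cmult:
  assumes "f \<in> lincombs" shows "(\<lambda>x. k * f x) \<in> lincombs"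
proof -
  obtain F c where F: "finite F" "F \<subseteq> I" "f = comb F c" using assms by (auto simp: lincombs_def)
  have "(\<lambda>x. k * f x) = comb F (\<lambda>i. k * c i)" by (simp add: F(3) comb_def sum_distrib_left mult.assoc)
  then show ?thesis unfolding lincombs_def using F by blast
qed

lemma lincombs_add:
  assumes "f \<in> lincombs" "g \<in> lincombs" shows "(\<lambda>x. f x + g x) \<in> lincombs"
proof -
  obtain F c where F: "finite F" "F \<subseteq> I" "f = comb F c" using assms(1) by (auto simp: lincombs_def)
  obtain G d where G: "finite G" "G \<subseteq> I" "g = comb G d" using assms(2) by (auto simp: lincombs_def)
  define c' d' where "c' = (\<lambda>i. if i \<in> F then c i else 0)" and "d' = (\<lambda>i. if i \<in> G then d i else 0)"
  have "f x = (\<Sum>i\<in>F \<union> G. c' i * e i x)" for x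
    unfolding F(3) comb_def c'_def using F G by (intro sum.mono_neutral_cong_left) auto
  moreover have "g x = (\<Sum>i\<in>F \<union> G. d' i * e i x)" for x
    unfolding G(3) comb_def d'_def using F G by (intro sum.mono_neutral_cong_left) auto
  ultimately have "(\<lambda>x. f x + g x) = comb (F \<union> G) (\<lambda>i. c' i + d' i)"
    by (simp add: comb_def sum.distrib distrib_right)
  then show ?thesis unfolding lincombs_def using F G by blast
qed

lemma lincombs_sum: "(\<And>j. j \<in> A \<Longrightarrow> f j \<in> lincombs) \<Longrightarrow> (\<lambda>x. \<Sum>j\<in>A. f j x) \<in> lincombs"
  by (induction A rule: infinite_finite_induct) (simp_all add: lincombs_zero lincombs_add)

end

text \<open>Mediates between modes indexed by triples and an enumeration by \<open>nat\<close>,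
  whose initial segments \<open>{..<n}\<close> are the Galerkin spaces.\<close>

lemma (in orthonormal) orthonormal_reindex:
  assumes "inj g" "range g \<subseteq> I"
  shows "orthonormal M (UNIV :: nat set) (\<lambda>i. e (g i))"
proof
  fix i j :: nat
  have "g i \<in> I" "g j \<in> I" using assms(2) by auto
  then show "sq_int M (e (g i))" "ip M (e (g i)) (e (g j)) = (if i = j then 1 else 0)"
    using sq_e ip_e assms(1) by (auto simp: inj_eq)
qed

lemma (in orthonormal) comb_reindex:
  fixes g :: "nat \<Rightarrow> 'i"
  assumes "inj g" "range g \<subseteq> I"
  shows "orthonormal.comb (\<lambda>i. e (g i)) E c = comb (g ` E) (\<lambda>j. c (inv g j))"
proof -
  interpret R: orthonormal M UNIV "\<lambda>i. e (g i)" by (rule orthonormal_reindex[OF assms])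
  show ?thesis
    unfolding R.comb_def comb_def
    by (simp add: sum.reindex[OF inj_on_subset[OF assms(1) subset_UNIV]] inv_f_f[OF assms(1)])
qed

section \<open>Zeros of finite-dimensional maps\<close>

text \<open>Acute-angle form of Brouwer's theorem on a cube. The dimension is an ordinary variable
  here, so the argument starts from Kuhn's combinatorial lemma and not from the
  library's type-indexed fixed point theorem.\<close>
lemma zero_of_coercive:
  fixes G :: "(nat \<Rightarrow> real) \<Rightarrow> nat \<Rightarrow> real"
  assumes R: "R > 0"
    and cont: "\<And>X c i. (\<And>k j. \<bar>X k j\<bar> \<le> R) \<Longrightarrow> (\<And>j. (\<lambda>k. X k j) \<longlonglongrightarrow> c j) \<Longrightarrow> i < n \<Longrightarrow>
      (\<lambda>k. G (X k) i) \<longlonglongrightarrow> G c i"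
    and pos: "\<And>c. (\<And>j. \<bar>c j\<bar> \<le> R) \<Longrightarrow> (\<exists>j<n. \<bar>c j\<bar> = R) \<Longrightarrow> 0 < (\<Sum>i<n. c i * G c i)"
  obtains c where "\<And>j. \<bar>c j\<bar> \<le> R" "\<And>i. i < n \<Longrightarrow> G c i = 0"
proof -
  \<comment> \<open>Grid points with integer coordinates from 0 to \<open>p\<close> go to the cube
    [-R, R]^n. Coordinates from \<open>n\<close> on are set to 0, so that all of them stay bounded
    and converge.\<close>
  define pt where "pt = (\<lambda>(p::nat) (x::nat \<Rightarrow> nat) j. if j < n then - R + 2 * R * (x j / p) else 0)"
  \<comment> \<open>Kuhn's labelling: on the faces the values are those demanded by the
    combinatorial lemma; elsewhere the label records the sign of the i-th component, 0 standing for
    nonpositive.\<close>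
  define label where "label = (\<lambda>(p::nat) (x::nat \<Rightarrow> nat) i. if x i = 0 then (0::nat) else if x i = p then 1
      else if G (pt p x) i \<le> 0 then 0 else 1)"
  define near where "near = (\<lambda>(q::nat \<Rightarrow> nat) r. \<forall>j<n. q j \<le> r j \<and> r j \<le> q j + 1)"
  have ex: "\<exists>q. (\<forall>i<n. q i < p) \<and> (\<forall>i<n. \<exists>r s. near q r \<and> near q s \<and> label p r i = 0 \<and> label p s i = 1)"
    if "p > 0" for p
  proof -
    from \<open>p > 0\<close> have "\<forall>x. (\<forall>i<n. x i \<le> p) \<longrightarrow> (\<forall>i<n. label p x i = 0 \<or> label p x i = 1)"
      "\<forall>x. (\<forall>i<n. x i \<le> p) \<longrightarrow> (\<forall>i<n. x i = 0 \<longrightarrow> label p x i = 0)"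
      "\<forall>x. (\<forall>i<n. x i \<le> p) \<longrightarrow> (\<forall>i<n. x i = p \<longrightarrow> label p x i = 1)"
      by (auto simp: label_def)
    from kuhn_lemma[OF that this] obtain q where q: "\<forall>i<n. q i < p"
      and rs: "\<forall>i<n. \<exists>r s. (\<forall>j<n. q j \<le> r j \<and> r j \<le> q j + 1)
        \<and> (\<forall>j<n. q j \<le> s j \<and> s j \<le> q j + 1) \<and> label p r i \<noteq> label p s i" by metis
    have "\<exists>r s. near q r \<and> near q s \<and> label p r i = 0 \<and> label p s i = 1" if i: "i < n" for i
    proof -
      from rs i obtain r s where "near q r" "near q s" "label p r i \<noteq> label p s i"
        unfolding near_def by blast
      moreover have "label p x i = 0 \<or> label p x i = 1" for x by (simp add: label_def)
      ultimately show ?thesis by metis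
    qed
    with q show ?thesis by blast
  qed
  define good where "good = (\<lambda>p q i (r, s). near q r \<and> near q s \<and> label p r i = 0 \<and> label p s i = 1)"
  have "\<forall>k. \<exists>q. (\<forall>i<n. q i < Suc k) \<and> (\<forall>i<n. \<exists>rs. good (Suc k) q i rs)"
    using ex by (simp add: good_def)
  from choice[OF this] obtain q where q: "\<And>k i. i < n \<Longrightarrow> q k i < Suc k"
    and qrs: "\<And>k i. i < n \<Longrightarrow> \<exists>rs. good (Suc k) (q k) i rs" by blast
  define r where "r = (\<lambda>k i. fst (SOME rs. good (Suc k) (q k) i rs))"
  define s where "s = (\<lambda>k i. snd (SOME rs. good (Suc k) (q k) i rs))"
  have "good (Suc k) (q k) i (r k i, s k i)" if "i < n" for k i
    unfolding r_def s_def prod.collapse by (rule someI_ex[OF qrs[OF that]])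
  then have rs: "\<And>k i. i < n \<Longrightarrow> near (q k) (r k i)" "\<And>k i. i < n \<Longrightarrow> near (q k) (s k i)"
    "\<And>k i. i < n \<Longrightarrow> label (Suc k) (r k i) i = 0" "\<And>k i. i < n \<Longrightarrow> label (Suc k) (s k i) i = 1"
    by (simp_all add: good_def)
  have ptR: "\<bar>pt (Suc k) x j\<bar> \<le> R" if "\<And>j. j < n \<Longrightarrow> x j \<le> Suc k" for k x j
  proof (cases "j < n")
    case True
    have f: "0 \<le> real (x j) / real (Suc k)" "real (x j) / real (Suc k) \<le> 1"
      using that[OF True] by simp_all
    have "2 * R * (real (x j) / real (Suc k)) \<le> 2 * R * 1"
      using f R by (intro mult_left_mono) auto
    moreover have "0 \<le> 2 * R * (real (x j) / real (Suc k))" using f R by simp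
    ultimately show ?thesis using True by (simp add: pt_def)
  qed (use R in \<open>simp add: pt_def\<close>)
  have nearR: "x j \<le> Suc k" if "near (q k) x" "j < n" for k x j
    using that q[of j k] by (fastforce simp: near_def)
  define X where "X = (\<lambda>k. pt (Suc k) (q k))"
  have XR: "\<bar>X k j\<bar> \<le> R" for k j
    unfolding X_def by (rule ptR) (use q in \<open>simp add: less_imp_le\<close>)
  obtain \<phi> where \<phi>: "strict_mono (\<phi>::nat \<Rightarrow> nat)" and "\<And>j. j \<in> UNIV \<Longrightarrow> \<exists>l. (\<lambda>k. X (\<phi> k) j) \<longlonglongrightarrow> l"
    using function_convergent_subsequence[of UNIV X R] XR by auto
  then have "convergent (\<lambda>k. X (\<phi> k) j)" for j by (auto simp: convergent_def)
  then obtain c where c: "\<And>j. (\<lambda>k. X (\<phi> k) j) \<longlonglongrightarrow> c j"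
    using that[of "\<lambda>j. lim (\<lambda>k. X (\<phi> k) j)"] by (simp add: convergent_LIMSEQ_iff)
  have cR: "\<bar>c j\<bar> \<le> R" for j
    using tendsto_rabs[OF c[of j]] by (rule LIMSEQ_le_const2) (use XR in auto)
  \<comment> \<open>The cells have side 2 R / (k + 1), so every choice of vertices of the k-th cell
    has the same limit \<open>c\<close> along the subsequence.\<close>
  have near_lim: "(\<lambda>k. pt (Suc (\<phi> k)) (x (\<phi> k)) j) \<longlonglongrightarrow> c j" if "\<And>k. near (q k) (x k)" for x j
  proof -
    have d: "\<bar>pt (Suc k) (x k) j - X k j\<bar> \<le> 2 * R * (1 / Suc k)" for k
    proof (cases "j < n")
      case True
      have "\<bar>real (x k j) - real (q k j)\<bar> \<le> 1"
        using that[of k] True by (auto simp: near_def)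
      then have "\<bar>real (x k j) - real (q k j)\<bar> / Suc k \<le> 1 / Suc k"
        by (rule divide_right_mono) simp
      then have "2 * R * (\<bar>real (x k j) - real (q k j)\<bar> / Suc k) \<le> 2 * R * (1 / Suc k)"
        using R by (intro mult_left_mono) auto
      moreover have "\<bar>pt (Suc k) (x k) j - X k j\<bar> = 2 * R * (\<bar>real (x k j) - real (q k j)\<bar> / Suc k)"
      proof -
        have "pt (Suc k) (x k) j - X k j = 2 * R * ((real (x k j) - real (q k j)) / Suc k)"
          using True by (simp add: X_def pt_def algebra_simps diff_divide_distrib)
        then show ?thesis using R by (simp add: abs_mult)
      qed
      ultimately show ?thesis by simp
    qed (use R in \<open>simp add: pt_def X_def\<close>)
    have *: "(\<lambda>k. 2 * R * (1 / Suc k)) \<longlonglongrightarrow> 0"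
      using tendsto_mult[OF tendsto_const LIMSEQ_Suc[OF lim_1_over_n], of "2 * R"] by simp
    have "(\<lambda>k. pt (Suc k) (x k) j - X k j) \<longlonglongrightarrow> 0"
      by (rule Lim_null_comparison[OF _ *]) (use d in \<open>simp del: of_nat_Suc\<close>)
    from tendsto_add[OF LIMSEQ_subseq_LIMSEQ[OF this \<phi>] c[of j]] show ?thesis
      by (simp add: o_def)
  qed
  \<comment> \<open>The vertices \<open>r\<close> carry label 0 in coordinate \<open>i\<close>: in
    the limit either the coordinate lies on the lower face or the component is nonpositive. The
    vertices \<open>s\<close> give the mirror statement \<open>upper\<close>.\<close>
  have lower: "c i = - R \<or> G c i \<le> 0" if i: "i < n" for i
  proof (rule ccontr)
    assume "\<not> ?thesis"
    then have a: "c i > - R" "G c i > 0" using cR[of i] by auto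
    let ?Z = "\<lambda>k. pt (Suc (\<phi> k)) (r (\<phi> k) i)"
    have l: "(\<lambda>k. ?Z k j) \<longlonglongrightarrow> c j" for j using near_lim[of "\<lambda>k. r k i"] rs(1) i by blast
    have "(\<lambda>k. G (?Z k) i) \<longlonglongrightarrow> G c i"
      by (rule cont[OF _ l i]) (rule ptR, use nearR rs(1) i in blast)
    then have "\<forall>\<^sub>F k in sequentially. G (?Z k) i > 0" using a(2) by (rule order_tendstoD)
    moreover have "\<forall>\<^sub>F k in sequentially. ?Z k i > - R" using l a(1) by (rule order_tendstoD)
    ultimately have "\<forall>\<^sub>F k in sequentially. False"
    proof eventually_elim
      case (elim k)
      have "r (\<phi> k) i i \<noteq> 0" using elim(2) i by (intro notI) (simp add: pt_def)
      with elim(1) have "label (Suc (\<phi> k)) (r (\<phi> k) i) i = 1"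
        by (auto simp: label_def)
      then show ?case using rs(3)[OF i] by simp
    qed
    then show False by simp
  qed
  have upper: "c i = R \<or> G c i \<ge> 0" if i: "i < n" for i
  proof (rule ccontr)
    assume "\<not> ?thesis"
    then have a: "c i < R" "G c i < 0" using cR[of i] by auto
    let ?Z = "\<lambda>k. pt (Suc (\<phi> k)) (s (\<phi> k) i)"
    have l: "(\<lambda>k. ?Z k j) \<longlonglongrightarrow> c j" for j using near_lim[of "\<lambda>k. s k i"] rs(2) i by blast
    have "(\<lambda>k. G (?Z k) i) \<longlonglongrightarrow> G c i"
      by (rule cont[OF _ l i]) (rule ptR, use nearR rs(2) i in blast)
    then have "\<forall>\<^sub>F k in sequentially. G (?Z k) i < 0" using a(2) by (rule order_tendstoD)
    moreover have "\<forall>\<^sub>F k in sequentially. ?Z k i < R" using l a(1) by (rule order_tendstoD)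
    ultimately have "\<forall>\<^sub>F k in sequentially. False"
    proof eventually_elim
      case (elim k)
      have "s (\<phi> k) i i \<noteq> Suc (\<phi> k)" using elim(2) i by (auto simp: pt_def simp del: of_nat_Suc)
      with elim(1) have "label (Suc (\<phi> k)) (s (\<phi> k) i) i = 0"
        by (auto simp: label_def)
      then show ?case using rs(4)[OF i] by simp
    qed
    then show False by simp
  qed
  \<comment> \<open>Where \<open>c i\<close> = -R, \<open>upper\<close> gives a nonnegative
    component; where \<open>c i\<close> = R, \<open>lower\<close> gives a nonpositive one; elsewhere
    it is 0. The sum is thus nonpositive, which \<open>pos\<close> forbids on the boundary of the
    cube.\<close>
  have "c i * G c i \<le> 0" if "i < n" for i
    using lower[OF that] upper[OF that] R by (auto simp: mult_le_0_iff)
  then have "(\<Sum>i<n. c i * G c i) \<le> 0" by (intro sum_nonpos) auto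
  then have nb: "\<bar>c j\<bar> \<noteq> R" if "j < n" for j using pos[of c] cR that by force
  have "G c i = 0" if "i < n" for i
    using lower[OF that] upper[OF that] nb[OF that] R by auto
  with cR that show ?thesis by blast
qed

text \<open>Compactness of the unit sphere: if no \<delta> worked, unit vectors with form below 1/(k
  + 1) would have a convergent subsequence, and its limit would be a unit vector with nonpositive
  form.\<close>

lemma positive_definite_coercive:
  fixes A :: "nat \<Rightarrow> nat \<Rightarrow> real"
  assumes E: "finite E"
    and pos: "\<And>c. \<exists>i\<in>E. c i \<noteq> 0 \<Longrightarrow> 0 < (\<Sum>i\<in>E. \<Sum>j\<in>E. A i j * c i * c j)"
  obtains \<delta> where "\<delta> > 0" "\<And>c. \<delta> * (\<Sum>i\<in>E. (c i)\<^sup>2) \<le> (\<Sum>i\<in>E. \<Sum>j\<in>E. A i j * c i * c j)"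
proof -
  define Q where "Q = (\<lambda>c. \<Sum>i\<in>E. \<Sum>j\<in>E. A i j * c i * c j)"
  have "\<exists>\<delta>>0. \<forall>c. \<delta> * (\<Sum>i\<in>E. (c i)\<^sup>2) \<le> Q c"
  proof (rule ccontr)
    assume neg: "\<not> ?thesis"
    have "\<exists>c. (\<Sum>i\<in>E. (c i)\<^sup>2) = 1 \<and> Q c < 1 / Suc k" for k
    proof -
      from neg obtain c where c: "Q c < 1 / Suc k * (\<Sum>i\<in>E. (c i)\<^sup>2)" (is "_ < _ * ?s")
        by (meson not_le zero_less_divide_1_iff of_nat_0_less_iff zero_less_Suc)
      have "?s \<noteq> 0"
      proof
        assume "?s = 0"
        then have "\<forall>i\<in>E. c i = 0" using E by (simp add: sum_nonneg_eq_0_iff)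
        then have "Q c = 0" by (simp add: Q_def)
        with c \<open>?s = 0\<close> show False by simp
      qed
      moreover have "0 \<le> ?s" by (simp add: sum_nonneg)
      ultimately have s: "?s > 0" by linarith
      define d where "d = (\<lambda>i. c i / sqrt ?s)"
      have "(\<Sum>i\<in>E. (d i)\<^sup>2) = 1"
        using s by (simp add: d_def power_divide sum_divide_distrib[symmetric])
      moreover have "Q d = Q c / ?s"
      proof -
        have "A i j * d i * d j = A i j * c i * c j / ?s" for i j
          using s by (simp add: d_def)
        then show ?thesis by (simp add: Q_def sum_divide_distrib)
      qed
      moreover have "Q c / ?s < 1 / Suc k"
        using c s by (simp only: pos_divide_less_eq)
      ultimately show ?thesis by (intro exI[of _ d]) simp
    qed
    then obtain X where X: "\<And>k. (\<Sum>i\<in>E. (X k i)\<^sup>2) = 1" "\<And>k. Q (X k) < 1 / Suc k" by metis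
    have "norm (X k i) \<le> 1" if "i \<in> E" for k i
    proof -
      have "(X k i)\<^sup>2 \<le> (\<Sum>i\<in>E. (X k i)\<^sup>2)" using E that by (intro member_le_sum) auto
      then show ?thesis using X(1)[of k] by (simp add: abs_square_le_1)
    qed
    with function_convergent_subsequence[of E X 1] E obtain \<phi>
      where \<phi>: "strict_mono (\<phi>::nat \<Rightarrow> nat)" and "\<And>j. j \<in> E \<Longrightarrow> \<exists>l. (\<lambda>k. X (\<phi> k) j) \<longlonglongrightarrow> l"
      using countable_finite by blast
    then have "convergent (\<lambda>k. X (\<phi> k) j)" if "j \<in> E" for j using that by (auto simp: convergent_def)
    then obtain c where c: "\<And>j. j \<in> E \<Longrightarrow> (\<lambda>k. X (\<phi> k) j) \<longlonglongrightarrow> c j"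
      using that[of "\<lambda>j. lim (\<lambda>k. X (\<phi> k) j)"] by (simp add: convergent_LIMSEQ_iff)
    have "(\<lambda>k. \<Sum>i\<in>E. (X (\<phi> k) i)\<^sup>2) \<longlonglongrightarrow> (\<Sum>i\<in>E. (c i)\<^sup>2)"
      by (intro tendsto_sum tendsto_power c)
    then have "(\<Sum>i\<in>E. (c i)\<^sup>2) = 1" using X(1) by (simp add: LIMSEQ_const_iff)
    then have "\<exists>i\<in>E. c i \<noteq> 0" by (rule contrapos_pp) simp
    from pos[OF this] have "0 < Q c" by (simp add: Q_def)
    moreover have "(\<lambda>k. Q (X (\<phi> k))) \<longlonglongrightarrow> Q c"
      unfolding Q_def by (intro tendsto_sum tendsto_mult tendsto_const c)
    moreover have "(\<lambda>k. 1 / Suc (\<phi> k)) \<longlonglongrightarrow> 0"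
      using LIMSEQ_subseq_LIMSEQ[OF LIMSEQ_Suc[OF lim_1_over_n] \<phi>] by (simp add: o_def)
    ultimately have "Q c \<le> 0"
      using X(2) by (intro LIMSEQ_le[of "\<lambda>k. Q (X (\<phi> k))" "Q c" "\<lambda>k. 1 / Suc (\<phi> k)"]) (auto intro: less_imp_le)
    with \<open>0 < Q c\<close> show False by simp
  qed
  then show ?thesis using that unfolding Q_def by blast
qed

section \<open>Galerkin solutions of asymptotically linear problems\<close>

lemma integral_square: "(LINT x|M. (f x)\<^sup>2) = (nrm M f)\<^sup>2"
  by (simp add: nrm_def ip_def power2_eq_square[of "f _"])

lemma sq_int_weight:
  assumes "b \<in> borel_measurable M" "AE x in M. \<bar>b x\<bar> \<le> B" "sq_int M f"
  shows "sq_int M (\<lambda>x. b x * f x)"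
proof (rule sq_int_bound[of M "\<lambda>x. B * f x"])
  show "AE x in M. \<bar>b x * f x\<bar> \<le> \<bar>B * f x\<bar>"
    using assms(2) by eventually_elim (auto simp: abs_mult intro!: mult_right_mono)
qed (use assms in \<open>auto simp: sq_int_def[of M f] intro: sq_int_cmult\<close>)

lemma integrable_weight:
  assumes "b \<in> borel_measurable M" "AE x in M. \<bar>b x\<bar> \<le> B" "sq_int M f"
  shows "integrable M (\<lambda>x. b x * (f x)\<^sup>2)"
  using integrable_mult_sq_int[OF sq_int_weight[OF assms] assms(3)]
  by (simp add: power2_eq_square mult.assoc)

text \<open>Rewrites a weighted integral as a finite quadratic form in the coefficients, so that
  \<open>positive_definite_coercive\<close> applies on an eigenspace.\<close>

lemma (in orthonormal) quadratic_comb: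
  assumes "E \<subseteq> I" "b \<in> borel_measurable M" "AE x in M. \<bar>b x\<bar> \<le> B"
  shows "(LINT x|M. b x * (comb E c x)\<^sup>2) = (\<Sum>i\<in>E. \<Sum>j\<in>E. (LINT x|M. b x * (e i x * e j x)) * c i * c j)"
proof -
  have int: "integrable M (\<lambda>x. b x * (e i x * e j x))" if "i \<in> E" "j \<in> E" for i j
    using integrable_mult_sq_int[OF sq_int_weight[OF assms(2,3) sq_e[of i]] sq_e[of j]] that assms(1)
    by (auto simp: mult.assoc)
  have "b x * (comb E c x)\<^sup>2 = (\<Sum>i\<in>E. \<Sum>j\<in>E. b x * (e i x * e j x) * (c i * c j))" for x
    by (simp add: comb_def power2_eq_square sum_product sum_distrib_left ac_simps)
  then have "(LINT x|M. b x * (comb E c x)\<^sup>2) = (LINT x|M. (\<Sum>i\<in>E. \<Sum>j\<in>E. b x * (e i x * e j x) * (c i * c j)))"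
    by simp
  also have "\<dots> = (\<Sum>i\<in>E. LINT x|M. (\<Sum>j\<in>E. b x * (e i x * e j x) * (c i * c j)))"
    by (rule Bochner_Integration.integral_sum)
      (intro Bochner_Integration.integrable_sum integrable_mult_left int)
  also have "\<dots> = (\<Sum>i\<in>E. \<Sum>j\<in>E. LINT x|M. b x * (e i x * e j x) * (c i * c j))"
    by (intro sum.cong refl Bochner_Integration.integral_sum integrable_mult_left int)
  also have "\<dots> = (\<Sum>i\<in>E. \<Sum>j\<in>E. (LINT x|M. b x * (e i x * e j x)) * c i * c j)"
    by (simp only: integral_mult_left_zero mult.assoc[symmetric])
  finally show ?thesis .
qed

text \<open>On the eigenspace of \<open>h\<close> the bound comes from finite dimension; above it from
  the spectral gap; the mixed term is split with \<open>2 w z \<ge> - w\<^sup>2 / (1 + r) - (1 + r) z\<^sup>2\<close>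
  for a small \<open>r\<close>.\<close>
lemma one_sided_coercivity:
  fixes e :: "nat \<Rightarrow> 'a \<Rightarrow> real" and nu :: "nat \<Rightarrow> real"
  assumes on: "orthonormal M UNIV e"
    and fin: "finite {i. h \<le> nu i \<and> nu i \<le> h + 1}"
    and b: "b \<in> borel_measurable M" "AE x in M. b x \<le> h" "AE x in M. h - b x \<le> K"
    and pos: "\<And>c E. finite E \<Longrightarrow> \<forall>i\<in>E. nu i = h \<Longrightarrow> \<exists>i\<in>E. c i \<noteq> 0 \<Longrightarrow>
      0 < (LINT x|M. (h - b x) * (orthonormal.comb e E c x)\<^sup>2)"
  obtains \<delta> where "\<delta> > 0" "\<And>F c. finite F \<Longrightarrow> \<forall>i\<in>F. h \<le> nu i \<Longrightarrow>
    \<delta> * (\<Sum>i\<in>F. (c i)\<^sup>2) \<le> (\<Sum>i\<in>F. nu i * (c i)\<^sup>2) - (LINT x|M. b x * (orthonormal.comb e F c x)\<^sup>2)"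
proof -
  interpret orthonormal M UNIV e by (rule on)
  define k where "k = (\<lambda>x. h - b x)"
  define K1 where "K1 = \<bar>K\<bar> + 1"
  have K1: "K1 > 0" by (simp add: K1_def)
  have km [measurable]: "k \<in> borel_measurable M" using b(1) by (simp add: k_def)
  have k0: "AE x in M. 0 \<le> k x" using b(2) by (simp add: k_def)
  have k1: "AE x in M. k x \<le> K1" using b(3) by eventually_elim (auto simp: k_def K1_def)
  have kb: "AE x in M. \<bar>k x\<bar> \<le> K1" using k0 k1 by eventually_elim simp
  have intk: "integrable M (\<lambda>x. k x * (comb F c x)\<^sup>2)" for F c
    by (rule integrable_weight[OF km kb sq_comb]) simp
  define E where "E = {i. nu i = h}"
  have finE: "finite E" by (rule finite_subset[OF _ fin]) (auto simp: E_def)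
  obtain d0 where d0: "d0 > 0"
    "\<And>c. d0 * (\<Sum>i\<in>E. (c i)\<^sup>2) \<le> (LINT x|M. k x * (comb E c x)\<^sup>2)"
  proof -
    have P: "0 < (\<Sum>i\<in>E. \<Sum>j\<in>E. (LINT x|M. k x * (e i x * e j x)) * c i * c j)"
      if "\<exists>i\<in>E. c i \<noteq> 0" for c
    proof -
      have "0 < (LINT x|M. k x * (comb E c x)\<^sup>2)"
        using pos[OF finE _ that] by (simp add: E_def k_def)
      then show ?thesis unfolding quadratic_comb[OF subset_UNIV km kb] .
    qed
    show ?thesis
      using positive_definite_coercive[OF finE P] that
      unfolding quadratic_comb[OF subset_UNIV km kb] by blast
  qed
  \<comment> \<open>Its minimum \<open>\<eta>\<close> is a lower bound for the distance from
    \<open>h\<close> to the larger values of \<open>nu\<close>: finitely many indices lie below h +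
    1, and the inserted 1 serves all others.\<close>
  define D where "D = insert 1 ((\<lambda>i. nu i - h) ` {i. h < nu i \<and> nu i \<le> h + 1})"
  have finD: "finite D"
    unfolding D_def by (intro finite.insertI finite_imageI finite_subset[OF _ fin]) auto
  define \<eta> where "\<eta> = Min D"
  have "\<eta> \<in> D" unfolding \<eta>_def using finD by (intro Min_in) (auto simp: D_def)
  then have \<eta>0: "\<eta> > 0" by (auto simp: D_def)
  have \<eta>: "\<eta> \<le> nu i - h" if "h < nu i" for i
  proof (cases "nu i \<le> h + 1")
    case True
    with that show ?thesis unfolding \<eta>_def using finD by (intro Min_le) (auto simp: D_def)
  next
    case False
    have "\<eta> \<le> 1" unfolding \<eta>_def using finD by (intro Min_le) (auto simp: D_def)
    with False show ?thesis by simp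
  qed
  \<comment> \<open>With this \<open>r\<close> the loss r K1 |z|^2 from the mixed term is half of
    the gain \<eta> |z|^2 from the spectral gap.\<close>
  define r where "r = \<eta> / (2 * K1)"
  have r: "r > 0" using \<eta>0 K1 by (simp add: r_def)
  define \<delta> where "\<delta> = min (\<eta> / 2) (r / (1 + r) * d0)"
  have \<delta>0: "\<delta> > 0" using \<eta>0 r d0 by (simp add: \<delta>_def)
  have main: "\<delta> * (\<Sum>i\<in>F. (c i)\<^sup>2) \<le> (\<Sum>i\<in>F. nu i * (c i)\<^sup>2) - (LINT x|M. b x * (comb F c x)\<^sup>2)"
    if F: "finite F" "\<forall>i\<in>F. h \<le> nu i" for F c
  proof -
    let ?W = "F \<inter> E" and ?Z = "F - E"
    let ?w = "comb ?W c" and ?z = "comb ?Z c"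
    have split: "(\<Sum>i\<in>F. g i) = (\<Sum>i\<in>?W. g i) + (\<Sum>i\<in>?Z. g i)" for g :: "nat \<Rightarrow> real"
      using F(1) by (simp add: sum.Int_Diff)
    have y: "comb F c x = ?w x + ?z x" for x
      using split by (simp add: comb_def)
    have "(\<Sum>i\<in>F. nu i * (c i)\<^sup>2) - (LINT x|M. b x * (comb F c x)\<^sup>2)
        = (\<Sum>i\<in>F. (nu i - h) * (c i)\<^sup>2) + (LINT x|M. k x * (comb F c x)\<^sup>2)"
    proof -
      have "(LINT x|M. b x * (comb F c x)\<^sup>2) = (LINT x|M. h * (comb F c x)\<^sup>2 - k x * (comb F c x)\<^sup>2)"
        by (simp add: k_def algebra_simps)
      also have "\<dots> = (LINT x|M. h * (comb F c x)\<^sup>2) - (LINT x|M. k x * (comb F c x)\<^sup>2)"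
        using sq_comb[of F c] intk by (intro Bochner_Integration.integral_diff) (auto simp: sq_int_def)
      also have "(LINT x|M. h * (comb F c x)\<^sup>2) = h * (\<Sum>i\<in>F. (c i)\<^sup>2)"
        using F(1) by (simp add: integral_square nrm_comb)
      finally show ?thesis by (simp add: left_diff_distrib sum_subtractf sum_distrib_left)
    qed
    moreover have "\<eta> * (\<Sum>i\<in>?Z. (c i)\<^sup>2) \<le> (\<Sum>i\<in>F. (nu i - h) * (c i)\<^sup>2)"
    proof -
      have "\<eta> * (\<Sum>i\<in>?Z. (c i)\<^sup>2) \<le> (\<Sum>i\<in>?Z. (nu i - h) * (c i)\<^sup>2)"
        unfolding sum_distrib_left using F(2)
        by (intro sum_mono mult_right_mono \<eta>) (auto simp: E_def order_less_le)
      moreover have "(\<Sum>i\<in>?W. (nu i - h) * (c i)\<^sup>2) = 0" by (intro sum.neutral) (auto simp: E_def)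
      ultimately show ?thesis by (simp add: split)
    qed
    moreover have "r / (1 + r) * d0 * (\<Sum>i\<in>?W. (c i)\<^sup>2) - \<eta> / 2 * (\<Sum>i\<in>?Z. (c i)\<^sup>2)
        \<le> (LINT x|M. k x * (comb F c x)\<^sup>2)"
    proof -
      have "(LINT x|M. r / (1 + r) * (k x * (?w x)\<^sup>2) - r * K1 * (?z x)\<^sup>2) \<le> (LINT x|M. k x * (comb F c x)\<^sup>2)"
      proof (rule integral_mono_AE)
        show "integrable M (\<lambda>x. r / (1 + r) * (k x * (?w x)\<^sup>2) - r * K1 * (?z x)\<^sup>2)"
          using sq_comb[of ?Z c]
          by (intro Bochner_Integration.integrable_diff integrable_mult_right intk) (auto simp: sq_int_def)
        show "AE x in M. r / (1 + r) * (k x * (?w x)\<^sup>2) - r * K1 * (?z x)\<^sup>2 \<le> k x * (comb F c x)\<^sup>2"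
          using k0 k1
        proof eventually_elim
          case (elim x)
          have "0 \<le> (?w x + (1 + r) * ?z x)\<^sup>2 / (1 + r)" using r by simp
          also have "\<dots> = (?w x)\<^sup>2 / (1 + r) + 2 * ?w x * ?z x + (1 + r) * (?z x)\<^sup>2"
            using r by (simp add: field_simps power2_eq_square)
          finally have "r / (1 + r) * (?w x)\<^sup>2 - r * (?z x)\<^sup>2 \<le> (?w x + ?z x)\<^sup>2"
            using r by (simp add: field_simps power2_eq_square)
          from mult_left_mono[OF this elim(1)]
          have "k x * (r / (1 + r) * (?w x)\<^sup>2) - k x * (r * (?z x)\<^sup>2) \<le> k x * (comb F c x)\<^sup>2"
            by (simp add: y right_diff_distrib)
          moreover have "k x * (r * (?z x)\<^sup>2) \<le> K1 * (r * (?z x)\<^sup>2)"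
            using elim(2) r by (intro mult_right_mono) auto
          ultimately show ?case by (simp add: ac_simps)
        qed
      qed (rule intk)
      moreover have "(LINT x|M. r / (1 + r) * (k x * (?w x)\<^sup>2) - r * K1 * (?z x)\<^sup>2)
          = r / (1 + r) * (LINT x|M. k x * (?w x)\<^sup>2) - r * K1 * (\<Sum>i\<in>?Z. (c i)\<^sup>2)"
      proof -
        have "(LINT x|M. (?z x)\<^sup>2) = (\<Sum>i\<in>?Z. (c i)\<^sup>2)"
          using F(1) by (simp add: integral_square nrm_comb)
        then show ?thesis
          using intk[of ?W c] sq_comb[of ?Z c] by (simp add: sq_int_def)
      qed
      moreover have "d0 * (\<Sum>i\<in>?W. (c i)\<^sup>2) \<le> (LINT x|M. k x * (?w x)\<^sup>2)"
      proof -
        \<comment> \<open>\<open>F\<close> may miss part of the eigenspace \<open>E\<close>; padding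
          with zeros makes the finite-dimensional bound on \<open>E\<close> applicable.\<close>
        define c' where "c' = (\<lambda>i. if i \<in> F then c i else 0)"
        have "comb E c' x = ?w x" for x
          unfolding comb_def c'_def using finE
          by (intro sum.mono_neutral_cong_right) auto
        moreover have "(\<Sum>i\<in>E. (c' i)\<^sup>2) = (\<Sum>i\<in>?W. (c i)\<^sup>2)"
          unfolding c'_def using finE by (intro sum.mono_neutral_cong_right) auto
        ultimately show ?thesis using d0(2)[of c'] by simp
      qed
      then have "r / (1 + r) * (d0 * (\<Sum>i\<in>?W. (c i)\<^sup>2)) \<le> r / (1 + r) * (LINT x|M. k x * (?w x)\<^sup>2)"
        using r by (intro mult_left_mono) auto
      moreover have "r * K1 = \<eta> / 2" using K1 by (simp add: r_def)
      ultimately show ?thesis by (simp add: mult.assoc)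
    qed
    moreover have "\<delta> * (\<Sum>i\<in>F. (c i)\<^sup>2) \<le> r / (1 + r) * d0 * (\<Sum>i\<in>?W. (c i)\<^sup>2) + \<eta> / 2 * (\<Sum>i\<in>?Z. (c i)\<^sup>2)"
    proof -
      have "\<delta> \<le> r / (1 + r) * d0" "\<delta> \<le> \<eta> / 2"
        unfolding \<delta>_def by (rule min.cobounded2 min.cobounded1)+
      then show ?thesis
        unfolding split distrib_left by (intro add_mono mult_right_mono sum_nonneg) auto
    qed
    ultimately show ?thesis by simp
  qed
  from \<delta>0 main show ?thesis by (rule that)
qed

text \<open>The abstract equation L y = N(y) with L diagonal in \<open>e\<close>. Discreteness
  \<open>fin\<close> plays the part of a compact resolvent. In \<open>N_growth\<close> the slope
  \<open>a\<close> may vary with \<open>x\<close> and \<open>y\<close>; this merges the limits of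
  f1/y and f2/y with the local bound on f, the error on bounded \<open>y\<close> being absorbed by
  \<open>h\<close>.\<close>

locale asymptotically_linear = orthonormal M "UNIV :: nat set" e
  for M :: "'a measure" and e +
  fixes nu :: "nat \<Rightarrow> real" and lo hi :: real and \<alpha> \<beta> :: "'a \<Rightarrow> real" and N :: "'a \<Rightarrow> real \<Rightarrow> real"
  assumes fin: "\<And>K. finite {i. \<bar>nu i\<bar> \<le> K}"
    and lohi: "lo < hi" and gap: "\<And>i. nu i \<le> lo \<or> hi \<le> nu i"
    and meas_\<alpha> [measurable]: "\<alpha> \<in> borel_measurable M"
    and meas_\<beta> [measurable]: "\<beta> \<in> borel_measurable M"
    and \<alpha>\<beta>: "AE x in M. lo \<le> \<alpha> x \<and> \<alpha> x \<le> \<beta> x \<and> \<beta> x \<le> hi"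
    and nonres_lo: "\<And>E c. finite E \<Longrightarrow> \<forall>i\<in>E. nu i = lo \<Longrightarrow> \<exists>i\<in>E. c i \<noteq> 0 \<Longrightarrow>
      0 < (LINT x|M. (\<alpha> x - lo) * (comb E c x)\<^sup>2)"
    and nonres_hi: "\<And>E c. finite E \<Longrightarrow> \<forall>i\<in>E. nu i = hi \<Longrightarrow> \<exists>i\<in>E. c i \<noteq> 0 \<Longrightarrow>
      0 < (LINT x|M. (hi - \<beta> x) * (comb E c x)\<^sup>2)"
    and N_meas: "\<And>y. y \<in> borel_measurable M \<Longrightarrow> (\<lambda>x. N x (y x)) \<in> borel_measurable M"
    and N_cont: "AE x in M. continuous_on UNIV (N x)"
    and N_growth: "\<And>\<epsilon>. \<epsilon> > 0 \<Longrightarrow> \<exists>h. sq_int M h \<and>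
      (AE x in M. \<forall>y. \<exists>a. \<alpha> x - \<epsilon> \<le> a \<and> a \<le> \<beta> x + \<epsilon> \<and> \<bar>N x y - a * y\<bar> \<le> h x)"
begin

definition Nem :: "('a \<Rightarrow> real) \<Rightarrow> 'a \<Rightarrow> real" where "Nem y = (\<lambda>x. N x (y x))"

text \<open>Bounds the slopes of \<open>N_growth\<close> for \<epsilon> = 1, which lie between lo -
  1 and hi + 1.\<close>

definition C0 :: real where "C0 = \<bar>lo\<bar> + \<bar>hi\<bar> + 1"

lemma linear_growth:
  obtains h where "sq_int M h" "AE x in M. \<forall>y. \<bar>N x y\<bar> \<le> C0 * \<bar>y\<bar> + h x"
proof -
  obtain h where h: "sq_int M h"
    "AE x in M. \<forall>y. \<exists>a. \<alpha> x - 1 \<le> a \<and> a \<le> \<beta> x + 1 \<and> \<bar>N x y - a * y\<bar> \<le> h x"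
    using N_growth[of 1] by auto
  have "AE x in M. \<forall>y. \<bar>N x y\<bar> \<le> C0 * \<bar>y\<bar> + h x"
    using h(2) \<alpha>\<beta>
  proof eventually_elim
    case (elim x)
    show ?case
    proof
      fix y
      obtain a where a: "\<alpha> x - 1 \<le> a" "a \<le> \<beta> x + 1" "\<bar>N x y - a * y\<bar> \<le> h x"
        using elim(1) by blast
      have "\<bar>a\<bar> \<le> C0" using a elim(2) unfolding C0_def by linarith
      then have "\<bar>a * y\<bar> \<le> C0 * \<bar>y\<bar>" by (simp add: abs_mult mult_right_mono)
      with a(3) show "\<bar>N x y\<bar> \<le> C0 * \<bar>y\<bar> + h x" by linarith
    qed
  qed
  with h(1) that show ?thesis by blast
qed

lemma sq_Nem:
  assumes y: "sq_int M y" shows "sq_int M (Nem y)"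
proof -
  obtain h where h: "sq_int M h" "AE x in M. \<forall>y. \<bar>N x y\<bar> \<le> C0 * \<bar>y\<bar> + h x" by (rule linear_growth)
  show ?thesis
  proof (rule sq_int_bound[of M "\<lambda>x. C0 * \<bar>y x\<bar> + h x"])
    show "AE x in M. \<bar>Nem y x\<bar> \<le> \<bar>C0 * \<bar>y x\<bar> + h x\<bar>"
      using h(2)
    proof eventually_elim
      case (elim x)
      then show ?case unfolding Nem_def using elim[rule_format, of "y x"] by linarith
    qed
    show "Nem y \<in> borel_measurable M" unfolding Nem_def using y by (intro N_meas) (simp add: sq_int_def)
  qed (intro sq_int_add sq_int_cmult sq_int_abs y h)
qed

lemma nrm_Nem:
  obtains H where "\<And>y. sq_int M y \<Longrightarrow> nrm M (Nem y) \<le> C0 * nrm M y + H"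
proof -
  obtain h where h: "sq_int M h" "AE x in M. \<forall>y. \<bar>N x y\<bar> \<le> C0 * \<bar>y\<bar> + h x" by (rule linear_growth)
  have "nrm M (Nem y) \<le> C0 * nrm M y + nrm M h" if y: "sq_int M y" for y
  proof -
    have "nrm M (Nem y) \<le> nrm M (\<lambda>x. C0 * \<bar>y x\<bar> + h x)"
    proof (rule nrm_mono)
      show "AE x in M. \<bar>Nem y x\<bar> \<le> \<bar>C0 * \<bar>y x\<bar> + h x\<bar>"
        using h(2)
      proof eventually_elim
        case (elim x)
        then show ?case unfolding Nem_def using elim[rule_format, of "y x"] by linarith
      qed
      show "Nem y \<in> borel_measurable M" using sq_Nem[OF y] by (simp add: sq_int_def)
    qed (intro sq_int_add sq_int_cmult sq_int_abs y h)
    also have "\<dots> \<le> nrm M (\<lambda>x. C0 * \<bar>y x\<bar>) + nrm M h"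
      by (intro nrm_triangle sq_int_cmult sq_int_abs y h)
    also have "nrm M (\<lambda>x. C0 * \<bar>y x\<bar>) = C0 * nrm M y"
      unfolding nrm_cmult nrm_abs by (simp add: C0_def)
    finally show ?thesis by simp
  qed
  with that show ?thesis by blast
qed

text \<open>Dominated convergence with majorant (C0 G + h) |g|. It serves twice: for continuity of
  the finite-dimensional maps and for the passage to the limit in the mode equations.\<close>

lemma tendsto_ip_Nem:
  assumes Y: "\<And>k. Y k \<in> borel_measurable M" "y \<in> borel_measurable M"
    and lim: "AE x in M. (\<lambda>k. Y k x) \<longlonglongrightarrow> y x"
    and dom: "AE x in M. \<forall>k. \<bar>Y k x\<bar> \<le> G x" and G: "sq_int M G" and g: "sq_int M g"
  shows "(\<lambda>k. ip M (Nem (Y k)) g) \<longlonglongrightarrow> ip M (Nem y) g"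
proof -
  obtain h where h: "sq_int M h" "AE x in M. \<forall>y. \<bar>N x y\<bar> \<le> C0 * \<bar>y\<bar> + h x" by (rule linear_growth)
  have gm: "g \<in> borel_measurable M" using g by (simp add: sq_int_def)
  have Nm: "Nem z \<in> borel_measurable M" if "z \<in> borel_measurable M" for z
    unfolding Nem_def by (rule N_meas[OF that])
  show ?thesis
    unfolding ip_def
  proof (rule integral_dominated_convergence[where w = "\<lambda>x. (C0 * G x + h x) * \<bar>g x\<bar>"])
    show "(\<lambda>x. Nem y x * g x) \<in> borel_measurable M" "\<And>k. (\<lambda>x. Nem (Y k) x * g x) \<in> borel_measurable M"
      using Nm[OF Y(2)] Nm[OF Y(1)] gm by auto
    show "integrable M (\<lambda>x. (C0 * G x + h x) * \<bar>g x\<bar>)"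
      by (intro integrable_mult_sq_int sq_int_add sq_int_cmult sq_int_abs G g h)
    show "AE x in M. (\<lambda>k. Nem (Y k) x * g x) \<longlonglongrightarrow> Nem y x * g x"
      using lim N_cont
    proof eventually_elim
      case (elim x)
      show ?case unfolding Nem_def
        by (intro tendsto_mult tendsto_const continuous_on_tendsto_compose[OF elim(2) elim(1)]) auto
    qed
    show "AE x in M. norm (Nem (Y k) x * g x) \<le> (C0 * G x + h x) * \<bar>g x\<bar>" for k
      using dom h(2)
    proof eventually_elim
      case (elim x)
      have "\<bar>Nem (Y k) x\<bar> \<le> C0 * \<bar>Y k x\<bar> + h x" unfolding Nem_def using elim(2) by blast
      also have "C0 * \<bar>Y k x\<bar> \<le> C0 * G x" using elim(1) by (intro mult_left_mono) (auto simp: C0_def)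
      finally show ?case by (simp add: abs_mult mult_right_mono)
    qed
  qed
qed

text \<open>The multiplier y_+ - y_- in coordinates; by \<open>gap\<close> the value -1 means
  \<open>nu i \<le> lo\<close>.\<close>

definition sg :: "nat \<Rightarrow> real" where "sg i = (if hi \<le> nu i then 1 else - 1)"

text \<open>The lower part is the upper part for the reflected data -nu, -lo, -\<alpha>, so
  \<open>one_sided_coercivity\<close> is used twice.\<close>

lemma two_sided_coercivity:
  obtains \<delta> where "\<delta> > 0" "\<And>n c. \<delta> * (\<Sum>i<n. (c i)\<^sup>2) \<le> (\<Sum>i<n. sg i * nu i * (c i)\<^sup>2)
    - (LINT x|M. \<beta> x * (comb {i\<in>{..<n}. hi \<le> nu i} c x)\<^sup>2)
    + (LINT x|M. \<alpha> x * (comb {i\<in>{..<n}. \<not> hi \<le> nu i} c x)\<^sup>2)"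
proof -
  have on: "orthonormal M UNIV e" by unfold_locales
  have f1: "finite {i. hi \<le> nu i \<and> nu i \<le> hi + 1}"
    by (rule finite_subset[OF _ fin[of "\<bar>hi\<bar> + 1"]]) auto
  obtain d1 where d1: "d1 > 0" "\<And>F c. finite F \<Longrightarrow> \<forall>i\<in>F. hi \<le> nu i \<Longrightarrow>
    d1 * (\<Sum>i\<in>F. (c i)\<^sup>2) \<le> (\<Sum>i\<in>F. nu i * (c i)\<^sup>2) - (LINT x|M. \<beta> x * (comb F c x)\<^sup>2)"
  proof (rule one_sided_coercivity[OF on f1 meas_\<beta>, of "hi - lo"])
    show "AE x in M. \<beta> x \<le> hi" using \<alpha>\<beta> by eventually_elim simp
    show "AE x in M. hi - \<beta> x \<le> hi - lo" using \<alpha>\<beta> by eventually_elim simp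
    show "0 < (LINT x|M. (hi - \<beta> x) * (comb E c x)\<^sup>2)"
      if "finite E" "\<forall>i\<in>E. nu i = hi" "\<exists>i\<in>E. c i \<noteq> 0" for c E
      using nonres_hi[of E c] that by simp
  qed auto
  have f2: "finite {i. - lo \<le> - nu i \<and> - nu i \<le> - lo + 1}"
    by (rule finite_subset[OF _ fin[of "\<bar>lo\<bar> + 1"]]) auto
  obtain d2 where d2: "d2 > 0" "\<And>F c. finite F \<Longrightarrow> \<forall>i\<in>F. - lo \<le> - nu i \<Longrightarrow>
    d2 * (\<Sum>i\<in>F. (c i)\<^sup>2) \<le> (\<Sum>i\<in>F. - nu i * (c i)\<^sup>2) - (LINT x|M. - \<alpha> x * (comb F c x)\<^sup>2)"
  proof (rule one_sided_coercivity[OF on f2, of "\<lambda>x. - \<alpha> x" "hi - lo"])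
    show "AE x in M. - \<alpha> x \<le> - lo" using \<alpha>\<beta> by eventually_elim simp
    show "AE x in M. - lo - - \<alpha> x \<le> hi - lo" using \<alpha>\<beta> by eventually_elim simp
    show "0 < (LINT x|M. (- lo - - \<alpha> x) * (comb E c x)\<^sup>2)"
      if "finite E" "\<forall>i\<in>E. - nu i = - lo" "\<exists>i\<in>E. c i \<noteq> 0" for c E
      using nonres_lo[of E c] that by simp
  qed auto
  show ?thesis
  proof (rule that[of "min d1 d2"])
    fix n c
    let ?P = "{i\<in>{..<n}. hi \<le> nu i}" and ?Q = "{i\<in>{..<n}. \<not> hi \<le> nu i}"
    have split: "(\<Sum>i<n. g i) = (\<Sum>i\<in>?P. g i) + (\<Sum>i\<in>?Q. g i)" for g :: "nat \<Rightarrow> real"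
      using sum.union_disjoint[of ?P ?Q g] by (simp add: Int_def Un_def conj_disj_distribL[symmetric] lessThan_def)
    have "min d1 d2 * (\<Sum>i\<in>?P. (c i)\<^sup>2) \<le> d1 * (\<Sum>i\<in>?P. (c i)\<^sup>2)"
      by (intro mult_right_mono) (auto simp: sum_nonneg)
    also have "\<dots> \<le> (\<Sum>i\<in>?P. nu i * (c i)\<^sup>2) - (LINT x|M. \<beta> x * (comb ?P c x)\<^sup>2)"
      by (rule d1(2)) auto
    also have "(\<Sum>i\<in>?P. nu i * (c i)\<^sup>2) = (\<Sum>i\<in>?P. sg i * nu i * (c i)\<^sup>2)"
      by (intro sum.cong) (auto simp: sg_def)
    finally have 1: "min d1 d2 * (\<Sum>i\<in>?P. (c i)\<^sup>2)
      \<le> (\<Sum>i\<in>?P. sg i * nu i * (c i)\<^sup>2) - (LINT x|M. \<beta> x * (comb ?P c x)\<^sup>2)" .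
    have "min d1 d2 * (\<Sum>i\<in>?Q. (c i)\<^sup>2) \<le> d2 * (\<Sum>i\<in>?Q. (c i)\<^sup>2)"
      by (intro mult_right_mono) (auto simp: sum_nonneg)
    also have "\<dots> \<le> (\<Sum>i\<in>?Q. - nu i * (c i)\<^sup>2) - (LINT x|M. - \<alpha> x * (comb ?Q c x)\<^sup>2)"
      by (rule d2(2)) (use gap in auto)
    also have "(\<Sum>i\<in>?Q. - nu i * (c i)\<^sup>2) = (\<Sum>i\<in>?Q. sg i * nu i * (c i)\<^sup>2)"
      by (intro sum.cong) (auto simp: sg_def)
    finally have 2: "min d1 d2 * (\<Sum>i\<in>?Q. (c i)\<^sup>2)
      \<le> (\<Sum>i\<in>?Q. sg i * nu i * (c i)\<^sup>2) + (LINT x|M. \<alpha> x * (comb ?Q c x)\<^sup>2)" by simp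
    from 1 2 show "min d1 d2 * (\<Sum>i<n. (c i)\<^sup>2) \<le> (\<Sum>i<n. sg i * nu i * (c i)\<^sup>2)
      - (LINT x|M. \<beta> x * (comb ?P c x)\<^sup>2) + (LINT x|M. \<alpha> x * (comb ?Q c x)\<^sup>2)"
      by (simp add: split distrib_left)
  qed (use d1 d2 in simp)
qed

text \<open>The factor \<open>sg i\<close> leaves the zeros of the projected equation unchanged, but
  turns its pairing with \<open>c\<close> into <L y - N(y), y_+ - y_->.\<close>

definition residual :: "nat \<Rightarrow> (nat \<Rightarrow> real) \<Rightarrow> nat \<Rightarrow> real" where
  "residual n c i = sg i * (nu i * c i - ip M (Nem (comb {..<n} c)) (e i))"

lemma residual_positive:
  obtains R where "R > 0" "\<And>n c. R\<^sup>2 \<le> (\<Sum>i<n. (c i)\<^sup>2) \<Longrightarrow> 0 < (\<Sum>i<n. c i * residual n c i)"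
proof -
  obtain \<delta> where \<delta>: "\<delta> > 0" "\<And>n c. \<delta> * (\<Sum>i<n. (c i)\<^sup>2) \<le> (\<Sum>i<n. sg i * nu i * (c i)\<^sup>2)
    - (LINT x|M. \<beta> x * (comb {i\<in>{..<n}. hi \<le> nu i} c x)\<^sup>2)
    + (LINT x|M. \<alpha> x * (comb {i\<in>{..<n}. \<not> hi \<le> nu i} c x)\<^sup>2)"
    using two_sided_coercivity by blast
  \<comment> \<open>Half of the coercivity constant is given up to the tolerance in the
    slopes.\<close>
  define \<epsilon> where "\<epsilon> = \<delta> / 2"
  have \<epsilon>: "\<epsilon> > 0" using \<delta>(1) by (simp add: \<epsilon>_def)
  obtain h where h: "sq_int M h"
    "AE x in M. \<forall>y. \<exists>a. \<alpha> x - \<epsilon> \<le> a \<and> a \<le> \<beta> x + \<epsilon> \<and> \<bar>N x y - a * y\<bar> \<le> h x"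
    using N_growth[OF \<epsilon>] by blast
  \<comment> \<open>Beyond this radius \<delta>/2 S exceeds the error term 2 |h| sqrt S, where S is
    the squared norm of the coefficients; the 1 makes both the radius positive and the inequality
    strict.\<close>
  define R where "R = 4 * nrm M h / \<delta> + 1"
  have R0: "R > 0" using \<delta>(1) by (simp add: R_def add_nonneg_pos)
  show ?thesis
  proof (rule that[OF R0])
    fix n :: nat and c :: "nat \<Rightarrow> real"
    assume big: "R\<^sup>2 \<le> (\<Sum>i<n. (c i)\<^sup>2)"
    let ?P = "{i\<in>{..<n}. hi \<le> nu i}" and ?Q = "{i\<in>{..<n}. \<not> hi \<le> nu i}"
    let ?p = "comb ?P c" and ?q = "comb ?Q c" and ?y = "comb {..<n} c"
    define S where "S = (\<Sum>i<n. (c i)\<^sup>2)"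
    have S0: "0 \<le> S" by (simp add: S_def sum_nonneg)
    have un: "?P \<union> ?Q = {..<n}" "?P \<inter> ?Q = {}" by auto
    have split: "(\<Sum>i<n. g i) = (\<Sum>i\<in>?P. g i) + (\<Sum>i\<in>?Q. g i)" for g :: "nat \<Rightarrow> real"
      by (subst un(1)[symmetric], subst sum.union_disjoint) auto
    have y: "?y x = ?p x + ?q x" for x by (simp add: comb_def split)
    have J: "comb {..<n} (\<lambda>i. sg i * c i) x = ?p x - ?q x" for x
      unfolding comb_def split by (simp add: sg_def sum_negf)
    have sqp: "sq_int M ?p" and sqq: "sq_int M ?q" and sqy: "sq_int M ?y" by (intro sq_comb subset_UNIV)+
    have np: "(nrm M ?p)\<^sup>2 = (\<Sum>i\<in>?P. (c i)\<^sup>2)" and nq: "(nrm M ?q)\<^sup>2 = (\<Sum>i\<in>?Q. (c i)\<^sup>2)"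
      by (intro nrm_comb subset_UNIV; simp)+
    have nsum: "(nrm M ?p)\<^sup>2 + (nrm M ?q)\<^sup>2 = S" by (simp only: np nq S_def split)
    have npS: "nrm M ?p \<le> sqrt S" and nqS: "nrm M ?q \<le> sqrt S"
      using nsum by (auto intro!: real_le_rsqrt simp flip: nsum)
    have ab: "AE x in M. \<bar>\<beta> x + \<epsilon>\<bar> \<le> C0 + \<epsilon>" "AE x in M. \<bar>\<alpha> x - \<epsilon>\<bar> \<le> C0 + \<epsilon>"
    proof -
      show "AE x in M. \<bar>\<beta> x + \<epsilon>\<bar> \<le> C0 + \<epsilon>"
        using \<alpha>\<beta> by eventually_elim (use \<epsilon> in \<open>unfold C0_def, linarith\<close>)
      show "AE x in M. \<bar>\<alpha> x - \<epsilon>\<bar> \<le> C0 + \<epsilon>"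
        using \<alpha>\<beta> by eventually_elim (use \<epsilon> in \<open>unfold C0_def, linarith\<close>)
    qed
    have ab': "AE x in M. \<bar>\<beta> x\<bar> \<le> C0" "AE x in M. \<bar>\<alpha> x\<bar> \<le> C0"
    proof -
      show "AE x in M. \<bar>\<beta> x\<bar> \<le> C0" using \<alpha>\<beta> by eventually_elim (unfold C0_def, linarith)
      show "AE x in M. \<bar>\<alpha> x\<bar> \<le> C0" using \<alpha>\<beta> by eventually_elim (unfold C0_def, linarith)
    qed
    have "(\<Sum>i<n. c i * residual n c i) = (\<Sum>i<n. sg i * nu i * (c i)\<^sup>2) - (\<Sum>i<n. sg i * c i * ip M (Nem ?y) (e i))"
      unfolding residual_def by (simp add: sum_subtractf[symmetric] algebra_simps power2_eq_square)
    moreover have "(\<Sum>i<n. sg i * c i * ip M (Nem ?y) (e i)) = ip M (Nem ?y) (comb {..<n} (\<lambda>i. sg i * c i))"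
      using ip_comb_left[OF subset_UNIV sq_Nem[OF sqy], of "{..<n}" "\<lambda>i. sg i * c i"]
      by (simp add: ip_commute[of M "Nem ?y"])
    moreover have "ip M (Nem ?y) (comb {..<n} (\<lambda>i. sg i * c i)) \<le> (LINT x|M. (\<beta> x + \<epsilon>) * (?p x)\<^sup>2 - (\<alpha> x - \<epsilon>) * (?q x)\<^sup>2 + h x * (\<bar>?p x\<bar> + \<bar>?q x\<bar>))"
      unfolding ip_def J
    proof (rule integral_mono_AE)
      show "integrable M (\<lambda>x. Nem ?y x * (?p x - ?q x))"
        by (intro integrable_mult_sq_int sq_Nem sq_int_diff sqy sqp sqq)
      show "integrable M (\<lambda>x. (\<beta> x + \<epsilon>) * (?p x)\<^sup>2 - (\<alpha> x - \<epsilon>) * (?q x)\<^sup>2 + h x * (\<bar>?p x\<bar> + \<bar>?q x\<bar>))"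
        by (intro Bochner_Integration.integrable_add Bochner_Integration.integrable_diff
            integrable_weight[OF _ ab(1) sqp] integrable_weight[OF _ ab(2) sqq]
            integrable_mult_sq_int sq_int_add sq_int_abs h sqp sqq) measurable
      show "AE x in M. Nem ?y x * (?p x - ?q x)
          \<le> (\<beta> x + \<epsilon>) * (?p x)\<^sup>2 - (\<alpha> x - \<epsilon>) * (?q x)\<^sup>2 + h x * (\<bar>?p x\<bar> + \<bar>?q x\<bar>)"
        using h(2)
      proof eventually_elim
        case (elim x)
        obtain a where a: "\<alpha> x - \<epsilon> \<le> a" "a \<le> \<beta> x + \<epsilon>" "\<bar>N x (?y x) - a * ?y x\<bar> \<le> h x"
          using elim by blast
        define \<rho> where "\<rho> = N x (?y x) - a * ?y x"
        have "Nem ?y x * (?p x - ?q x) = a * (?p x)\<^sup>2 - a * (?q x)\<^sup>2 + \<rho> * (?p x - ?q x)"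
          unfolding Nem_def \<rho>_def y by (simp add: algebra_simps power2_eq_square)
        also have "\<rho> * (?p x - ?q x) \<le> h x * (\<bar>?p x\<bar> + \<bar>?q x\<bar>)"
        proof -
          have "\<rho> * (?p x - ?q x) \<le> \<bar>\<rho>\<bar> * \<bar>?p x - ?q x\<bar>" by (simp add: abs_mult[symmetric])
          also have "\<dots> \<le> h x * (\<bar>?p x\<bar> + \<bar>?q x\<bar>)"
            using a(3) by (intro mult_mono) (auto simp: \<rho>_def)
          finally show ?thesis .
        qed
        also have "a * (?p x)\<^sup>2 \<le> (\<beta> x + \<epsilon>) * (?p x)\<^sup>2" using a by (intro mult_right_mono) auto
        finally have "Nem ?y x * (?p x - ?q x)
          \<le> (\<beta> x + \<epsilon>) * (?p x)\<^sup>2 - a * (?q x)\<^sup>2 + h x * (\<bar>?p x\<bar> + \<bar>?q x\<bar>)" by simp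
        moreover have "(\<alpha> x - \<epsilon>) * (?q x)\<^sup>2 \<le> a * (?q x)\<^sup>2" using a by (intro mult_right_mono) auto
        ultimately show ?case by linarith
      qed
    qed
    moreover have "(LINT x|M. (\<beta> x + \<epsilon>) * (?p x)\<^sup>2 - (\<alpha> x - \<epsilon>) * (?q x)\<^sup>2 + h x * (\<bar>?p x\<bar> + \<bar>?q x\<bar>))
        = (LINT x|M. \<beta> x * (?p x)\<^sup>2) - (LINT x|M. \<alpha> x * (?q x)\<^sup>2) + \<epsilon> * S
        + ip M h (\<lambda>x. \<bar>?p x\<bar> + \<bar>?q x\<bar>)"
    proof -
      have i: "integrable M (\<lambda>x. \<beta> x * (?p x)\<^sup>2)" "integrable M (\<lambda>x. \<alpha> x * (?q x)\<^sup>2)"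
        "integrable M (\<lambda>x. (?p x)\<^sup>2)" "integrable M (\<lambda>x. (?q x)\<^sup>2)"
        "integrable M (\<lambda>x. h x * (\<bar>?p x\<bar> + \<bar>?q x\<bar>))"
        using integrable_weight[OF meas_\<beta> ab'(1) sqp] integrable_weight[OF meas_\<alpha> ab'(2) sqq]
          sqp sqq integrable_mult_sq_int[OF h(1) sq_int_add[OF sq_int_abs[OF sqp] sq_int_abs[OF sqq]]]
        by (simp_all only: sq_int_def)
      have "(LINT x|M. (\<beta> x + \<epsilon>) * (?p x)\<^sup>2 - (\<alpha> x - \<epsilon>) * (?q x)\<^sup>2 + h x * (\<bar>?p x\<bar> + \<bar>?q x\<bar>))
        = (LINT x|M. \<beta> x * (?p x)\<^sup>2 - \<alpha> x * (?q x)\<^sup>2 + \<epsilon> * (?p x)\<^sup>2 + \<epsilon> * (?q x)\<^sup>2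
            + h x * (\<bar>?p x\<bar> + \<bar>?q x\<bar>))"
        by (intro Bochner_Integration.integral_cong) (auto simp: algebra_simps)
      also have "\<dots> = (LINT x|M. \<beta> x * (?p x)\<^sup>2) - (LINT x|M. \<alpha> x * (?q x)\<^sup>2)
          + \<epsilon> * (LINT x|M. (?p x)\<^sup>2) + \<epsilon> * (LINT x|M. (?q x)\<^sup>2) + (LINT x|M. h x * (\<bar>?p x\<bar> + \<bar>?q x\<bar>))"
        using i by simp
      also have "(LINT x|M. (?p x)\<^sup>2) = (nrm M ?p)\<^sup>2" by (rule integral_square)
      also have "(LINT x|M. (?q x)\<^sup>2) = (nrm M ?q)\<^sup>2" by (rule integral_square)
      finally show ?thesis by (simp add: nsum[symmetric] ip_def algebra_simps)
    qed
    moreover have "ip M h (\<lambda>x. \<bar>?p x\<bar> + \<bar>?q x\<bar>) \<le> 2 * nrm M h * sqrt S"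
    proof -
      have "ip M h (\<lambda>x. \<bar>?p x\<bar> + \<bar>?q x\<bar>) \<le> nrm M h * nrm M (\<lambda>x. \<bar>?p x\<bar> + \<bar>?q x\<bar>)"
        using Cauchy_Schwarz_ip[OF h(1) sq_int_add[OF sq_int_abs[OF sqp] sq_int_abs[OF sqq]]] by linarith
      also have "nrm M (\<lambda>x. \<bar>?p x\<bar> + \<bar>?q x\<bar>) \<le> nrm M (\<lambda>x. \<bar>?p x\<bar>) + nrm M (\<lambda>x. \<bar>?q x\<bar>)"
        by (intro nrm_triangle sq_int_abs sqp sqq)
      also have "\<dots> \<le> 2 * sqrt S" using npS nqS by simp
      finally show ?thesis by (simp add: mult_left_mono)
    qed
    ultimately have "(\<Sum>i<n. c i * residual n c i) \<ge> (\<Sum>i<n. sg i * nu i * (c i)\<^sup>2)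
        - (LINT x|M. \<beta> x * (?p x)\<^sup>2) + (LINT x|M. \<alpha> x * (?q x)\<^sup>2) - \<epsilon> * S - 2 * nrm M h * sqrt S"
      by linarith
    moreover have "\<delta> * S \<le> (\<Sum>i<n. sg i * nu i * (c i)\<^sup>2)
        - (LINT x|M. \<beta> x * (?p x)\<^sup>2) + (LINT x|M. \<alpha> x * (?q x)\<^sup>2)"
      unfolding S_def by (rule \<delta>(2))
    ultimately have "(\<Sum>i<n. c i * residual n c i) \<ge> \<delta> * S - \<epsilon> * S - 2 * nrm M h * sqrt S" by linarith
    moreover have "\<delta> * S - \<epsilon> * S - 2 * nrm M h * sqrt S = \<delta> / 2 * sqrt S * (sqrt S - 4 * nrm M h / \<delta>)"
    proof -
      have "S = sqrt S * sqrt S" using S0 by simp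
      then show ?thesis using \<delta>(1) by (simp add: \<epsilon>_def field_simps)
    qed
    ultimately have ge: "(\<Sum>i<n. c i * residual n c i) \<ge> \<delta> / 2 * sqrt S * (sqrt S - 4 * nrm M h / \<delta>)" by simp
    have "R \<le> sqrt S" using big R0 by (intro real_le_rsqrt) (simp add: S_def)
    then have "0 < sqrt S" "0 < sqrt S - 4 * nrm M h / \<delta>" using R0 unfolding R_def by linarith+
    then have "0 < \<delta> / 2 * sqrt S * (sqrt S - 4 * nrm M h / \<delta>)"
      using \<delta>(1) by (intro mult_pos_pos) simp_all
    with ge show "0 < (\<Sum>i<n. c i * residual n c i)" by linarith
  qed
qed

lemma galerkin_solutions:
  obtains R a where "\<And>n. (\<Sum>i<n. (a n i)\<^sup>2) \<le> R\<^sup>2"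
    "\<And>n i. i < n \<Longrightarrow> nu i * a n i = ip M (Nem (comb {..<n} (a n))) (e i)"
proof -
  obtain R where R: "R > 0" "\<And>n c. R\<^sup>2 \<le> (\<Sum>i<n. (c i)\<^sup>2) \<Longrightarrow> 0 < (\<Sum>i<n. c i * residual n c i)"
    using residual_positive by blast
  have "\<exists>c. (\<Sum>i<n. (c i)\<^sup>2) \<le> R\<^sup>2 \<and> (\<forall>i<n. nu i * c i = ip M (Nem (comb {..<n} c)) (e i))" for n
  proof -
    obtain c where "\<And>j. \<bar>c j\<bar> \<le> R" and c: "\<And>i. i < n \<Longrightarrow> residual n c i = 0"
    proof (rule zero_of_coercive[OF R(1), of n "residual n"])
      fix X :: "nat \<Rightarrow> nat \<Rightarrow> real" and c i
      assume X: "\<And>k j. \<bar>X k j\<bar> \<le> R" "\<And>j. (\<lambda>k. X k j) \<longlonglongrightarrow> c j" "i < n"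
      have sqc: "sq_int M (comb {..<n} d)" for d by (rule sq_comb) simp
      have "(\<lambda>k. ip M (Nem (comb {..<n} (X k))) (e i)) \<longlonglongrightarrow> ip M (Nem (comb {..<n} c)) (e i)"
      \<comment> \<open>All coefficients stay in the cube of half-side R, so one fixed function
        dominates the sequence of combinations.\<close>
      proof (rule tendsto_ip_Nem[where G = "\<lambda>x. \<Sum>j<n. R * \<bar>e j x\<bar>"])
        show "AE x in M. (\<lambda>k. comb {..<n} (X k) x) \<longlonglongrightarrow> comb {..<n} c x"
          unfolding comb_def by (intro AE_I2 tendsto_sum tendsto_mult tendsto_const X(2))
        show "AE x in M. \<forall>k. \<bar>comb {..<n} (X k) x\<bar> \<le> (\<Sum>j<n. R * \<bar>e j x\<bar>)"
        proof (intro AE_I2 allI)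
          fix x k
          have "\<bar>comb {..<n} (X k) x\<bar> \<le> (\<Sum>j<n. \<bar>X k j * e j x\<bar>)"
            unfolding comb_def by (rule sum_abs)
          also have "\<dots> \<le> (\<Sum>j<n. R * \<bar>e j x\<bar>)"
            unfolding abs_mult by (intro sum_mono mult_right_mono X) simp
          finally show "\<bar>comb {..<n} (X k) x\<bar> \<le> (\<Sum>j<n. R * \<bar>e j x\<bar>)" .
        qed
        show "sq_int M (\<lambda>x. \<Sum>j<n. R * \<bar>e j x\<bar>)"
          by (intro sq_int_sum sq_int_cmult sq_int_abs sq_e UNIV_I)
        show "comb {..<n} (X k) \<in> borel_measurable M" "comb {..<n} c \<in> borel_measurable M" for k
          using sqc by (simp_all add: sq_int_def)
      qed (simp add: sq_e)
      then show "(\<lambda>k. residual n (X k) i) \<longlonglongrightarrow> residual n c i"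
        unfolding residual_def by (intro tendsto_intros X(2))
    next
      fix c :: "nat \<Rightarrow> real"
      assume "\<exists>j<n. \<bar>c j\<bar> = R"
      then obtain j where j: "j < n" "\<bar>c j\<bar> = R" by blast
      have "R\<^sup>2 = (c j)\<^sup>2" using j(2) by auto
      also have "\<dots> \<le> (\<Sum>i<n. (c i)\<^sup>2)" using j(1) by (intro member_le_sum) auto
      finally show "0 < (\<Sum>i<n. c i * residual n c i)" by (rule R(2))
    qed auto
    \<comment> \<open>The cube bounds each coefficient only separately. Positivity of the pairing
      outside the ball upgrades this to a bound on the sum of squares that does not depend on
      \<open>n\<close>.\<close>
    have "(\<Sum>i<n. c i * residual n c i) = 0" using c by simp
    then have "(\<Sum>i<n. (c i)\<^sup>2) \<le> R\<^sup>2" using R(2)[where c=c and n=n] by linarith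
    moreover have "\<forall>i<n. nu i * c i = ip M (Nem (comb {..<n} c)) (e i)"
    proof (intro allI impI)
      fix i assume "i < n"
      moreover have "sg i \<noteq> 0" by (simp add: sg_def)
      ultimately show "nu i * c i = ip M (Nem (comb {..<n} c)) (e i)"
        using c[of i] by (simp add: residual_def)
    qed
    ultimately show ?thesis by blast
  qed
  then have "\<forall>n. \<exists>c. (\<Sum>i<n. (c i)\<^sup>2) \<le> R\<^sup>2 \<and> (\<forall>i<n. nu i * c i = ip M (Nem (comb {..<n} c)) (e i))" ..
  from choice[OF this] show ?thesis using that by blast
qed

text \<open>The limits are taken of an everywhere defined expression, so that pointwise symmetries of
  the approximations pass to the solution.\<close>
theorem galerkin_limit:
  obtains Y y where "\<And>k. \<exists>n c. Y k = comb {..<n} c"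
    "y = (\<lambda>x. if convergent (\<lambda>k. Y k x) then lim (\<lambda>k. Y k x) else 0)"
    "sq_int M y" "(\<lambda>k. nrm M (\<lambda>x. y x - Y k x)) \<longlonglongrightarrow> 0"
    "\<And>i. nu i * ip M y (e i) = ip M (Nem y) (e i)"
proof -
  obtain R a where aR: "\<And>n. (\<Sum>i<n. (a n i)\<^sup>2) \<le> R\<^sup>2"
    and sol: "\<And>n i. i < n \<Longrightarrow> nu i * a n i = ip M (Nem (comb {..<n} (a n))) (e i)"
    by (rule galerkin_solutions) blast
  \<comment> \<open>Padding with zeros lets solutions of different orders be compared coordinate by
    coordinate.\<close>
  define a' where "a' = (\<lambda>n i. if i < n then a n i else 0)"
  define Z where "Z = (\<lambda>n. comb {..<n} (a n))"
  have sqZ: "sq_int M (Z n)" for n unfolding Z_def by (rule sq_comb) simp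
  have nZ: "nrm M (Z n) \<le> \<bar>R\<bar>" for n
  proof (rule power2_le_imp_le)
    have "(nrm M (Z n))\<^sup>2 = (\<Sum>i<n. (a n i)\<^sup>2)" unfolding Z_def by (rule nrm_comb) auto
    with aR[of n] show "(nrm M (Z n))\<^sup>2 \<le> \<bar>R\<bar>\<^sup>2" unfolding power2_abs by linarith
  qed simp
  obtain H where H: "\<And>y. sq_int M y \<Longrightarrow> nrm M (Nem y) \<le> C0 * nrm M y + H"
    using nrm_Nem by blast
  define D where "D = \<bar>C0 * \<bar>R\<bar> + H\<bar>"
  have ND: "nrm M (Nem (Z n)) \<le> D" for n
  proof -
    have "C0 * nrm M (Z n) \<le> C0 * \<bar>R\<bar>" using nZ by (intro mult_left_mono) (auto simp: C0_def)
    with H[OF sqZ[of n]] show ?thesis unfolding D_def by linarith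
  qed
  \<comment> \<open>By the projected equations \<open>nu i * a' n i\<close> is a Fourier coefficient
    of N(Z n) or 0, so Bessel's inequality bounds these sums uniformly in \<open>n\<close> and
    \<open>F\<close>.\<close>
  have weighted: "(\<Sum>i\<in>F. (nu i * a' n i)\<^sup>2) \<le> D\<^sup>2" if "finite F" for F n
  proof -
    have "(\<Sum>i\<in>F. (nu i * a' n i)\<^sup>2) \<le> (\<Sum>i\<in>F. (ip M (Nem (Z n)) (e i))\<^sup>2)"
      by (intro sum_mono) (auto simp: a'_def sol Z_def)
    also have "\<dots> \<le> (nrm M (Nem (Z n)))\<^sup>2" using that by (intro Bessel sq_Nem sqZ) auto
    also have "\<dots> \<le> D\<^sup>2" using ND by (intro power_mono) auto
    finally show ?thesis .
  qed
  have Z': "Z n = comb {..<m} (a' n)" if "n \<le> m" for n m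
    unfolding Z_def comb_def a'_def using that by (intro ext sum.mono_neutral_cong_left) auto
  have a'R: "norm (a' n i) \<le> \<bar>R\<bar>" for n i
  proof (cases "i < n")
    case True
    have "(a n i)\<^sup>2 \<le> (\<Sum>i<n. (a n i)\<^sup>2)" using True by (intro member_le_sum) auto
    also have "\<dots> \<le> R\<^sup>2" by (rule aR)
    finally show ?thesis using True by (simp add: a'_def abs_le_square_iff)
  qed (simp add: a'_def)
  obtain \<phi> where \<phi>: "strict_mono (\<phi>::nat \<Rightarrow> nat)" and \<phi>l: "\<And>i. i \<in> UNIV \<Longrightarrow> \<exists>l. (\<lambda>k. a' (\<phi> k) i) \<longlonglongrightarrow> l"
    using function_convergent_subsequence[of UNIV a' "\<bar>R\<bar>"] a'R by auto
  have Cau: "\<exists>N. \<forall>m\<ge>N. \<forall>n\<ge>N. nrm M (\<lambda>x. Z (\<phi> m) x - Z (\<phi> n) x) \<le> \<epsilon>" if \<epsilon>: "\<epsilon> > 0" for \<epsilon>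
  proof -
    \<comment> \<open>Modes with |nu| > K contribute at most (2 D / K)^2 to a squared distance; this
      \<open>K\<close> makes it at most (\<epsilon>/2)^2.\<close>
    define K where "K = 4 * D / \<epsilon> + 1"
    have K: "K > 0" using \<epsilon> by (simp add: K_def D_def add_nonneg_pos)
    define I0 where "I0 = {i. \<bar>nu i\<bar> \<le> K}"
    have I0: "finite I0" unfolding I0_def by (rule fin)
    \<comment> \<open>On the finitely many remaining modes coordinatewise convergence suffices; the
      tolerance sums to at most \<epsilon>^2 / 2, and the 1 covers an empty
      \<open>I0\<close>.\<close>
    have "\<exists>N. \<forall>i\<in>I0. \<forall>m\<ge>N. \<forall>n\<ge>N. (a' (\<phi> m) i - a' (\<phi> n) i)\<^sup>2 \<le> \<epsilon>\<^sup>2 / (2 * (card I0 + 1))"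
    proof -
      have "\<exists>N. \<forall>m\<ge>N. \<forall>n\<ge>N. (a' (\<phi> m) i - a' (\<phi> n) i)\<^sup>2 \<le> \<epsilon>\<^sup>2 / (2 * (card I0 + 1))" for i
      proof -
        have pos: "sqrt (\<epsilon>\<^sup>2 / (2 * (card I0 + 1))) > 0" using \<epsilon> by simp
        have "Cauchy (\<lambda>k. a' (\<phi> k) i)" using \<phi>l by (auto intro: LIMSEQ_imp_Cauchy)
        from CauchyD[OF this pos] obtain N where N: "\<And>m n. m \<ge> N \<Longrightarrow> n \<ge> N \<Longrightarrow>
          norm (a' (\<phi> m) i - a' (\<phi> n) i) < sqrt (\<epsilon>\<^sup>2 / (2 * (card I0 + 1)))" by blast
        have "(a' (\<phi> m) i - a' (\<phi> n) i)\<^sup>2 \<le> \<epsilon>\<^sup>2 / (2 * (card I0 + 1))" if "m \<ge> N" "n \<ge> N" for m n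
        proof -
          have "\<bar>a' (\<phi> m) i - a' (\<phi> n) i\<bar>\<^sup>2 \<le> (sqrt (\<epsilon>\<^sup>2 / (2 * (card I0 + 1))))\<^sup>2"
            using N[OF that] by (intro power_mono) auto
          then show ?thesis by (simp only: power2_abs real_sqrt_pow2_iff) (simp add: real_sqrt_pow2)
        qed
        then show ?thesis by blast
      qed
      then obtain N where N: "\<And>i m n. m \<ge> N i \<Longrightarrow> n \<ge> N i \<Longrightarrow> (a' (\<phi> m) i - a' (\<phi> n) i)\<^sup>2 \<le> \<epsilon>\<^sup>2 / (2 * (card I0 + 1))"
        using choice[of "\<lambda>i N. \<forall>m\<ge>N. \<forall>n\<ge>N. (a' (\<phi> m) i - a' (\<phi> n) i)\<^sup>2 \<le> \<epsilon>\<^sup>2 / (2 * (card I0 + 1))"] by blast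
      have "N i \<le> (\<Sum>i\<in>I0. N i)" if "i \<in> I0" for i using that I0 by (intro member_le_sum) auto
      then show ?thesis using N by (intro exI[of _ "\<Sum>i\<in>I0. N i"]) (meson order_trans)
    qed
    then obtain N where N: "\<And>i m n. i \<in> I0 \<Longrightarrow> m \<ge> N \<Longrightarrow> n \<ge> N \<Longrightarrow>
      (a' (\<phi> m) i - a' (\<phi> n) i)\<^sup>2 \<le> \<epsilon>\<^sup>2 / (2 * (card I0 + 1))" by blast
    have "nrm M (\<lambda>x. Z (\<phi> m) x - Z (\<phi> n) x) \<le> \<epsilon>" if mn: "m \<ge> N" "n \<ge> N" for m n
    proof (rule power2_le_imp_le)
      define L where "L = max (\<phi> m) (\<phi> n)"
      let ?d = "\<lambda>i. a' (\<phi> m) i - a' (\<phi> n) i"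
      have "(\<lambda>x. Z (\<phi> m) x - Z (\<phi> n) x) = comb {..<L} ?d"
        using Z'[of "\<phi> m" L] Z'[of "\<phi> n" L]
        by (auto simp: L_def comb_def sum_subtractf left_diff_distrib)
      then have "(nrm M (\<lambda>x. Z (\<phi> m) x - Z (\<phi> n) x))\<^sup>2 = (\<Sum>i<L. (?d i)\<^sup>2)"
        by (simp add: nrm_comb)
      also have "\<dots> = (\<Sum>i\<in>{..<L} \<inter> I0. (?d i)\<^sup>2) + (\<Sum>i\<in>{..<L} - I0. (?d i)\<^sup>2)"
        by (rule sum.Int_Diff) simp
      also have "(\<Sum>i\<in>{..<L} \<inter> I0. (?d i)\<^sup>2) \<le> \<epsilon>\<^sup>2 / 2"
      proof -
        have "(\<Sum>i\<in>{..<L} \<inter> I0. (?d i)\<^sup>2) \<le> (\<Sum>i\<in>I0. (?d i)\<^sup>2)" using I0 by (intro sum_mono2) auto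
        also have "\<dots> \<le> (\<Sum>i\<in>I0. \<epsilon>\<^sup>2 / (2 * (card I0 + 1)))" by (intro sum_mono N mn)
        also have "\<dots> = \<epsilon>\<^sup>2 / 2 * (card I0 / (card I0 + 1))" by simp
        also have "\<dots> \<le> \<epsilon>\<^sup>2 / 2 * 1" by (intro mult_left_mono) auto
        finally show ?thesis by simp
      qed
      also have "(\<Sum>i\<in>{..<L} - I0. (?d i)\<^sup>2) \<le> \<epsilon>\<^sup>2 / 2"
      proof -
        have "(\<Sum>i\<in>{..<L} - I0. (?d i)\<^sup>2)
          \<le> (\<Sum>i\<in>{..<L} - I0. 2 / K\<^sup>2 * ((nu i * a' (\<phi> m) i)\<^sup>2 + (nu i * a' (\<phi> n) i)\<^sup>2))"
        proof (rule sum_mono)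
          fix i assume "i \<in> {..<L} - I0"
          then have "K \<le> \<bar>nu i\<bar>" by (auto simp: I0_def)
          then have "K\<^sup>2 \<le> (nu i)\<^sup>2" using K by (simp add: abs_le_square_iff[symmetric])
          have "(?d i)\<^sup>2 \<le> 2 * ((a' (\<phi> m) i)\<^sup>2 + (a' (\<phi> n) i)\<^sup>2)"
            using zero_le_power2[of "a' (\<phi> m) i + a' (\<phi> n) i"] by (simp add: power2_sum power2_diff)
          then have "K\<^sup>2 * (?d i)\<^sup>2 \<le> (nu i)\<^sup>2 * (2 * ((a' (\<phi> m) i)\<^sup>2 + (a' (\<phi> n) i)\<^sup>2))"
            using \<open>K\<^sup>2 \<le> (nu i)\<^sup>2\<close> by (intro mult_mono) auto
          then show "(?d i)\<^sup>2 \<le> 2 / K\<^sup>2 * ((nu i * a' (\<phi> m) i)\<^sup>2 + (nu i * a' (\<phi> n) i)\<^sup>2)"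
            using K by (simp add: field_simps power_mult_distrib)
        qed
        also have "\<dots> = 2 / K\<^sup>2 * ((\<Sum>i\<in>{..<L} - I0. (nu i * a' (\<phi> m) i)\<^sup>2) + (\<Sum>i\<in>{..<L} - I0. (nu i * a' (\<phi> n) i)\<^sup>2))"
          by (simp only: sum_distrib_left[symmetric] sum.distrib)
        also have "\<dots> \<le> 2 / K\<^sup>2 * (D\<^sup>2 + D\<^sup>2)"
          by (intro mult_left_mono add_mono weighted) auto
        also have "\<dots> = (2 * D / K)\<^sup>2" by (simp add: power_divide power_mult_distrib)
        also have "\<dots> \<le> (\<epsilon> / 2)\<^sup>2"
        proof (rule power_mono)
          have "4 * D \<le> \<epsilon> * K" using \<epsilon> by (simp add: K_def distrib_left)
          then show "2 * D / K \<le> \<epsilon> / 2" using K by (simp add: field_simps)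
        qed (use K in \<open>simp add: D_def\<close>)
        also have "\<dots> \<le> \<epsilon>\<^sup>2 / 2" by (simp add: power_divide)
        finally show ?thesis .
      qed
      finally show "(nrm M (\<lambda>x. Z (\<phi> m) x - Z (\<phi> n) x))\<^sup>2 \<le> \<epsilon>\<^sup>2" by simp
    qed (use \<epsilon> in simp)
    then show ?thesis by blast
  qed
  have "\<forall>j. \<exists>N. \<forall>m\<ge>N. \<forall>n\<ge>N. nrm M (\<lambda>x. Z (\<phi> m) x - Z (\<phi> n) x) \<le> (1/2)^j"
    using Cau by simp
  from choice[OF this] obtain N where
    N: "\<And>j m n. m \<ge> N j \<Longrightarrow> n \<ge> N j \<Longrightarrow> nrm M (\<lambda>x. Z (\<phi> m) x - Z (\<phi> n) x) \<le> (1/2)^j" by blast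
  \<comment> \<open>Summing \<open>Suc (N i)\<close> gives strictly increasing indices with
    \<open>N j \<le> g j\<close>.\<close>
  define g where "g = (\<lambda>j. \<Sum>i\<le>j. Suc (N i))"
  have g: "strict_mono g" by (rule strict_monoI_Suc) (simp add: g_def)
  have gN: "N j \<le> g j" for j
  proof -
    have "Suc (N j) \<le> g j" unfolding g_def by (intro member_le_sum) auto
    then show ?thesis by simp
  qed
  define Y where "Y = (\<lambda>j. Z (\<phi> (g j)))"
  have sqY: "sq_int M (Y k)" for k unfolding Y_def by (rule sqZ)
  have YN: "nrm M (\<lambda>x. Y m x - Y n x) \<le> (1/2)^j" if "m \<ge> j" "n \<ge> j" for m n j
  proof -
    have "g j \<le> g m" "g j \<le> g n" using g that by (auto simp: strict_mono_less_eq)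
    then show ?thesis unfolding Y_def using gN[of j] by (intro N) auto
  qed
  have fast: "nrm M (\<lambda>x. Y (Suc k) x - Y k x) \<le> (1/2)^k" for k by (rule YN) auto
  obtain G where G: "sq_int M G" "AE x in M. convergent (\<lambda>k. Y k x)" "AE x in M. \<forall>k. \<bar>Y k x\<bar> \<le> G x"
    using L2_fast_Cauchy[OF sqY fast] by blast
  define y where "y = (\<lambda>x. if convergent (\<lambda>k. Y k x) then lim (\<lambda>k. Y k x) else 0)"
  have [measurable]: "Y k \<in> borel_measurable M" for k using sqY[of k] by (simp add: sq_int_def)
  have ym: "y \<in> borel_measurable M"
    unfolding y_def Cauchy_convergent_iff[symmetric] by measurable
  have lim: "AE x in M. (\<lambda>k. Y k x) \<longlonglongrightarrow> y x"
    using G(2) by eventually_elim (simp add: y_def convergent_LIMSEQ_iff)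
  have yG: "AE x in M. \<bar>y x\<bar> \<le> G x"
    using lim G(3)
  proof eventually_elim
    case (elim x)
    show ?case by (rule LIMSEQ_le_const2[OF tendsto_rabs[OF elim(1)]]) (use elim(2) in blast)
  qed
  have sqy: "sq_int M y"
    by (rule sq_int_bound[OF G(1) ym]) (use yG in \<open>eventually_elim, simp\<close>)
  have diff: "(\<lambda>k. nrm M (\<lambda>x. y x - Y k x)) \<longlonglongrightarrow> 0"
  proof -
    have "(\<lambda>k. ip M (\<lambda>x. y x - Y k x) (\<lambda>x. y x - Y k x)) \<longlonglongrightarrow> (LINT x|M. 0)"
      unfolding ip_def
    proof (rule integral_dominated_convergence[where w = "\<lambda>x. (2 * G x) * (2 * G x)"])
      show "integrable M (\<lambda>x. (2 * G x) * (2 * G x))"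
        by (intro integrable_mult_sq_int sq_int_cmult G)
      show "AE x in M. (\<lambda>k. (y x - Y k x) * (y x - Y k x)) \<longlonglongrightarrow> 0"
        using lim
      proof eventually_elim
        case (elim x)
        have "(\<lambda>k. (y x - Y k x) * (y x - Y k x)) \<longlonglongrightarrow> (y x - y x) * (y x - y x)"
          by (intro tendsto_intros elim)
        then show ?case by simp
      qed
      show "AE x in M. norm ((y x - Y k x) * (y x - Y k x)) \<le> (2 * G x) * (2 * G x)" for k
        using yG G(3)
      proof eventually_elim
        case (elim x)
        have "\<bar>y x - Y k x\<bar> \<le> 2 * G x" using elim(1) elim(2)[rule_format, of k] by linarith
        then show ?case unfolding real_norm_def abs_mult by (intro mult_mono) auto
      qed
    qed (use ym in measurable)
    then have "(\<lambda>k. sqrt (ip M (\<lambda>x. y x - Y k x) (\<lambda>x. y x - Y k x))) \<longlonglongrightarrow> sqrt 0"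
      by (intro tendsto_real_sqrt) simp
    then show ?thesis by (simp add: nrm_def)
  qed
  have "nu i * ip M y (e i) = ip M (Nem y) (e i)" for i
  proof (rule LIMSEQ_unique)
    show "(\<lambda>k. ip M (Nem (Y k)) (e i)) \<longlonglongrightarrow> ip M (Nem y) (e i)"
      by (rule tendsto_ip_Nem[OF _ ym lim G(3,1)]) (auto simp: sq_e)
    have "(\<lambda>k. ip M y (e i) - ip M (Y k) (e i)) \<longlonglongrightarrow> 0"
    proof (rule Lim_null_comparison[OF _ diff], rule always_eventually, rule allI)
      fix k
      have "\<bar>ip M (\<lambda>x. y x - Y k x) (e i)\<bar> \<le> nrm M (\<lambda>x. y x - Y k x) * nrm M (e i)"
        by (intro Cauchy_Schwarz_ip sq_int_diff sqy sqY sq_e) simp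
      then show "norm (ip M y (e i) - ip M (Y k) (e i)) \<le> nrm M (\<lambda>x. y x - Y k x)"
        using ip_e[of i i] sq_e[of i] by (simp add: ip_diff_left sqy sqY nrm_def)
    qed
    from tendsto_diff[OF tendsto_const[of "ip M y (e i)"] this]
    have "(\<lambda>k. ip M (Y k) (e i)) \<longlonglongrightarrow> ip M y (e i)" by simp
    then have "(\<lambda>k. nu i * ip M (Y k) (e i)) \<longlonglongrightarrow> nu i * ip M y (e i)" by (rule tendsto_mult_left)
    \<comment> \<open>The i-th equation is satisfied by approximations of order above i, hence
      eventually along the subsequence.\<close>
    moreover have "\<forall>\<^sub>F k in sequentially. nu i * ip M (Y k) (e i) = ip M (Nem (Y k)) (e i)"
      using eventually_gt_at_top[of i]
    proof eventually_elim
      case (elim k)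
      have "k \<le> \<phi> (g k)" using seq_suble[OF strict_mono_o[OF \<phi> g]] by simp
      with elim have "i < \<phi> (g k)" by simp
      then show ?case
        unfolding Y_def Z_def by (simp add: ip_comb_e sol)
    qed
    ultimately show "(\<lambda>k. ip M (Nem (Y k)) (e i)) \<longlonglongrightarrow> nu i * ip M y (e i)"
      by (rule Lim_transform_eventually)
  qed
  moreover have "\<exists>n c. Y k = comb {..<n} c" for k unfolding Y_def Z_def by blast
  ultimately show ?thesis using that[OF _ y_def sqy diff] by blast
qed

end

section \<open>Sturm--Liouville theory\<close>

locale weight =
  fixes u u' u'' :: "real \<Rightarrow> real"
  assumes du: "\<And>x. x \<in> {0..pi} \<Longrightarrow> (u has_real_derivative u' x) (at x within {0..pi})"
    and ddu: "\<And>x. x \<in> {0..pi} \<Longrightarrow> (u' has_real_derivative u'' x) (at x within {0..pi})"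
    and cont_u'': "continuous_on {0..pi} u''"
    and u_pos: "\<And>x. x \<in> {0..pi} \<Longrightarrow> u x > 0"
begin

abbreviation J :: "real set" where "J \<equiv> {0..pi}"

text \<open>Restricting before taking the density keeps the arbitrary values of \<open>u\<close>
  outside \<open>J\<close> out of the measure.\<close>

definition W :: "real measure" where
  "W = density (restrict_space lborel J) (\<lambda>x. ennreal (u x))"

lemma cont_u: "continuous_on J u"
  by (rule DERIV_continuous_on[OF du])

lemma cont_u': "continuous_on J u'"
  by (rule DERIV_continuous_on[OF ddu])

lemma u_nz: "x \<in> J \<Longrightarrow> u x \<noteq> 0"
  using u_pos by force

lemma meas_J: "continuous_on J f \<Longrightarrow> f \<in> borel_measurable (restrict_space lborel J)"
  using borel_measurable_continuous_on_restrict[of J f]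
  by (simp add: measurable_cong_sets[OF sets_restrict_space_cong[OF sets_lborel] refl])

lemma meas_W: "continuous_on J f \<Longrightarrow> f \<in> borel_measurable W"
  unfolding W_def using meas_J by simp

lemma integral_W:
  assumes f: "continuous_on J (f :: real \<Rightarrow> real)"
  shows "integrable W f" "(LINT x|W. f x) = integral J (\<lambda>x. u x * f x)"
proof -
  have c: "continuous_on J (\<lambda>x. u x * f x)" by (intro continuous_intros cont_u f)
  have si: "set_integrable lborel J (\<lambda>x. u x * f x)"
    unfolding set_integrable_def using borel_integrable_atLeastAtMost'[OF c]
    by (simp add: set_integrable_def)
  have pos: "AE x in restrict_space lborel J. 0 \<le> u x"
    using u_pos by (intro AE_I2) (auto simp: space_restrict_space less_imp_le)
  show "integrable W f"
    unfolding W_def using si pos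
    by (subst integrable_density) (auto simp: meas_J f cont_u integrable_restrict_space set_integrable_def)
  have "(LINT x|W. f x) = (LINT x:J|lborel. u x * f x)"
    unfolding W_def using pos
    by (subst integral_density) (auto simp: meas_J f cont_u integral_restrict_space set_lebesgue_integral_def)
  also have "\<dots> = integral J (\<lambda>x. u x * f x)"
    by (rule set_borel_integral_eq_integral(2)[OF si])
  finally show "(LINT x|W. f x) = integral J (\<lambda>x. u x * f x)" .
qed

lemma ip_W:
  assumes "continuous_on J f" "continuous_on J g"
  shows "ip W f g = integral J (\<lambda>x. u x * (f x * g x))"
  unfolding ip_def by (intro integral_W continuous_intros assms)

lemma sq_W [intro]: "continuous_on J f \<Longrightarrow> sq_int W f"
  unfolding sq_int_def by (intro conjI meas_W integral_W continuous_intros)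

lemma ip_W_cong:
  assumes "continuous_on J f" "continuous_on J g" "\<And>x. x \<in> J \<Longrightarrow> f x = f1 x" "\<And>x. x \<in> J \<Longrightarrow> g x = g1 x"
  shows "ip W f g = ip W f1 g1"
proof -
  have "continuous_on J f1" "continuous_on J g1"
    using continuous_on_eq[OF assms(1,3)] continuous_on_eq[OF assms(2,4)] by auto
  with assms show ?thesis by (auto simp: ip_W intro!: integral_cong)
qed

text \<open>Positivity of \<open>u\<close> and continuity turn an identity in L2 into a pointwise
  one on \<open>J\<close>, endpoints included.\<close>

lemma nrm_W_zero:
  assumes f: "continuous_on J f" and "nrm W f = 0" and x: "x \<in> J"
  shows "f x = 0"
proof -
  have "integral J (\<lambda>x. u x * (f x * f x)) = 0"
    using assms(2) by (simp add: nrm_def ip_W f)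
  moreover have c: "continuous_on J (\<lambda>x. u x * (f x * f x))" by (intro continuous_intros cont_u f)
  ultimately have 0: "((\<lambda>x. u x * (f x * f x)) has_integral 0) (cbox 0 pi)"
    using integrable_integral[OF integrable_continuous_real[OF c]] by simp
  have "u x * (f x * f x) = 0"
  proof (rule has_integral_0_cbox_imp_0[OF _ _ 0])
    show "0 \<le> u s * (f s * f s)" if "s \<in> box 0 pi" for s
      using u_pos[of s] that by (simp add: less_imp_le)
    show "box 0 pi \<noteq> ({} :: real set)"
      unfolding box_real greaterThanLessThan_empty_iff not_le by (rule pi_gt_zero)
  qed (use c x in auto)
  then show ?thesis using u_nz[OF x] by simp
qed

lemma umin: obtains c where "c > 0" "\<And>x. x \<in> J \<Longrightarrow> c \<le> u x"
proof -
  obtain x0 where "x0 \<in> J" "\<And>x. x \<in> J \<Longrightarrow> u x0 \<le> u x"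
    using continuous_attains_inf[of J u] cont_u by force
  then show ?thesis using that u_pos by blast
qed

text \<open>The equation (u v')' = -u g in flux form, with \<open>v'\<close> as explicit witness and
  one-sided derivatives at the ends.\<close>

definition SLd :: "(real \<Rightarrow> real) \<Rightarrow> (real \<Rightarrow> real) \<Rightarrow> (real \<Rightarrow> real) \<Rightarrow> bool" where
  "SLd g v v' \<longleftrightarrow> (\<forall>x\<in>J. (v has_real_derivative v' x) (at x within J) \<and>
      ((\<lambda>s. u s * v' s) has_real_derivative - (u x * g x)) (at x within J))"

text \<open>The graph of the Green operator of -(u v')'/u with Dirichlet conditions: g is the
  source, v its image. An eigenfunction is the image of its eigenvalue times itself.\<close>

definition sol :: "(real \<Rightarrow> real) \<Rightarrow> (real \<Rightarrow> real) \<Rightarrow> bool" where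
  "sol g v \<longleftrightarrow> continuous_on J g \<and> v 0 = 0 \<and> v pi = 0 \<and> (\<exists>v'. SLd g v v')"

lemma SLd_D:
  assumes "SLd g v v'" "x \<in> J"
  shows "(v has_real_derivative v' x) (at x within J)"
    "((\<lambda>s. u s * v' s) has_real_derivative - (u x * g x)) (at x within J)"
  using assms by (auto simp: SLd_def)

lemma SLd_cont:
  assumes "SLd g v v'"
  shows "continuous_on J v" "continuous_on J v'" "continuous_on J (\<lambda>s. u s * v' s)"
proof -
  show "continuous_on J v" by (rule DERIV_continuous_on[OF SLd_D(1)[OF assms]])
  show c: "continuous_on J (\<lambda>s. u s * v' s)" by (rule DERIV_continuous_on[OF SLd_D(2)[OF assms]])
  have "continuous_on J (\<lambda>s. (u s * v' s) / u s)"
    using u_nz by (intro continuous_on_divide c cont_u) auto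
  then show "continuous_on J v'"
    by (rule continuous_on_eq) (use u_nz in auto)
qed

lemma sol_cont: "sol g v \<Longrightarrow> continuous_on J g" "sol g v \<Longrightarrow> continuous_on J v"
  using SLd_cont by (auto simp: sol_def)

lemma SLd_lincomb:
  assumes "SLd g v v'" "SLd h w w'"
  shows "SLd (\<lambda>x. a * g x + b * h x) (\<lambda>x. a * v x + b * w x) (\<lambda>x. a * v' x + b * w' x)"
  unfolding SLd_def
proof (intro ballI conjI)
  fix x assume x: "x \<in> J"
  show "((\<lambda>x. a * v x + b * w x) has_real_derivative a * v' x + b * w' x) (at x within J)"
    by (intro derivative_intros DERIV_cmult SLd_D[OF assms(1) x] SLd_D[OF assms(2) x])
  have "((\<lambda>s. a * (u s * v' s) + b * (u s * w' s)) has_real_derivative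
    a * - (u x * g x) + b * - (u x * h x)) (at x within J)"
    by (intro derivative_intros DERIV_cmult SLd_D[OF assms(1) x] SLd_D[OF assms(2) x])
  then show "((\<lambda>s. u s * (a * v' s + b * w' s)) has_real_derivative - (u x * (a * g x + b * h x))) (at x within J)"
    by (simp add: algebra_simps)
qed

lemma sol_lincomb:
  assumes "sol g v" "sol h w"
  shows "sol (\<lambda>x. a * g x + b * h x) (\<lambda>x. a * v x + b * w x)"
  using assms SLd_lincomb unfolding sol_def by (fastforce intro!: continuous_intros)

lemma FTC_J:
  assumes "a \<in> J" "b \<in> J" "a \<le> b" "\<And>x. x \<in> J \<Longrightarrow> (F has_real_derivative f x) (at x within J)"
  shows "(f has_integral F b - F a) {a..b}"
proof (rule fundamental_theorem_of_calculus)
  fix x assume x: "x \<in> {a..b}"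
  then have "(F has_real_derivative f x) (at x within J)" using assms by auto
  then have "(F has_real_derivative f x) (at x within {a..b})"
    by (rule DERIV_subset) (use assms in auto)
  then show "(F has_vector_derivative f x) (at x within {a..b})"
    by (simp add: has_real_derivative_iff_has_vector_derivative)
qed fact

lemma Green:
  assumes S: "SLd g v v'" and g: "continuous_on J g"
    and w: "\<And>x. x \<in> J \<Longrightarrow> (w has_real_derivative w' x) (at x within J)" and w': "continuous_on J w'"
    and bc: "w 0 = 0" "w pi = 0"
  shows "ip W v' w' = ip W g w"
proof -
  have cw: "continuous_on J w" by (rule DERIV_continuous_on[OF w])
  note cv = SLd_cont[OF S]
  have "((\<lambda>x. (u x * v' x) * w' x + - (u x * g x) * w x) has_integral (u pi * v' pi * w pi - u 0 * v' 0 * w 0)) {0..pi}"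
    by (rule FTC_J[OF _ _ _ DERIV_mult'[OF SLd_D(2)[OF S] w]]) auto
  then have "((\<lambda>x. u x * (v' x * w' x) - u x * (g x * w x)) has_integral 0) J"
    using bc by (simp add: algebra_simps)
  then have "integral J (\<lambda>x. u x * (v' x * w' x) - u x * (g x * w x)) = 0" by (rule integral_unique)
  moreover have "integral J (\<lambda>x. u x * (v' x * w' x) - u x * (g x * w x))
      = integral J (\<lambda>x. u x * (v' x * w' x)) - integral J (\<lambda>x. u x * (g x * w x))"
    by (intro Henstock_Kurzweil_Integration.integral_diff integrable_continuous_real continuous_intros cont_u cv w' g cw)
  ultimately show ?thesis by (simp add: ip_W cv w' g cw)
qed

text \<open>The Green operator is symmetric, since both sides equal the energy
  \<open>ip W v' w'\<close>.\<close>

lemma sol_sym: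
  assumes "sol g v" "sol h w"
  shows "ip W g w = ip W v h"
proof -
  obtain v' w' where S: "SLd g v v'" "SLd h w w'" using assms by (auto simp: sol_def)
  have "ip W v' w' = ip W g w"
    by (rule Green[OF S(1) _ SLd_D(1)[OF S(2)] SLd_cont(2)[OF S(2)]]) (use assms in \<open>auto simp: sol_def\<close>)
  moreover have "ip W w' v' = ip W h v"
    by (rule Green[OF S(2) _ SLd_D(1)[OF S(1)] SLd_cont(2)[OF S(1)]]) (use assms in \<open>auto simp: sol_def\<close>)
  ultimately show ?thesis by (simp add: ip_commute)
qed

lemma sol_pos:
  assumes "sol g v"
  shows "0 \<le> ip W v g"
proof -
  obtain v' where S: "SLd g v v'" using assms by (auto simp: sol_def)
  have "ip W v' v' = ip W g v"
    by (rule Green[OF S _ SLd_D(1)[OF S] SLd_cont(2)[OF S]]) (use assms in \<open>auto simp: sol_def\<close>)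
  then show ?thesis using ip_nonneg[of W v'] by (simp add: ip_commute)
qed

text \<open>One-dimensional Sobolev embedding: the integral of |v'| is the inner product of 1/u and
  |v'| in \<open>W\<close>, to which Cauchy-Schwarz applies. The constant is |1/u|^2, increased by 1
  to be positive.\<close>

lemma derivative_bound:
  obtains P0 where "P0 > 0" "\<And>v v' x. \<lbrakk>\<And>x. x \<in> J \<Longrightarrow> (v has_real_derivative v' x) (at x within J);
    continuous_on J v'; v 0 = 0; x \<in> J\<rbrakk> \<Longrightarrow> (v x)\<^sup>2 \<le> P0 * ip W v' v'"
proof -
  define P0 where "P0 = ip W (\<lambda>x. 1 / u x) (\<lambda>x. 1 / u x) + 1"
  have cu: "continuous_on J (\<lambda>x. 1 / u x)" using u_nz by (intro continuous_intros cont_u) auto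
  have "(v x)\<^sup>2 \<le> P0 * ip W v' v'"
    if v: "\<And>x. x \<in> J \<Longrightarrow> (v has_real_derivative v' x) (at x within J)"
      and v': "continuous_on J v'" and "v 0 = 0" and x: "x \<in> J" for v v' x
  proof -
    have i: "(v' has_integral v x - v 0) {0..x}" by (rule FTC_J[OF _ x _ v]) (use x in auto)
    have cx: "continuous_on {0..x} v'" using v' by (rule continuous_on_subset) (use x in auto)
    have "\<bar>v x\<bar> = norm (integral {0..x} v')" using i \<open>v 0 = 0\<close> by (simp add: integral_unique)
    also have "\<dots> \<le> integral {0..x} (\<lambda>s. \<bar>v' s\<bar>)"
      by (intro integral_norm_bound_integral integrable_continuous_real continuous_intros cx) auto
    also have "\<dots> \<le> integral J (\<lambda>s. \<bar>v' s\<bar>)"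
      using x by (intro integral_subset_le integrable_continuous_real continuous_intros cx v') auto
    also have "\<dots> = ip W (\<lambda>x. 1 / u x) (\<lambda>s. \<bar>v' s\<bar>)"
      using u_nz by (subst ip_W) (auto intro!: integral_cong continuous_intros v' cont_u)
    also have "\<dots> \<le> nrm W (\<lambda>x. 1 / u x) * nrm W (\<lambda>s. \<bar>v' s\<bar>)"
      using Cauchy_Schwarz_ip[OF sq_W[OF cu] sq_int_abs[OF sq_W[OF v']]] by linarith
    finally have "\<bar>v x\<bar>\<^sup>2 \<le> (nrm W (\<lambda>x. 1 / u x) * nrm W v')\<^sup>2" by (intro power_mono) auto
    also have "\<dots> = (P0 - 1) * ip W v' v'" by (simp add: power_mult_distrib nrm_square P0_def)
    also have "\<dots> \<le> P0 * ip W v' v'" by (intro mult_right_mono) auto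
    finally show ?thesis by simp
  qed
  moreover have "P0 > 0" by (simp add: P0_def add_nonneg_pos)
  ultimately show ?thesis using that by blast
qed

text \<open>By Rolle v' vanishes somewhere; integrating the flux equation from there bounds u v' by
  |1| |g|, and dividing by the minimum of \<open>u\<close> bounds v'. This provides the
  equicontinuity for Arzela-Ascoli.\<close>

lemma sol_Lipschitz:
  obtains C where "C > 0" "\<And>g v x y. sol g v \<Longrightarrow> x \<in> J \<Longrightarrow> y \<in> J \<Longrightarrow> \<bar>v x - v y\<bar> \<le> C * nrm W g * \<bar>x - y\<bar>"
proof -
  obtain c where c: "c > 0" "\<And>x. x \<in> J \<Longrightarrow> c \<le> u x" using umin by blast
  define C where "C = (nrm W (\<lambda>x. 1) + 1) / c"
  have "\<bar>v x - v y\<bar> \<le> C * nrm W g * \<bar>x - y\<bar>" if s: "sol g v" and xy: "x \<in> J" "y \<in> J" for g v x y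
  proof -
    obtain v' where S: "SLd g v v'" using s by (auto simp: sol_def)
    have cg: "continuous_on J g" using s by (simp add: sol_def)
    note cv = SLd_cont[OF S]
    have "\<exists>z. 0 < z \<and> z < pi \<and> (v has_real_derivative 0) (at z)"
    proof (rule Rolle[of 0 pi v])
      fix x :: real assume "0 < x" "x < pi"
      then have "(v has_real_derivative v' x) (at x)"
        using SLd_D(1)[OF S, of x] by (simp add: at_within_Icc_at)
      then show "v differentiable (at x)" unfolding real_differentiable_def by blast
    qed (use s cv in \<open>auto simp: sol_def\<close>)
    then obtain \<xi> where \<xi>: "0 < \<xi>" "\<xi> < pi" "(v has_real_derivative 0) (at \<xi>)" by blast
    have "(v has_real_derivative v' \<xi>) (at \<xi>)"
      using SLd_D(1)[OF S, of \<xi>] \<xi> by (simp add: at_within_Icc_at)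
    then have v0: "v' \<xi> = 0" using \<xi>(3) by (rule DERIV_unique)
    have bnd: "\<bar>v' x\<bar> \<le> C * nrm W g" if x: "x \<in> J" for x
    proof -
      define a b where "a = min \<xi> x" and "b = max \<xi> x"
      have ab: "a \<in> J" "b \<in> J" "a \<le> b" using \<xi> x by (auto simp: a_def b_def)
      have i: "((\<lambda>s. - (u s * g s)) has_integral u b * v' b - u a * v' a) {a..b}"
        by (rule FTC_J[OF ab SLd_D(2)[OF S]])
      have cx: "continuous_on {a..b} u" "continuous_on {a..b} g"
        using cont_u cg ab by (auto intro: continuous_on_subset)
      have "\<bar>u x * v' x\<bar> = norm (integral {a..b} (\<lambda>s. - (u s * g s)))"
        unfolding integral_unique[OF i] using v0 by (auto simp: a_def b_def min_def max_def)
      also have "\<dots> \<le> integral {a..b} (\<lambda>s. u s * \<bar>g s\<bar>)"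
      proof (intro integral_norm_bound_integral integrable_continuous_real continuous_intros cx)
        fix s assume "s \<in> {a..b}"
        then have "u s > 0" using u_pos ab by auto
        then show "norm (- (u s * g s)) \<le> u s * \<bar>g s\<bar>" by (simp add: abs_mult)
      qed
      also have "\<dots> \<le> integral J (\<lambda>s. u s * \<bar>g s\<bar>)"
        using ab u_pos by (intro integral_subset_le integrable_continuous_real continuous_intros cx cont_u cg)
          (auto simp: less_imp_le)
      also have "\<dots> = ip W (\<lambda>x. 1) (\<lambda>s. \<bar>g s\<bar>)"
        by (subst ip_W) (auto intro!: continuous_intros cg)
      also have "\<dots> \<le> nrm W (\<lambda>x. 1) * nrm W (\<lambda>s. \<bar>g s\<bar>)"
        using Cauchy_Schwarz_ip[OF sq_W[OF continuous_on_const] sq_int_abs[OF sq_W[OF cg]], of 1] by linarith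
      finally have "u x * \<bar>v' x\<bar> \<le> nrm W (\<lambda>x. 1) * nrm W g"
        using u_pos[OF x] by (simp add: abs_mult)
      moreover have "c * \<bar>v' x\<bar> \<le> u x * \<bar>v' x\<bar>" using c x by (intro mult_right_mono) auto
      moreover have "nrm W (\<lambda>x. 1) * nrm W g \<le> (nrm W (\<lambda>x. 1) + 1) * nrm W g" by (intro mult_right_mono) auto
      ultimately have "c * \<bar>v' x\<bar> \<le> (nrm W (\<lambda>x. 1) + 1) * nrm W g" by linarith
      then show ?thesis using c(1) by (simp add: C_def field_simps)
    qed
    have "norm (v x - v y) \<le> (C * nrm W g) * norm (x - y)"
    proof (rule field_differentiable_bound[of J v v'])
      show "(v has_field_derivative v' z) (at z within J)" if "z \<in> J" for z
        by (rule SLd_D(1)[OF S that])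
    qed (use bnd xy in auto)
    then show ?thesis by simp
  qed
  moreover have "C > 0" using c(1) by (simp add: C_def add_nonneg_pos)
  ultimately show ?thesis using that by blast
qed

text \<open>Two quadratures: u v' = A - K with K the integral of u g. The constant \<open>A\<close>
  is fixed by v(pi) = 0, which is possible because the integral of 1/u does not vanish.\<close>

lemma sol_exists:
  assumes g: "continuous_on J g"
  obtains v where "sol g v"
proof -
  define K where "K = (\<lambda>x. integral {0..x} (\<lambda>s. u s * g s))"
  have K: "(K has_real_derivative u x * g x) (at x within J)" if "x \<in> J" for x
    unfolding K_def using that
    by (intro integral_has_real_derivative continuous_intros cont_u g) auto
  have cK: "continuous_on J K" by (rule DERIV_continuous_on[OF K])
  define P where "P = (\<lambda>x. integral {0..x} (\<lambda>s. 1 / u s))"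
  have P: "(P has_real_derivative 1 / u x) (at x within J)" if "x \<in> J" for x
    unfolding P_def using that u_nz
    by (intro integral_has_real_derivative continuous_intros cont_u) auto
  define Q where "Q = (\<lambda>x. integral {0..x} (\<lambda>s. K s / u s))"
  have Q: "(Q has_real_derivative K x / u x) (at x within J)" if "x \<in> J" for x
    unfolding Q_def using that u_nz
    by (intro integral_has_real_derivative continuous_intros cont_u cK) auto
  have "P pi \<noteq> 0"
  proof
    assume 0: "P pi = 0"
    have "\<exists>x\<in>{0..pi}. P pi - P 0 = (*) (1 / u x) (pi - 0)"
    proof (rule mvt_very_simple)
      fix x assume "0 \<le> x" "x \<le> pi"
      then show "(P has_derivative (*) (1 / u x)) (at x within {0..pi})"
        using P[of x] unfolding has_field_derivative_def by simp
    qed simp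
    then show False using 0 u_nz by (auto simp: P_def)
  qed
  define A where "A = Q pi / P pi"
  have "SLd g (\<lambda>x. A * P x - Q x) (\<lambda>x. (A - K x) / u x)"
    unfolding SLd_def
  proof (intro ballI conjI)
    fix x assume x: "x \<in> J"
    have "((\<lambda>x. A * P x - Q x) has_real_derivative A * (1 / u x) - K x / u x) (at x within J)"
      by (intro derivative_intros DERIV_cmult P Q x)
    then show "((\<lambda>x. A * P x - Q x) has_real_derivative (A - K x) / u x) (at x within J)"
      by (simp add: diff_divide_distrib)
    have "((\<lambda>x. A - K x) has_real_derivative 0 - u x * g x) (at x within J)"
      by (intro derivative_intros K x)
    then have "((\<lambda>x. A - K x) has_real_derivative - (u x * g x)) (at x within J)" by simp
    then show "((\<lambda>s. u s * ((A - K s) / u s)) has_real_derivative - (u x * g x)) (at x within J)"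
      by (rule has_field_derivative_transform_within[where d = 1]) (use x u_nz in auto)
  qed
  moreover have "A * P pi - Q pi = 0" using \<open>P pi \<noteq> 0\<close> by (simp add: A_def)
  moreover have "A * P 0 - Q 0 = 0" by (simp add: P_def Q_def)
  ultimately have "sol g (\<lambda>x. A * P x - Q x)" unfolding sol_def using g by (intro conjI exI)
  then show ?thesis by (rule that)
qed

text \<open>Gronwall: with p = u w' the derivative of E = w^2 + p^2 is 2 w p (1/u - \<mu> u) \<le> C
  E, so E exp(-C x) cannot rise above its initial value 0.\<close>

lemma initial_value_unique:
  assumes S: "SLd (\<lambda>x. \<mu> * w x) w w'" and "w 0 = 0" "w' 0 = 0" and x: "x \<in> J"
  shows "w x = 0"
proof -
  let ?p = "\<lambda>s. u s * w' s"
  define E where "E = (\<lambda>x. (w x)\<^sup>2 + (?p x)\<^sup>2)"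
  have "bounded ((\<lambda>x. 1 / u x - \<mu> * u x) ` J)"
    using u_nz by (intro compact_imp_bounded compact_continuous_image continuous_intros cont_u) auto
  then obtain C where "\<forall>y\<in>(\<lambda>x. 1 / u x - \<mu> * u x) ` J. norm y \<le> C"
    unfolding bounded_iff by blast
  then have C: "\<bar>1 / u x - \<mu> * u x\<bar> \<le> C" if "x \<in> J" for x using that by simp
  define G where "G = (\<lambda>x. E x * exp (- C * x))"
  define G' where "G' = (\<lambda>x. (2 * w x * ?p x * (1 / u x - \<mu> * u x) - C * E x) * exp (- C * x))"
  have G: "(G has_real_derivative G' s) (at s within {0..x})" if s: "s \<in> {0..x}" for s
  proof -
    have sJ: "s \<in> J" using s x by auto
    have "(G has_real_derivative (2 * w s * w' s + 2 * ?p s * (- (u s * (\<mu> * w s)))) * exp (- C * s)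
      + E s * (exp (- C * s) * (- C))) (at s within J)"
      unfolding G_def E_def
      by (rule derivative_eq_intros SLd_D[OF S sJ] refl | simp)+
    also have "(2 * w s * w' s + 2 * ?p s * (- (u s * (\<mu> * w s)))) * exp (- C * s) + E s * (exp (- C * s) * (- C)) = G' s"
      using u_nz[OF sJ] by (simp add: G'_def field_simps)
    finally show ?thesis by (rule DERIV_subset) (use x in auto)
  qed
  have "\<exists>s\<in>{0..x}. G x - G 0 = (*) (G' s) (x - 0)"
    by (rule mvt_very_simple) (use G x in \<open>auto simp: has_field_derivative_def\<close>)
  then obtain s where s: "s \<in> {0..x}" "G x - G 0 = G' s * x" by auto
  have "2 * w s * ?p s * (1 / u s - \<mu> * u s) \<le> C * E s"
  proof -
    have "2 * w s * ?p s * (1 / u s - \<mu> * u s) \<le> \<bar>2 * w s * ?p s\<bar> * \<bar>1 / u s - \<mu> * u s\<bar>"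
      by (simp add: abs_mult[symmetric])
    also have "\<dots> \<le> E s * C"
    proof (intro mult_mono C)
      show "\<bar>2 * w s * ?p s\<bar> \<le> E s"
        using zero_le_power2[of "w s - ?p s"] zero_le_power2[of "w s + ?p s"]
        unfolding E_def power2_sum power2_diff by (simp add: abs_le_iff)
    qed (use s x in \<open>auto simp: E_def\<close>)
    finally show ?thesis by (simp add: mult.commute)
  qed
  then have "G' s \<le> 0" by (simp add: G'_def mult_le_0_iff)
  then have "G' s * x \<le> 0" using s x by (intro mult_nonpos_nonneg) auto
  then have "G x \<le> G 0" using s by linarith
  also have "G 0 = 0" using assms by (simp add: G_def E_def)
  finally have "E x \<le> 0" by (simp add: G_def mult_le_0_iff)
  then have "(w x)\<^sup>2 \<le> 0" unfolding E_def using zero_le_power2[of "?p x"] by linarith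
  then show ?thesis by simp
qed

text \<open>The combination w'(0) v - v'(0) w has vanishing value and slope at 0, hence vanishes;
  w'(0) is nonzero since otherwise w itself would vanish.\<close>

lemma eigenfunction_simple:
  assumes "SLd (\<lambda>x. \<mu> * v x) v v'" "v 0 = 0" "SLd (\<lambda>x. \<mu> * w x) w w'" "w 0 = 0"
    and nz: "z \<in> J" "w z \<noteq> 0"
  obtains c where "\<And>x. x \<in> J \<Longrightarrow> v x = c * w x"
proof -
  have "w' 0 \<noteq> 0" using initial_value_unique[OF assms(3,4) _ nz(1)] nz(2) by blast
  have "SLd (\<lambda>x. \<mu> * (w' 0 * v x + - v' 0 * w x)) (\<lambda>x. w' 0 * v x + - v' 0 * w x) (\<lambda>x. w' 0 * v' x + - v' 0 * w' x)"
    using SLd_lincomb[OF assms(1,3), of "w' 0" "- v' 0"] by (simp add: algebra_simps)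
  from initial_value_unique[OF this] have "w' 0 * v x + - v' 0 * w x = 0" if "x \<in> J" for x
    using assms that by simp
  then have "v x = v' 0 / w' 0 * w x" if "x \<in> J" for x
    using that \<open>w' 0 \<noteq> 0\<close> by (simp add: field_simps)
  then show ?thesis using that by blast
qed

end

section \<open>Eigenfunctions, eigenvalue growth and completeness\<close>

locale SL_basis = weight +
  fixes lam2 :: "nat \<Rightarrow> real" and phi :: "nat \<Rightarrow> real \<Rightarrow> real"
  assumes SL: "SL_system u lam2 phi"
begin

lemma phi_sol: assumes "n \<ge> 1" shows "sol (\<lambda>x. lam2 n * phi n x) (phi n)"
proof -
  from SL assms obtain \<phi>' where
    d: "\<forall>x\<in>J. (phi n has_real_derivative \<phi>' x) (at x within J)"
    "\<forall>x\<in>J. ((\<lambda>s. u s * \<phi>' s) has_real_derivative (- lam2 n * u x * phi n x)) (at x within J)"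
    and bc: "phi n 0 = 0" "phi n pi = 0"
    unfolding SL_system_def SL_eigenpair_def by blast
  have "SLd (\<lambda>x. lam2 n * phi n x) (phi n) \<phi>'"
    using d unfolding SLd_def by (simp add: ac_simps)
  moreover have "continuous_on J (phi n)" using d(1) by (intro DERIV_continuous_on) blast
  ultimately show ?thesis using bc unfolding sol_def by (auto intro!: continuous_intros)
qed

lemma phi_cont: "n \<ge> 1 \<Longrightarrow> continuous_on J (phi n)"
  using sol_cont(2)[OF phi_sol] .

definition phi' :: "nat \<Rightarrow> real \<Rightarrow> real" where
  "phi' n = (SOME v'. SLd (\<lambda>x. lam2 n * phi n x) (phi n) v')"

lemma phi': "n \<ge> 1 \<Longrightarrow> SLd (\<lambda>x. lam2 n * phi n x) (phi n) (phi' n)"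
  unfolding phi'_def using phi_sol[of n] unfolding sol_def by (intro someI_ex[where P = "SLd _ _"]) blast

lemma lam2_less: "1 \<le> n \<Longrightarrow> n < m \<Longrightarrow> lam2 n < lam2 m"
  using SL by (auto simp: SL_system_def)

lemma lam2_le: "1 \<le> n \<Longrightarrow> n \<le> m \<Longrightarrow> lam2 n \<le> lam2 m"
  using lam2_less[of n m] by (cases "n = m") auto

lemma phi_normalized: assumes "n \<ge> 1" shows "ip W (phi n) (phi n) = 1"
proof -
  have c: "continuous_on J (\<lambda>x. u x * (phi n x)\<^sup>2)"
    by (intro continuous_intros cont_u phi_cont assms)
  have "(LBINT x=0..pi. u x * (phi n x)\<^sup>2) = (LBINT x:J. u x * (phi n x)\<^sup>2)"
    using interval_integral_Icc[of 0 pi "\<lambda>x. u x * (phi n x)\<^sup>2"] by (simp add: zero_ereal_def)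
  also have "\<dots> = integral J (\<lambda>x. u x * (phi n x)\<^sup>2)"
    by (rule set_borel_integral_eq_integral(2)[OF borel_integrable_atLeastAtMost'[OF c]])
  finally show ?thesis
    using SL assms by (simp add: SL_system_def ip_W phi_cont power2_eq_square)
qed

lemma ip_sol_phi:
  assumes "sol g v" "n \<ge> 1"
  shows "ip W g (phi n) = lam2 n * ip W v (phi n)"
  using sol_sym[OF assms(1) phi_sol[OF assms(2)]] by (simp add: ip_cmult_right)

lemma phi_orthogonal:
  assumes "n \<ge> 1" "m \<ge> 1" "n \<noteq> m"
  shows "ip W (phi n) (phi m) = 0"
proof -
  have "lam2 n * ip W (phi n) (phi m) = lam2 m * ip W (phi n) (phi m)"
    using ip_sol_phi[OF phi_sol[OF assms(1)] assms(2)] by (simp add: ip_cmult_left)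
  moreover have "lam2 n \<noteq> lam2 m"
    using lam2_less[of n m] lam2_less[of m n] assms by (cases "n < m") auto
  ultimately show ?thesis by simp
qed

sublocale orthonormal W "{1..}" phi
  by unfold_locales (auto intro!: sq_W phi_cont simp: phi_normalized phi_orthogonal)

lemma ip_phi':
  assumes "n \<ge> 1" "m \<ge> 1"
  shows "ip W (phi' n) (phi' m) = (if n = m then lam2 n else 0)"
proof -
  have "ip W (phi' n) (phi' m) = ip W (\<lambda>x. lam2 n * phi n x) (phi m)"
  proof (rule Green[OF phi'[OF assms(1)] _ _ SLd_cont(2)[OF phi'[OF assms(2)]]])
    show "(phi m has_real_derivative phi' m x) (at x within J)" if "x \<in> J" for x
      by (rule SLd_D(1)[OF phi'[OF assms(2)] that])
  qed (use phi_sol[OF assms(1)] phi_sol[OF assms(2)] in \<open>auto simp: sol_def\<close>)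
  then show ?thesis using ip_e[of n m] assms by (simp add: ip_cmult_left)
qed

text \<open>Bessel's inequality for the orthogonal system \<open>phi' n\<close>, tested against the primitive
  \<open>phi n x\<close>, bounds \<open>\<Sum> (phi n x)\<^sup>2 / lam2 n\<close> uniformly in \<open>x\<close>; integrating over \<open>x\<close> bounds
  \<open>\<Sum> 1 / lam2 n\<close>.\<close>
lemma lam2_growth:
  obtains c where "c > 0" "\<And>n. n \<ge> 1 \<Longrightarrow> c * n \<le> lam2 n"
proof -
  obtain P0 where P0: "P0 > 0" "\<And>v v' x. \<lbrakk>\<And>x. x \<in> J \<Longrightarrow> (v has_real_derivative v' x) (at x within J);
    continuous_on J v'; v 0 = 0; x \<in> J\<rbrakk> \<Longrightarrow> (v x)\<^sup>2 \<le> P0 * ip W v' v'"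
    using derivative_bound by blast
  note d = SLd_D(1)[OF phi'] and c = SLd_cont(2)[OF phi']
  have phi0: "phi n 0 = 0" if "n \<ge> 1" for n using phi_sol[OF that] by (simp add: sol_def)
  define U where "U = ip W (\<lambda>x. 1) (\<lambda>x. 1)"
  have intc: "(LINT x|W. k) = k * U" for k
    using ip_cmult_left[of W k "\<lambda>x. 1" "\<lambda>x. 1"] by (simp add: U_def ip_def)
  have U0: "U \<ge> 0" by (simp add: U_def)
  have mono_W: "integral\<^sup>L W f \<le> k * U" if "continuous_on J f" "\<And>x. x \<in> J \<Longrightarrow> f x \<le> k" for f k
  proof -
    have "integral\<^sup>L W f \<le> (LINT x|W. k)"
      by (rule integral_mono[OF integral_W(1)[OF that(1)] integral_W(1)[OF continuous_on_const]])
        (use that(2) in \<open>auto simp: W_def space_restrict_space\<close>)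
    then show ?thesis by (simp only: intc)
  qed
  \<comment> \<open>\<open>lam2 n\<close> is the energy of \<open>phi n\<close>, hence nonnegative;
    if it were 0, the embedding would force \<open>phi n\<close> to vanish on \<open>J\<close>,
    against the normalisation.\<close>
  have pos: "lam2 n > 0" if n: "n \<ge> 1" for n
  proof -
    have "(phi n x)\<^sup>2 \<le> P0 * lam2 n" if "x \<in> J" for x
      using P0(2)[OF d[OF n] c[OF n] phi0[OF n] that] ip_phi'[OF n n] by simp
    then have "(LINT x|W. (phi n x)\<^sup>2) \<le> P0 * lam2 n * U"
      by (intro mono_W continuous_intros phi_cont n)
    then have "1 \<le> P0 * lam2 n * U"
      using phi_normalized[OF n] by (simp add: ip_def power2_eq_square)
    moreover have "lam2 n \<ge> 0" using ip_phi'[OF n n] ip_nonneg[of W "phi' n"] by simp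
    ultimately show ?thesis using P0(1) by (cases "lam2 n = 0") auto
  qed
  have S: "(\<Sum>n=1..N. (phi n x)\<^sup>2 / lam2 n) \<le> P0" if x: "x \<in> J" for N x
  proof -
    define S where "S = (\<Sum>n=1..N. (phi n x)\<^sup>2 / lam2 n)"
    \<comment> \<open>With these coefficients the combination of the \<open>phi n\<close> takes the
      value S at the point x, and its energy is S too. The embedding then reads S^2 \<le> P0
      S.\<close>
    define a where "a = (\<lambda>n. phi n x / lam2 n)"
    have sqc: "sq_int W (phi' n)" if "n \<ge> 1" for n by (intro sq_W c that)
    have "(\<Sum>n=1..N. a n * phi n x)\<^sup>2 \<le> P0 * ip W (\<lambda>s. \<Sum>n=1..N. a n * phi' n s) (\<lambda>s. \<Sum>n=1..N. a n * phi' n s)"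
    proof (rule P0(2)[OF _ _ _ x])
      show "((\<lambda>s. \<Sum>n=1..N. a n * phi n s) has_real_derivative (\<Sum>n=1..N. a n * phi' n s)) (at s within J)"
        if "s \<in> J" for s
        by (intro DERIV_sum DERIV_cmult d that) auto
      show "continuous_on J (\<lambda>s. \<Sum>n=1..N. a n * phi' n s)"
        by (intro continuous_intros c) auto
    qed (auto simp: phi0)
    also have "ip W (\<lambda>s. \<Sum>n=1..N. a n * phi' n s) (\<lambda>s. \<Sum>n=1..N. a n * phi' n s) = S"
    proof -
      have "ip W (\<lambda>s. \<Sum>n=1..N. a n * phi' n s) (\<lambda>s. \<Sum>n=1..N. a n * phi' n s)
        = (\<Sum>n=1..N. a n * (\<Sum>m=1..N. a m * ip W (phi' m) (phi' n)))"
        by (subst ip_sum_left, (auto intro!: sq_int_sum sq_int_cmult sqc)[2],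
            intro sum.cong refl, subst ip_cmult_left, subst ip_commute,
            subst ip_sum_left) (auto intro!: sq_int_sum sq_int_cmult sqc simp: ip_cmult_left)
      also have "\<dots> = (\<Sum>n=1..N. a n * (a n * lam2 n))"
      proof (intro sum.cong refl arg_cong2[where f="(*)"])
        fix n assume n: "n \<in> {1..N}"
        have "(\<Sum>m=1..N. a m * ip W (phi' m) (phi' n)) = (\<Sum>m=1..N. if m = n then a n * lam2 n else 0)"
          using n by (intro sum.cong) (auto simp: ip_phi')
        then show "(\<Sum>m=1..N. a m * ip W (phi' m) (phi' n)) = a n * lam2 n" using n by simp
      qed
      also have "\<dots> = S"
        unfolding S_def by (intro sum.cong) (use pos in \<open>force simp: a_def power2_eq_square\<close>)+
      finally show ?thesis .
    qed
    also have "(\<Sum>n=1..N. a n * phi n x) = S"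
      unfolding S_def a_def by (simp add: power2_eq_square)
    finally have "S * S \<le> P0 * S" by (simp add: power2_eq_square)
    moreover have "S \<ge> 0" unfolding S_def using pos by (intro sum_nonneg divide_nonneg_pos) auto
    ultimately have "S \<le> P0" using P0(1) by (cases "S = 0") auto
    then show ?thesis by (simp add: S_def)
  qed
  have U: "N \<le> P0 * U * lam2 N" if N: "N \<ge> 1" for N :: nat
  proof -
    have "(\<Sum>n=1..N. 1 / lam2 n) = (LINT x|W. (\<Sum>n=1..N. (phi n x)\<^sup>2 / lam2 n))"
    proof -
      have "(LINT x|W. (\<Sum>n=1..N. (phi n x)\<^sup>2 / lam2 n)) = (\<Sum>n=1..N. LINT x|W. (phi n x)\<^sup>2 / lam2 n)"
        using pos by (intro Bochner_Integration.integral_sum integral_W continuous_intros phi_cont) force+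
      also have "\<dots> = (\<Sum>n=1..N. 1 / lam2 n)"
        using phi_normalized by (intro sum.cong refl) (simp add: ip_def power2_eq_square)
      finally show ?thesis ..
    qed
    also have "\<dots> \<le> P0 * U"
      using pos by (intro mono_W S continuous_intros phi_cont) force+
    finally have "(\<Sum>n=1..N. 1 / lam2 n) \<le> P0 * U" .
    \<comment> \<open>As \<open>lam2\<close> increases, 1 / lam2 N is the smallest of the N terms,
      so N / lam2 N is at most the bounded sum.\<close>
    moreover have "(\<Sum>n=1..N. 1 / lam2 N) \<le> (\<Sum>n=1..N. 1 / lam2 n)"
      using pos lam2_le by (intro sum_mono divide_left_mono) auto
    ultimately have "N / lam2 N \<le> P0 * U" by simp
    then show ?thesis using pos[OF N] by (simp add: field_simps)
  qed
  have "P0 * U > 0" using U[of 1] P0(1) U0 by (cases "U = 0") auto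
  show ?thesis
  proof (rule that)
    show "1 / (P0 * U) > 0" using \<open>P0 * U > 0\<close> by simp
    show "1 / (P0 * U) * n \<le> lam2 n" if "n \<ge> 1" for n
      using U[OF that] \<open>P0 * U > 0\<close> by (simp add: field_simps)
  qed
qed

lemma lam2_pos: "n \<ge> 1 \<Longrightarrow> lam2 n > 0"
  using lam2_growth by (metis less_le_trans mult_pos_pos of_nat_0_less_iff zero_less_one)

definition perp :: "nat \<Rightarrow> (real \<Rightarrow> real) set" where
  "perp N = {g. continuous_on J g \<and> (\<forall>n\<in>{1..N}. ip W g (phi n) = 0)}"

text \<open>By symmetry <g, phi n> = lam2 n <v, phi n> with \<open>lam2 n\<close> > 0, so the Green
  operator maps the complement into itself.\<close>

lemma perp_sol: "g \<in> perp N \<Longrightarrow> sol g v \<Longrightarrow> v \<in> perp N"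
  using ip_sol_phi[of g v] lam2_pos sol_cont(2)[of g v] unfolding perp_def by force

text \<open>\<open>SL_system\<close> enumerates all eigenvalues, so 1/\<kappa> is some
  \<open>lam2 m\<close>. For m \<le> N simplicity would make v a multiple of \<open>phi m\<close>,
  to which it is orthogonal.\<close>

lemma eigenfunction_in_perp:
  assumes "v \<in> perp N" "sol v (\<lambda>x. \<kappa> * v x)" "\<kappa> > 0" "nrm W v > 0"
  shows "\<kappa> \<le> 1 / lam2 (Suc N)"
proof -
  have vc: "continuous_on J v" using assms(1) by (simp add: perp_def)
  obtain w' where w': "SLd v (\<lambda>x. \<kappa> * v x) w'" using assms(2) by (auto simp: sol_def)
  obtain x0 where x0: "x0 \<in> J" "v x0 \<noteq> 0"
  proof (rule ccontr)
    assume "\<not> thesis"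
    then have "v x = 0" if "x \<in> J" for x using that \<open>\<And>x0. x0 \<in> J \<Longrightarrow> v x0 \<noteq> 0 \<Longrightarrow> thesis\<close> by blast
    then have "ip W v v = ip W (\<lambda>x. 0) (\<lambda>x. 0)" by (intro ip_W_cong vc)
    then show False using assms(4) by (simp add: nrm_def ip_def)
  qed
  define v' where "v' = (\<lambda>x. w' x / \<kappa>)"
  have S: "SLd (\<lambda>x. 1 / \<kappa> * v x) v v'"
    using SLd_lincomb[OF w' w', of "1 / \<kappa>" 0] assms(3) by (simp add: v'_def)
  have bc: "v 0 = 0" "v pi = 0" using assms(2,3) by (auto simp: sol_def)
  have "SL_eigenpair u (1 / \<kappa>) v"
    unfolding SL_eigenpair_def using S x0 bc unfolding SLd_def by (intro exI[of _ v']) (auto simp: ac_simps)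
  then obtain m where m: "m \<ge> 1" "1 / \<kappa> = lam2 m" using SL unfolding SL_system_def by blast
  have "\<not> m \<le> N"
  proof
    assume "m \<le> N"
    then have perp0: "ip W v (phi m) = 0" using assms(1) m by (simp add: perp_def)
    obtain z where z: "z \<in> J" "phi m z \<noteq> 0"
      using SL m unfolding SL_system_def SL_eigenpair_def by blast
    obtain c where c: "\<And>x. x \<in> J \<Longrightarrow> v x = c * phi m x"
      using eigenfunction_simple[OF S[unfolded m(2)] bc(1) phi'[OF m(1)] _ z] phi_sol[OF m(1)]
      by (auto simp: sol_def)
    have "ip W v (phi m) = ip W (\<lambda>x. c * phi m x) (phi m)"
      by (intro ip_W_cong vc phi_cont m c) auto
    then have "c = 0" using perp0 phi_normalized[OF m(1)] by (simp add: ip_cmult_left)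
    with c[OF x0(1)] x0(2) show False by simp
  qed
  then have "lam2 (Suc N) \<le> 1 / \<kappa>" unfolding m(2) by (intro lam2_le) auto
  then show ?thesis using assms(3) lam2_pos[of "Suc N"] by (simp add: field_simps)
qed

text \<open>The supremum of the quadratic form of the solution operator over the complement of
  \<open>phi 1, \<dots>, phi N\<close> is attained at an eigenfunction, by Arzela--Ascoli.\<close>
lemma sol_contraction_on_perp:
  assumes g: "g \<in> perp N" and s: "sol g v"
  shows "nrm W v \<le> nrm W g / lam2 (Suc N)"
proof -
  obtain C0 where C0: "C0 > 0" "\<And>g v x y. sol g v \<Longrightarrow> x \<in> J \<Longrightarrow> y \<in> J \<Longrightarrow> \<bar>v x - v y\<bar> \<le> C0 * nrm W g * \<bar>x - y\<bar>"
    using sol_Lipschitz by blast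
  have sup: "\<bar>v x\<bar> \<le> C0 * pi * nrm W g" if "sol g v" "x \<in> J" for g v x
  proof -
    have "\<bar>v x - v 0\<bar> \<le> C0 * nrm W g * \<bar>x - 0\<bar>" using C0(2)[OF that, of 0] by simp
    also have "\<dots> \<le> C0 * nrm W g * pi" using that C0(1) by (intro mult_left_mono) auto
    finally show ?thesis using that by (simp add: sol_def ac_simps)
  qed
  define B where "B = C0 * pi * nrm W (\<lambda>x. 1)"
  have nrm_sup: "nrm W f \<le> k * nrm W (\<lambda>x. 1)" if "continuous_on J f" "\<And>x. x \<in> J \<Longrightarrow> \<bar>f x\<bar> \<le> k" "k \<ge> 0" for f k
  proof -
    have "nrm W f \<le> nrm W (\<lambda>x. k * 1)"
      using that by (intro nrm_mono sq_W continuous_intros meas_W AE_I2) (auto simp: W_def space_restrict_space)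
    then show ?thesis using that(3) by (simp only: nrm_cmult abs_of_nonneg)
  qed
  have bdd: "nrm W v \<le> B * nrm W g" if "sol g v" for g v
    using nrm_sup[OF sol_cont(2)[OF that] sup[OF that]] C0(1) by (simp add: B_def ac_simps)
  \<comment> \<open>Rayleigh quotients of the Green operator on the complement; their supremum
    \<open>\<kappa>\<close> turns out to be an eigenvalue of that operator.\<close>
  define Q where "Q = {ip W v g |g v. g \<in> perp N \<and> sol g v \<and> nrm W g = 1}"
  define \<kappa> where "\<kappa> = Sup Q"
  have Qb: "q \<le> B" if "q \<in> Q" for q
  proof -
    obtain g v where gv: "q = ip W v g" "sol g v" "nrm W g = 1" using \<open>q \<in> Q\<close> by (auto simp: Q_def)
    have "\<bar>ip W v g\<bar> \<le> nrm W v * nrm W g"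
      by (intro Cauchy_Schwarz_ip sq_W sol_cont[OF gv(2)])
    then show ?thesis using bdd[OF gv(2)] gv by simp
  qed
  have bddQ: "bdd_above Q" using Qb by (auto simp: bdd_above_def)
  have l0: "lam2 (Suc N) > 0" by (rule lam2_pos) simp
  \<comment> \<open>The quotient of \<open>phi (Suc N)\<close>: it makes \<open>Q\<close> nonempty
    and \<open>\<kappa>\<close> positive.\<close>
  have mem: "1 / lam2 (Suc N) \<in> Q"
    unfolding Q_def
  proof (intro CollectI exI conjI)
    have "sol (\<lambda>x. 1 / lam2 (Suc N) * (lam2 (Suc N) * phi (Suc N) x) + 0 * phi (Suc N) x)
      (\<lambda>x. 1 / lam2 (Suc N) * phi (Suc N) x + 0 * phi (Suc N) x)"
      using sol_lincomb[OF phi_sol[of "Suc N"] phi_sol[of "Suc N"], of "1 / lam2 (Suc N)" 0] by simp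
    then show "sol (phi (Suc N)) (\<lambda>x. 1 / lam2 (Suc N) * phi (Suc N) x)" using l0 by simp
    show "1 / lam2 (Suc N) = ip W (\<lambda>x. 1 / lam2 (Suc N) * phi (Suc N) x) (phi (Suc N))"
      by (simp only: ip_cmult_left phi_normalized)
  qed (auto simp: perp_def phi_cont phi_orthogonal nrm_def phi_normalized)
  have \<kappa>ge: "q \<le> \<kappa>" if "q \<in> Q" for q unfolding \<kappa>_def by (rule cSup_upper[OF that bddQ])
  have \<kappa>0: "\<kappa> > 0" using \<kappa>ge[OF mem] l0 by (meson less_le_trans zero_less_divide_1_iff)
  have form: "ip W v g \<le> \<kappa> * (nrm W g)\<^sup>2" if g: "g \<in> perp N" and s: "sol g v" for g v
  proof (cases "nrm W g = 0")
    case True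
    have "\<bar>ip W v g\<bar> \<le> nrm W v * nrm W g"
      by (intro Cauchy_Schwarz_ip sq_W sol_cont[OF s])
    then show ?thesis using True by simp
  next
    case False
    define t where "t = 1 / nrm W g"
    have t: "t > 0" using False nrm_nonneg[of W g] by (simp add: t_def order_less_le)
    have "ip W (\<lambda>x. t * v x) (\<lambda>x. t * g x) \<in> Q"
      unfolding Q_def
    proof (intro CollectI exI conjI)
      show "(\<lambda>x. t * g x) \<in> perp N"
        using g by (auto simp: perp_def ip_cmult_left intro!: continuous_intros)
      show "sol (\<lambda>x. t * g x) (\<lambda>x. t * v x)" using sol_lincomb[OF s s, of t 0] by simp
      show "nrm W (\<lambda>x. t * g x) = 1" unfolding nrm_cmult using False t by (simp add: t_def)
    qed simp
    then have "t * (t * ip W v g) \<le> \<kappa>" using \<kappa>ge by (simp only: ip_cmult_left ip_cmult_right)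
    moreover have "nrm W g > 0" using False nrm_nonneg[of W g] by linarith
    ultimately show ?thesis by (simp add: t_def field_simps power2_eq_square)
  qed
  \<comment> \<open>Write K for the Green operator. Cauchy-Schwarz for the nonnegative form <K g,
    h>, applied to g and v = K g, gives |v|^4 \<le> <K g, g> <K v, v>, and the last factor is at
    most \<kappa> |v|^2.\<close>
  have form2: "(nrm W v)\<^sup>2 \<le> \<kappa> * ip W v g" if g: "g \<in> perp N" and s: "sol g v" for g v
  proof -
    obtain z where z: "sol v z" using sol_exists[OF sol_cont(2)[OF s]] by blast
    note sq = sq_W[OF sol_cont(1)[OF s]] sq_W[OF sol_cont(2)[OF s]] sq_W[OF sol_cont(2)[OF z]]
    have "(ip W v v)\<^sup>2 \<le> ip W v g * ip W z v"
    proof (rule discriminant_le)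
      fix t
      have "0 \<le> ip W (\<lambda>x. 1 * v x + t * z x) (\<lambda>x. 1 * g x + t * v x)"
        by (rule sol_pos[OF sol_lincomb[OF s z]])
      also have "\<dots> = ip W v g + t * ip W v v + t * ip W z g + t * t * ip W z v"
        using sq by (simp add: ip_add_left ip_add_right ip_cmult_left ip_cmult_right sq_int_add sq_int_cmult distrib_left)
      also have "ip W z g = ip W v v" using sol_sym[OF s z] by (simp add: ip_commute)
      finally show "0 \<le> ip W v g + 2 * ip W v v * t + ip W z v * t\<^sup>2"
        by (simp add: power2_eq_square algebra_simps)
    qed (rule sol_pos[OF z])
    also have "\<dots> \<le> ip W v g * (\<kappa> * (nrm W v)\<^sup>2)"
      by (intro mult_left_mono form perp_sol[OF g s] z sol_pos[OF s])
    finally have le: "(nrm W v)\<^sup>2 * (nrm W v)\<^sup>2 \<le> (\<kappa> * ip W v g) * (nrm W v)\<^sup>2"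
      by (simp add: nrm_square power2_eq_square[of "ip W v v"] ac_simps)
    show ?thesis
    proof (cases "nrm W v = 0")
      case False
      then have "(nrm W v)\<^sup>2 > 0" by simp
      with le show ?thesis by (rule mult_right_le_imp_le)
    qed (use sol_pos[OF s] \<kappa>0 in simp)
  qed
  have \<kappa>le: "\<kappa> \<le> 1 / lam2 (Suc N)"
  proof -
    have "\<exists>g v. g \<in> perp N \<and> sol g v \<and> nrm W g = 1 \<and> \<kappa> - 1 / Suc k < ip W v g" for k
    proof -
      have "\<exists>q\<in>Q. \<kappa> - 1 / Suc k < q"
        unfolding \<kappa>_def by (intro less_cSupD) (use mem in auto)
      then show ?thesis by (auto simp: Q_def)
    qed
    then obtain gs vs where gs: "\<And>k::nat. gs k \<in> perp N" "\<And>k. sol (gs k) (vs k)" "\<And>k. nrm W (gs k) = 1"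
      "\<And>k. \<kappa> - 1 / Suc k < ip W (vs k) (gs k)" by metis
    \<comment> \<open>Compactness is available for the images \<open>vs\<close> only, which are
      uniformly bounded and Lipschitz; the maximising sources \<open>gs\<close> are merely bounded
      in norm.\<close>
    obtain v \<phi> where v: "continuous_on J v" and \<phi>: "strict_mono (\<phi> :: nat \<Rightarrow> nat)"
      and conv: "\<And>\<epsilon>. 0 < \<epsilon> \<Longrightarrow> \<exists>K. \<forall>n x. n \<ge> K \<and> x \<in> J \<longrightarrow> norm (vs (\<phi> n) x - v x) < \<epsilon>"
    proof (rule Arzela_Ascoli[of J vs "C0 * pi"])
      show "norm (vs n x) \<le> C0 * pi" if "x \<in> J" for n x using sup[OF gs(2) that, of n] gs(3)[of n] by simp
      show "\<exists>d>0. \<forall>n y. y \<in> J \<and> norm (x - y) < d \<longrightarrow> norm (vs n x - vs n y) < \<epsilon>"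
        if x: "x \<in> J" and \<epsilon>: "0 < \<epsilon>" for x \<epsilon>
      proof (intro exI[of _ "\<epsilon> / C0"] conjI allI impI)
        fix n y assume y: "y \<in> J \<and> norm (x - y) < \<epsilon> / C0"
        have "\<bar>vs n x - vs n y\<bar> \<le> C0 * nrm W (gs n) * \<bar>x - y\<bar>" using C0(2)[OF gs(2) x] y by blast
        also have "\<dots> < \<epsilon>" using y C0(1) gs(3)[of n] by (simp add: field_simps)
        finally show "norm (vs n x - vs n y) < \<epsilon>" by simp
      qed (use \<epsilon> C0 in simp)
    qed auto
    define V where "V = (\<lambda>k. vs (\<phi> k))"
    define G where "G = (\<lambda>k. gs (\<phi> k))"
    have G: "G k \<in> perp N" "sol (G k) (V k)" "nrm W (G k) = 1" for k
      using gs by (simp_all add: G_def V_def)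
    have Vc: "continuous_on J (V k)" and Gc: "continuous_on J (G k)" for k using sol_cont[OF G(2)] by auto
    have ipG: "(\<lambda>k. ip W (V k) (G k)) \<longlonglongrightarrow> \<kappa>"
    proof (rule tendsto_sandwich)
      show "\<forall>\<^sub>F k in sequentially. \<kappa> - 1 / Suc (\<phi> k) \<le> ip W (V k) (G k)"
        using gs(4) by (intro always_eventually) (auto simp: V_def G_def less_imp_le)
      show "\<forall>\<^sub>F k in sequentially. ip W (V k) (G k) \<le> \<kappa>"
        using form[OF G(1,2)] G(3) by (intro always_eventually) simp
      have "(\<lambda>k. 1 / Suc (\<phi> k)) \<longlonglongrightarrow> 0"
        using LIMSEQ_subseq_LIMSEQ[OF LIMSEQ_Suc[OF lim_1_over_n] \<phi>] by (simp add: o_def)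
      from tendsto_diff[OF tendsto_const this] show "(\<lambda>k. \<kappa> - 1 / Suc (\<phi> k)) \<longlonglongrightarrow> \<kappa>" by simp
    qed simp
    have Vv: "(\<lambda>k. nrm W (\<lambda>x. V k x - v x)) \<longlonglongrightarrow> 0"
    proof (rule LIMSEQ_I)
      fix \<epsilon> :: real assume \<epsilon>: "\<epsilon> > 0"
      define M1 where "M1 = nrm W (\<lambda>x. 1) + 1"
      have M1: "M1 > 0" by (simp add: M1_def add_nonneg_pos)
      obtain K where K: "\<And>n x. n \<ge> K \<Longrightarrow> x \<in> J \<Longrightarrow> \<bar>V n x - v x\<bar> < \<epsilon> / M1"
        using conv[of "\<epsilon> / M1"] \<epsilon> M1 by (auto simp: V_def)
      have "norm (nrm W (\<lambda>x. V n x - v x) - 0) < \<epsilon>" if "n \<ge> K" for n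
      proof -
        have "nrm W (\<lambda>x. V n x - v x) \<le> \<epsilon> / M1 * nrm W (\<lambda>x. 1)"
          using K[OF that] \<epsilon> M1 by (intro nrm_sup continuous_intros Vc v) (auto simp: less_imp_le)
        also have "\<dots> < \<epsilon> / M1 * M1" using \<epsilon> M1 by (intro mult_strict_left_mono) (auto simp: M1_def)
        finally show ?thesis using M1 by simp
      qed
      then show "\<exists>K. \<forall>n\<ge>K. norm (nrm W (\<lambda>x. V n x - v x) - 0) < \<epsilon>" by blast
    qed
    \<comment> \<open>By \<open>form2\<close> the squared norm is at most \<kappa> <V, G> - 2
      \<kappa> <V, G> + \<kappa>^2, and <V, G> tends to \<kappa>: the \<open>G k\<close> are
      approximate eigenvectors.\<close>
    have w0: "(\<lambda>k. nrm W (\<lambda>x. V k x - \<kappa> * G k x)) \<longlonglongrightarrow> 0"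
    proof -
      have le: "(nrm W (\<lambda>x. V k x - \<kappa> * G k x))\<^sup>2 \<le> \<kappa> * (\<kappa> - ip W (V k) (G k))" for k
      proof -
        have "(nrm W (\<lambda>x. V k x - \<kappa> * G k x))\<^sup>2 = (nrm W (V k))\<^sup>2 - 2 * (\<kappa> * ip W (V k) (G k)) + \<kappa> * (\<kappa> * (nrm W (G k))\<^sup>2)"
          using sq_W[OF Vc[of k]] sq_W[OF Gc[of k]]
          by (simp add: nrm_square ip_diff_left ip_diff_right sq_int_diff sq_int_cmult ip_cmult_left ip_cmult_right
              ip_commute[of W "G k" "V k"] right_diff_distrib)
        then show ?thesis using form2[OF G(1,2)[of k]] G(3)[of k] by (simp add: algebra_simps)
      qed
      have "(\<lambda>k. \<kappa> * (\<kappa> - ip W (V k) (G k))) \<longlonglongrightarrow> \<kappa> * (\<kappa> - \<kappa>)" by (intro tendsto_intros ipG)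
      then have lim0: "(\<lambda>k. \<kappa> * (\<kappa> - ip W (V k) (G k))) \<longlonglongrightarrow> 0" by simp
      have "(\<lambda>k. (nrm W (\<lambda>x. V k x - \<kappa> * G k x))\<^sup>2) \<longlonglongrightarrow> 0"
        by (rule tendsto_sandwich[OF always_eventually always_eventually tendsto_const lim0]) (use le in auto)
      from tendsto_real_sqrt[OF this] show ?thesis by simp
    qed
    obtain z where z: "sol v z" using sol_exists[OF v] by blast
    have "\<exists>z. sol (V k) z" for k using sol_exists[OF Vc] by blast
    then obtain zs where zs: "\<And>k. sol (V k) (zs k)" by metis
    note zc = sol_cont(2)[OF z] and zsc = sol_cont(2)[OF zs]
    \<comment> \<open>As only \<open>V\<close> is known to converge, the defect V - \<kappa> G is
      sent once more through the Green operator K. Its image K V - \<kappa> V involves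
      \<open>V\<close> alone and can be compared with K v - \<kappa> v.\<close>
    have bound: "nrm W (\<lambda>x. z x - \<kappa> * v x) \<le> (B + \<kappa>) * nrm W (\<lambda>x. V k x - v x) + B * nrm W (\<lambda>x. V k x - \<kappa> * G k x)" for k
    proof -
      have s1: "sol (\<lambda>x. V k x - v x) (\<lambda>x. zs k x - z x)"
        using sol_lincomb[OF zs z, of 1 k "-1"] by simp
      have s2: "sol (\<lambda>x. V k x - \<kappa> * G k x) (\<lambda>x. zs k x - \<kappa> * V k x)"
        using sol_lincomb[OF zs G(2), of 1 k "- \<kappa>" k] by simp
      have "nrm W (\<lambda>x. z x - \<kappa> * v x)
        = nrm W (\<lambda>x. ((- 1) * (zs k x - z x) + (zs k x - \<kappa> * V k x)) + \<kappa> * (V k x - v x))"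
        by (simp add: algebra_simps)
      also have "\<dots> \<le> nrm W (\<lambda>x. (- 1) * (zs k x - z x) + (zs k x - \<kappa> * V k x)) + nrm W (\<lambda>x. \<kappa> * (V k x - v x))"
        by (intro nrm_triangle sq_W continuous_intros zsc zc Vc v)
      also have "nrm W (\<lambda>x. (- 1) * (zs k x - z x) + (zs k x - \<kappa> * V k x))
        \<le> nrm W (\<lambda>x. (- 1) * (zs k x - z x)) + nrm W (\<lambda>x. zs k x - \<kappa> * V k x)"
        by (intro nrm_triangle sq_W continuous_intros zsc zc Vc v)
      finally show ?thesis
        unfolding nrm_cmult using bdd[OF s1] bdd[OF s2] \<kappa>0 by (simp add: distrib_right)
    qed
    have "(\<lambda>k. (B + \<kappa>) * nrm W (\<lambda>x. V k x - v x) + B * nrm W (\<lambda>x. V k x - \<kappa> * G k x)) \<longlonglongrightarrow> (B + \<kappa>) * 0 + B * 0"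
      by (intro tendsto_intros Vv w0)
    then have "nrm W (\<lambda>x. z x - \<kappa> * v x) \<le> 0"
      by (intro LIMSEQ_le_const) (use bound in auto)
    then have "nrm W (\<lambda>x. z x - \<kappa> * v x) = 0" using nrm_nonneg[of W] by (metis order_antisym)
    then have zv: "z x = \<kappa> * v x" if "x \<in> J" for x
    proof -
      have "continuous_on J (\<lambda>x. z x - \<kappa> * v x)" by (intro continuous_intros zc v)
      from nrm_W_zero[OF this \<open>nrm W (\<lambda>x. z x - \<kappa> * v x) = 0\<close> that] show ?thesis by simp
    qed
    have "sol v (\<lambda>x. \<kappa> * v x)"
    proof -
      obtain z' where z': "SLd v z z'" using z by (auto simp: sol_def)
      have "SLd v (\<lambda>x. \<kappa> * v x) z'"
        unfolding SLd_def
      proof (intro ballI conjI)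
        fix x assume x: "x \<in> J"
        show "((\<lambda>x. \<kappa> * v x) has_real_derivative z' x) (at x within J)"
          by (rule has_field_derivative_transform_within[OF SLd_D(1)[OF z' x], of 1]) (use x zv in auto)
      qed (rule SLd_D(2)[OF z'])
      then show ?thesis using z v zv[of 0] zv[of pi] by (auto simp: sol_def)
    qed
    moreover have "v \<in> perp N"
      unfolding perp_def
    proof (intro CollectI conjI ballI v)
      fix n assume n: "n \<in> {1..N}"
      have "\<bar>ip W v (phi n)\<bar> \<le> nrm W (\<lambda>x. V k x - v x)" for k
      proof -
        have "ip W (V k) (phi n) = 0" using perp_sol[OF G(1,2)] n by (simp add: perp_def)
        moreover have "ip W (\<lambda>x. V k x - v x) (phi n) = ip W (V k) (phi n) - ip W v (phi n)"
          using n by (intro ip_diff_left sq_W Vc v phi_cont) auto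
        moreover have "\<bar>ip W (\<lambda>x. V k x - v x) (phi n)\<bar> \<le> nrm W (\<lambda>x. V k x - v x) * nrm W (phi n)"
          using n by (intro Cauchy_Schwarz_ip sq_W continuous_intros Vc v phi_cont) auto
        ultimately show ?thesis using n phi_normalized[of n] by (simp add: nrm_def[of W "phi n"])
      qed
      then have "\<bar>ip W v (phi n)\<bar> \<le> 0" by (intro LIMSEQ_le_const[OF Vv]) auto
      then show "ip W v (phi n) = 0" by simp
    qed
    \<comment> \<open>If v had norm 0, <V, G> would tend to 0, against its positive limit
      \<open>\<kappa>\<close>.\<close>
    moreover have "nrm W v > 0"
    proof (rule ccontr)
      assume "\<not> ?thesis"
      then have "nrm W v = 0" using nrm_nonneg[of W v] by linarith
      have "ip W (V k) (G k) \<le> nrm W (\<lambda>x. V k x - v x)" for k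
      proof -
        have "\<bar>ip W (V k) (G k)\<bar> \<le> nrm W (V k) * nrm W (G k)" by (intro Cauchy_Schwarz_ip sq_W Vc Gc)
        moreover have "nrm W (\<lambda>x. (V k x - v x) + v x) \<le> nrm W (\<lambda>x. V k x - v x) + nrm W v"
          by (intro nrm_triangle sq_W continuous_intros Vc v)
        ultimately show ?thesis using G(3)[of k] \<open>nrm W v = 0\<close> by simp
      qed
      then have "\<kappa> \<le> 0" by (intro LIMSEQ_le[OF ipG Vv]) auto
      with \<kappa>0 show False by simp
    qed
    ultimately show ?thesis using \<kappa>0 by (intro eigenfunction_in_perp)
  qed
  have "(nrm W v)\<^sup>2 \<le> \<kappa> * ip W v g" by (rule form2[OF g s])
  also have "\<dots> \<le> \<kappa> * (\<kappa> * (nrm W g)\<^sup>2)" using \<kappa>0 form[OF g s] by (intro mult_left_mono) auto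
  finally have "(nrm W v)\<^sup>2 \<le> (\<kappa> * nrm W g)\<^sup>2" by (simp add: power2_eq_square ac_simps)
  then have "nrm W v \<le> \<kappa> * nrm W g" by (rule power2_le_imp_le) (use \<kappa>0 in simp)
  also have "\<dots> \<le> 1 / lam2 (Suc N) * nrm W g" using \<kappa>le by (intro mult_right_mono) auto
  finally show ?thesis by simp
qed

text \<open>Truncation commutes with the Green operator, so the remainder of f is the image of the
  remainder of h. The latter lies in \<open>perp N\<close>, where the operator contracts by 1 / lam2
  (N + 1), and is no longer than h.\<close>

lemma eigenfunction_expansion:
  assumes s: "sol h f"
  shows "nrm W (\<lambda>x. f x - comb {1..N} (\<lambda>n. ip W f (phi n)) x) \<le> nrm W h / lam2 (Suc N)"
proof -
  let ?c = "\<lambda>n. ip W f (phi n)" and ?d = "\<lambda>n. ip W h (phi n)"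
  have hc: "continuous_on J h" and fc: "continuous_on J f" using sol_cont[OF s] by auto
  have sc: "sol (\<lambda>x. h x - comb {1..K} ?d x) (\<lambda>x. f x - comb {1..K} ?c x)" for K
  proof (induction K)
    case 0
    then show ?case using s by (simp add: comb_def)
  next
    case (Suc K)
    have "sol (\<lambda>x. 1 * (h x - comb {1..K} ?d x) + (- ?c (Suc K)) * (lam2 (Suc K) * phi (Suc K) x))
      (\<lambda>x. 1 * (f x - comb {1..K} ?c x) + (- ?c (Suc K)) * phi (Suc K) x)"
      by (rule sol_lincomb[OF Suc phi_sol]) simp
    moreover have "?d (Suc K) = lam2 (Suc K) * ?c (Suc K)" by (rule ip_sol_phi[OF s]) simp
    ultimately show ?case by (simp add: comb_def algebra_simps)
  qed
  have cc: "continuous_on J (comb {1..N} d)" for d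
    unfolding comb_def by (intro continuous_intros phi_cont) auto
  have "(\<lambda>x. h x - comb {1..N} ?d x) \<in> perp N"
    unfolding perp_def
  proof (intro CollectI conjI ballI continuous_intros hc cc)
    fix n assume n: "n \<in> {1..N}"
    have "ip W (\<lambda>x. h x - comb {1..N} ?d x) (phi n) = ?d n - ip W (comb {1..N} ?d) (phi n)"
      using n by (intro ip_diff_left sq_W hc cc phi_cont) auto
    also have "ip W (comb {1..N} ?d) (phi n) = ?d n"
      using ip_comb_e[of "{1..N}" n ?d] n by simp
    finally show "ip W (\<lambda>x. h x - comb {1..N} ?d x) (phi n) = 0" by simp
  qed
  from sol_contraction_on_perp[OF this sc]
  have "nrm W (\<lambda>x. f x - comb {1..N} ?c x) \<le> nrm W (\<lambda>x. h x - comb {1..N} ?d x) / lam2 (Suc N)" .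
  also have "\<dots> \<le> nrm W h / lam2 (Suc N)"
  proof (intro divide_right_mono)
    show "nrm W (\<lambda>x. h x - comb {1..N} ?d x) \<le> nrm W h"
      using best_approximation[of "{}" "{1..N}" h] sq_W[OF hc] by (simp add: comb_def subset_iff)
    show "0 \<le> lam2 (Suc N)" using lam2_pos[of "Suc N"] by simp
  qed
  finally show ?thesis .
qed

end

text \<open>The Liouville substitution \<open>w = sqrt u * phi n\<close>
  turns the equation into \<open>w'' + lam2 n * w = Q * w\<close> with bounded \<open>Q\<close>, and variation of constants
  compares \<open>w\<close> with a sine.\<close>
lemma (in SL_basis) sin_eigenfrequency:
  obtains C where "C > 0" "\<And>n. n \<ge> 1 \<Longrightarrow> C \<le> sqrt (lam2 n) \<Longrightarrow> \<bar>sin (pi * sqrt (lam2 n))\<bar> \<le> C / sqrt (lam2 n)"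
proof -
  define s where "s = (\<lambda>x. sqrt (u x))"
  define s1 where "s1 = (\<lambda>x. u' x / (2 * s x))"
  define s2 where "s2 = (\<lambda>x. (u'' x * (2 * s x) - u' x * (2 * s1 x)) / ((2 * s x) * (2 * s x)))"
  have s0: "s x > 0" if "x \<in> J" for x using u_pos[OF that] by (simp add: s_def)
  have ss: "s x * s x = u x" if "x \<in> J" for x using u_pos[OF that] by (simp add: s_def)
  have ds: "(s has_real_derivative s1 x) (at x within J)" if "x \<in> J" for x
    unfolding s_def s1_def using u_pos[OF that]
    by (auto intro!: derivative_eq_intros du[OF that] simp: field_simps)
  have ds1: "(s1 has_real_derivative s2 x) (at x within J)" if "x \<in> J" for x
  proof -
    have "((\<lambda>x. u' x / (2 * s x)) has_real_derivative s2 x) (at x within J)"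
      unfolding s2_def by (rule DERIV_divide[OF ddu[OF that] DERIV_cmult[OF ds[OF that]]]) (use s0[OF that] in simp)
    moreover have "s1 = (\<lambda>x. u' x / (2 * s x))" by (simp add: s1_def)
    ultimately show ?thesis by (simp only:)
  qed
  have cs: "continuous_on J s" "continuous_on J s1"
    using DERIV_continuous_on[OF ds] DERIV_continuous_on[OF ds1] by auto
  \<comment> \<open>The potential (sqrt u)'' / sqrt u of the transformed equation.\<close>
  define Q where "Q = (\<lambda>x. s2 x / s x)"
  have cQ: "continuous_on J Q"
    unfolding Q_def s2_def using s0 by (intro continuous_intros cs cont_u' cont_u'') force+
  then have "bounded (Q ` J)" by (intro compact_imp_bounded compact_continuous_image) auto
  then obtain Qm where Qm: "Qm > 0" "\<And>x. x \<in> J \<Longrightarrow> \<bar>Q x\<bar> \<le> Qm"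
    unfolding bounded_pos by auto
  show ?thesis
  \<comment> \<open>The constant has two roles: above it the Duhamel error is at most half of L max
    |w|, and it is the final bound for L |sin (pi L)|.\<close>
  proof (rule that[of "2 * pi * Qm"])
    fix n :: nat assume n: "n \<ge> 1" and big: "2 * pi * Qm \<le> sqrt (lam2 n)"
    define L where "L = sqrt (lam2 n)"
    have L0: "L > 0" using lam2_pos[OF n] by (simp add: L_def)
    have LL: "L * L = lam2 n" using lam2_pos[OF n] by (simp add: L_def)
    define w where "w = (\<lambda>x. s x * phi n x)"
    define w1 where "w1 = (\<lambda>x. s1 x * phi n x + (u x * phi' n x) / s x)"
    have dw: "(w has_real_derivative w1 x) (at x within J)" if x: "x \<in> J" for x
    proof -
      have "(w has_real_derivative s x * phi' n x + s1 x * phi n x) (at x within J)"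
        unfolding w_def by (intro DERIV_mult' ds x SLd_D(1)[OF phi'[OF n] x])
      moreover have "s x * phi' n x + s1 x * phi n x = w1 x"
        using s0[OF x] by (simp add: w1_def ss[OF x, symmetric])
      ultimately show ?thesis by simp
    qed
    have dw1: "(w1 has_real_derivative (Q x - lam2 n) * w x) (at x within J)" if x: "x \<in> J" for x
    proof -
      have "(w1 has_real_derivative (s1 x * phi' n x + s2 x * phi n x)
          + (- (u x * (lam2 n * phi n x)) * s x - (u x * phi' n x) * s1 x) / (s x * s x)) (at x within J)"
        unfolding w1_def using s0[OF x]
        by (intro DERIV_add DERIV_mult' DERIV_divide ds ds1 x SLd_D[OF phi'[OF n] x]) simp
      moreover have "(s1 x * phi' n x + s2 x * phi n x)
          + (- (u x * (lam2 n * phi n x)) * s x - (u x * phi' n x) * s1 x) / (s x * s x) = (Q x - lam2 n) * w x"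
        using s0[OF x] by (simp add: ss[OF x, symmetric] Q_def w_def field_simps)
      ultimately show ?thesis by simp
    qed
    have cw: "continuous_on J w" by (rule DERIV_continuous_on[OF dw])
    have w0: "w 0 = 0" using phi_sol[OF n] by (simp add: w_def sol_def)
    obtain x0 where x0: "x0 \<in> J" "\<And>x. x \<in> J \<Longrightarrow> \<bar>w x\<bar> \<le> \<bar>w x0\<bar>"
      using continuous_attains_sup[of J "\<lambda>x. \<bar>w x\<bar>"] cw by (force intro: continuous_intros)
    define Wm where "Wm = \<bar>w x0\<bar>"
    have Wm0: "Wm > 0"
    proof -
      obtain z where z: "z \<in> J" "phi n z \<noteq> 0"
        using SL n unfolding SL_system_def SL_eigenpair_def by blast
      then have "\<bar>w z\<bar> > 0" using s0[of z] by (simp add: w_def)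
      with x0(2)[OF z(1)] show ?thesis by (simp add: Wm_def)
    qed
    have duhamel: "\<bar>L * w y - w1 0 * sin (L * y)\<bar> \<le> pi * Qm * Wm" if y: "y \<in> J" for y
    proof -
      \<comment> \<open>F(y) = L w(y) and F(0) = w1(0) sin (L y), while in the derivative everything
        cancels except the term with \<open>Q\<close>.\<close>
      define F where "F = (\<lambda>x. w1 x * sin (L * (y - x)) + L * (w x * cos (L * (y - x))))"
      have dF: "(F has_real_derivative Q x * w x * sin (L * (y - x))) (at x within J)" if x: "x \<in> J" for x
      proof -
        have "(F has_real_derivative (w1 x * (cos (L * (y - x)) * (- L)) + (Q x - lam2 n) * w x * sin (L * (y - x)))
          + L * (w x * (- sin (L * (y - x)) * (- L)) + w1 x * cos (L * (y - x)))) (at x within J)"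
          unfolding F_def
          by (intro DERIV_add DERIV_cmult DERIV_mult' dw dw1 x) (auto intro!: derivative_eq_intros)
        then show ?thesis by (simp add: LL[symmetric] algebra_simps)
      qed
      have "((\<lambda>x. Q x * w x * sin (L * (y - x))) has_integral F y - F 0) (cbox 0 y)"
        using FTC_J[OF _ y _ dF] y by simp
      then have "norm (F y - F 0) \<le> (Qm * Wm) * measure lborel (cbox 0 y)"
      proof (rule has_integral_bound[rotated])
        fix x assume "x \<in> cbox 0 y"
        then have x: "x \<in> J" using y by auto
        have "\<bar>Q x\<bar> * \<bar>w x\<bar> * \<bar>sin (L * (y - x))\<bar> \<le> (Qm * Wm) * 1"
          using Qm x0(2)[OF x] x Wm0 by (intro mult_mono) (auto simp: Wm_def)
        then show "norm (Q x * w x * sin (L * (y - x))) \<le> Qm * Wm" by (simp add: abs_mult)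
      qed (use Qm Wm0 in simp)
      also have "\<dots> \<le> (Qm * Wm) * pi" using y Qm Wm0 by (intro mult_left_mono) auto
      finally show ?thesis by (simp add: F_def w0 ac_simps)
    qed
    have "L * Wm \<le> \<bar>w1 0\<bar> + pi * Qm * Wm"
    proof -
      have "\<bar>w1 0 * sin (L * x0)\<bar> \<le> \<bar>w1 0\<bar> * 1" unfolding abs_mult by (intro mult_left_mono) auto
      moreover have "L * Wm = \<bar>L * w x0\<bar>" using L0 by (simp add: Wm_def abs_mult)
      ultimately show ?thesis using duhamel[OF x0(1)] by linarith
    qed
    moreover have "2 * pi * Qm * Wm \<le> L * Wm"
      using big Wm0 unfolding L_def by (intro mult_right_mono) auto
    ultimately have A: "L * Wm \<le> 2 * \<bar>w1 0\<bar>" by linarith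
    have A0: "\<bar>w1 0\<bar> > 0" using A mult_pos_pos[OF L0 Wm0] by linarith
    have wpi: "w pi = 0" using phi_sol[OF n] by (simp add: w_def sol_def)
    \<comment> \<open>At pi the function w vanishes, so the sine term alone is bounded by the
      Duhamel error; \<open>A\<close> then trades the maximum of |w| for |w1 0| / L.\<close>
    have "\<bar>w1 0\<bar> * \<bar>sin (L * pi)\<bar> * L \<le> pi * Qm * Wm * L"
      using duhamel[of pi] wpi L0 by (intro mult_right_mono) (auto simp: abs_mult)
    also have "\<dots> = pi * Qm * (L * Wm)" by simp
    also have "\<dots> \<le> pi * Qm * (2 * \<bar>w1 0\<bar>)" using A Qm by (intro mult_left_mono) auto
    finally have "\<bar>w1 0\<bar> * (\<bar>sin (L * pi)\<bar> * L) \<le> \<bar>w1 0\<bar> * (2 * pi * Qm)" by (simp add: ac_simps)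
    then have "\<bar>sin (L * pi)\<bar> * L \<le> 2 * pi * Qm" using A0 by (rule mult_left_le_imp_le)
    then show "\<bar>sin (pi * sqrt (lam2 n))\<bar> \<le> 2 * pi * Qm / sqrt (lam2 n)"
      using L0 by (simp add: L_def[symmetric] field_simps)
  qed (use Qm in simp)
qed

text \<open>For odd m the number q m is odd, so the even p does not divide it, and |sin (pi q m /
  p)| depends only on the nonzero residue of q m modulo p. A minimum over finitely many positive
  values remains.\<close>

lemma sin_rational_lower_bound:
  fixes p q :: nat
  assumes "p > 0" "even p" "odd q"
  obtains s0 where "s0 > 0" "\<And>m. odd m \<Longrightarrow> s0 \<le> \<bar>sin (pi * freq p q m)\<bar>"
proof -
  define S where "S = (\<lambda>j. sin (pi * (real j / real p))) ` {1..<p}"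
  have p2: "p \<ge> 2" using assms(1,2) by presburger
  have S: "finite S" "S \<noteq> {}" using p2 by (auto simp: S_def)
  have pos: "s > 0" if "s \<in> S" for s
  proof -
    obtain j where j: "s = sin (pi * (real j / real p))" "1 \<le> j" "j < p" using \<open>s \<in> S\<close> unfolding S_def by force
    have 1: "real j / real p < 1" "0 < real j / real p" using j by auto
    have "pi * (real j / real p) < pi * 1" by (rule mult_strict_left_mono[OF 1(1) pi_gt_zero])
    then show ?thesis unfolding j(1) using mult_pos_pos[OF pi_gt_zero 1(2)] by (intro sin_gt_zero) auto
  qed
  show ?thesis
  proof (rule that[of "Min S"])
    show "Min S > 0" using Min_in[OF S] pos by blast
    fix m :: nat assume m: "odd m"
    define k where "k = q * m"
    have "odd k" using assms m by (simp add: k_def)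
    define j d where "j = k mod p" and "d = k div p"
    have "j \<noteq> 0"
    proof
      assume "j = 0"
      then have "p dvd k" by (simp add: j_def dvd_eq_mod_eq_0)
      with \<open>even p\<close> \<open>odd k\<close> show False using dvd_trans by blast
    qed
    moreover have "j < p" using assms(1) by (simp add: j_def)
    ultimately have jS: "sin (pi * (real j / real p)) \<in> S" by (auto simp: S_def)
    have "k = d * p + j" by (simp add: j_def d_def)
    then have "real k = real d * real p + real j" by (metis of_nat_add of_nat_mult)
    moreover have "freq p q m = real k / real p" by (simp add: freq_def k_def)
    ultimately have "pi * freq p q m = real d * pi + pi * (real j / real p)"
      using assms(1) by (simp add: field_simps)
    then have "\<bar>sin (pi * freq p q m)\<bar> = \<bar>sin (pi * (real j / real p))\<bar>"
      by (simp add: sin_add cos_npi abs_mult power_abs)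
    also have "\<dots> \<ge> Min S" using Min_le[OF S(1) jS] by linarith
    finally show "Min S \<le> \<bar>sin (pi * freq p q m)\<bar>" .
  qed
qed

lemma abs_sin_diff_le: "\<bar>sin x - sin y\<bar> \<le> \<bar>x - y\<bar>" for x y :: real
proof -
  have "norm (sin x - sin y) \<le> 1 * norm (x - y)"
    by (rule field_differentiable_bound[of UNIV sin cos]) (auto intro!: derivative_eq_intros)
  then show ?thesis by simp
qed

text \<open>\<open>mu\<close> factors as (L - r)(L + r) with L = sqrt (lam2 n) and r the frequency.
  For large L the sines of pi L and pi r differ, which keeps |L - r| away from 0, so small
  \<open>mu\<close> bounds L + r. For small L, r^2 \<le> L^2 + K bounds r directly.\<close>

lemma (in SL_basis) finite_small_mu:
  fixes p q :: nat
  assumes "p > 0" "q > 0" "even p" "odd q"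
  shows "finite {(m, n). odd m \<and> n \<ge> 1 \<and> \<bar>mu lam2 p q m n\<bar> \<le> K}"
proof (cases "K \<ge> 0")
  case False
  then have "{(m, n). odd m \<and> n \<ge> 1 \<and> \<bar>mu lam2 p q m n\<bar> \<le> K} = {}" by auto
  then show ?thesis by (simp only: finite.emptyI)
next
  case K: True
  obtain C where C: "C > 0" "\<And>n. n \<ge> 1 \<Longrightarrow> C \<le> sqrt (lam2 n) \<Longrightarrow> \<bar>sin (pi * sqrt (lam2 n))\<bar> \<le> C / sqrt (lam2 n)"
    using sin_eigenfrequency by blast
  obtain s0 where s0: "s0 > 0" "\<And>m. odd m \<Longrightarrow> s0 \<le> \<bar>sin (pi * freq p q m)\<bar>"
    using sin_rational_lower_bound[OF assms(1,3,4)] by blast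
  obtain c where c: "c > 0" "\<And>n. n \<ge> 1 \<Longrightarrow> c * n \<le> lam2 n" using lam2_growth by blast
  \<comment> \<open>Half of \<open>s0\<close>, divided by the Lipschitz constant pi of x \<mapsto>
    sin (pi x).\<close>
  define d where "d = s0 / (2 * pi)"
  have d0: "d > 0" using s0 by (simp add: d_def)
  \<comment> \<open>From here on the eigenfrequency estimate applies and its bound C / L is at most
    s0 / 2.\<close>
  define \<Lambda> where "\<Lambda> = max C (2 * C / s0)"
  \<comment> \<open>Collects the bounds of both cases; in the second, r \<le> 1 + r^2 avoids a
    square root.\<close>
  define B where "B = K / d + 1 + K + \<Lambda>\<^sup>2 + \<bar>\<Lambda>\<bar>"
  have *: "n \<le> nat \<lceil>B\<^sup>2 / c\<rceil> \<and> m \<le> nat \<lceil>B * p\<rceil>"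
    if "odd m" and n: "n \<ge> 1" and small: "\<bar>mu lam2 p q m n\<bar> \<le> K" for m n
  proof -
    define L r where "L = sqrt (lam2 n)" and "r = freq p q m"
    have L0: "L > 0" using lam2_pos[OF n] by (simp add: L_def)
    have r0: "r \<ge> 0" by (simp add: r_def freq_def)
    have LL: "L\<^sup>2 = lam2 n" using lam2_pos[OF n] by (simp add: L_def)
    have mu: "mu lam2 p q m n = (L - r) * (L + r)"
      by (simp add: mu_def LL[symmetric] r_def power2_eq_square algebra_simps)
    have LB: "L \<le> B \<and> r \<le> B"
    proof (cases "L \<ge> \<Lambda>")
      case True
      then have L: "L \<ge> C" "L \<ge> 2 * C / s0" by (auto simp: \<Lambda>_def)
      have "C / L \<le> s0 / 2" using L(2) s0 L0 by (simp add: field_simps)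
      moreover have "\<bar>sin (pi * L)\<bar> \<le> C / L" using C(2)[OF n] L(1) by (simp add: L_def)
      moreover have "s0 \<le> \<bar>sin (pi * r)\<bar>" using s0(2)[OF \<open>odd m\<close>] by (simp add: r_def)
      moreover have "\<bar>sin (pi * L) - sin (pi * r)\<bar> \<le> pi * \<bar>L - r\<bar>"
        using abs_sin_diff_le[of "pi * L" "pi * r"] by (simp add: abs_mult flip: right_diff_distrib)
      ultimately have "s0 / 2 \<le> pi * \<bar>L - r\<bar>" by linarith
      then have "d \<le> \<bar>L - r\<bar>" by (simp add: d_def field_simps)
      then have "d * (L + r) \<le> \<bar>L - r\<bar> * (L + r)" using L0 r0 by (intro mult_right_mono) auto
      also have "\<dots> = \<bar>mu lam2 p q m n\<bar>" using L0 r0 by (simp add: mu abs_mult)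
      finally have "d * (L + r) \<le> K" using small by linarith
      then have "L + r \<le> K / d" using d0 by (simp add: field_simps)
      moreover have "K / d \<le> B" using K by (simp add: B_def)
      ultimately show ?thesis using L0 r0 by linarith
    next
      case False
      have "L\<^sup>2 \<le> \<Lambda>\<^sup>2" using False L0 by (intro power_mono) auto
      moreover have "r\<^sup>2 - L\<^sup>2 \<le> K" using small by (simp add: mu power2_eq_square algebra_simps abs_le_iff)
      moreover have "r \<le> 1 + r\<^sup>2" using zero_le_power2[of "r - 1"] r0 by (simp add: power2_diff)
      moreover have "K / d \<ge> 0" using K d0 by simp
      moreover have "\<Lambda>\<^sup>2 \<ge> 0" by simp
      ultimately show ?thesis using False K unfolding B_def by linarith
    qed
    have "c * n \<le> B\<^sup>2" using c(2)[OF n] power_mono[of L B 2] LB L0 LL by simp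
    then have "real n \<le> B\<^sup>2 / c" using c(1) by (simp add: field_simps)
    then have "n \<le> nat \<lceil>B\<^sup>2 / c\<rceil>" by linarith
    moreover have "real m \<le> B * p"
    proof -
      have "real q * real m \<le> B * p" using LB assms(1) by (simp add: r_def freq_def field_simps)
      moreover have "1 * real m \<le> real q * real m" using assms(2) by (intro mult_right_mono) auto
      ultimately show ?thesis by linarith
    qed
    then have "m \<le> nat \<lceil>B * p\<rceil>" by linarith
    ultimately show ?thesis by blast
  qed
  have "{(m, n). odd m \<and> n \<ge> 1 \<and> \<bar>mu lam2 p q m n\<bar> \<le> K} \<subseteq> {..nat \<lceil>B * p\<rceil>} \<times> {..nat \<lceil>B\<^sup>2 / c\<rceil>}"
    using * by auto
  then show ?thesis by (rule finite_subset) simp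
qed

section \<open>Density of trigonometric polynomials\<close>

text \<open>Generated linearly, so that by induction each one is a combination of time factors of
  modes. Closure under products, required for Stone-Weierstrass, is derived from the product-to-sum
  formulas.\<close>

inductive trig_poly :: "real \<Rightarrow> (real \<Rightarrow> real) \<Rightarrow> bool" for \<omega> where
  cos: "trig_poly \<omega> (\<lambda>t. cos (\<omega> * real m * t))"
| sin: "trig_poly \<omega> (\<lambda>t. sin (\<omega> * real m * t))"
| add: "trig_poly \<omega> P \<Longrightarrow> trig_poly \<omega> Q \<Longrightarrow> trig_poly \<omega> (\<lambda>t. P t + Q t)"
| cmult: "trig_poly \<omega> P \<Longrightarrow> trig_poly \<omega> (\<lambda>t. c * P t)"

lemma trig_poly_const: "trig_poly \<omega> (\<lambda>t. c)"
  using trig_poly.cmult[OF trig_poly.cos[of \<omega> 0], of c] by simp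

lemma trig_poly_cos_diff: "trig_poly \<omega> (\<lambda>t. cos ((\<omega> * real m - \<omega> * real n) * t))"
proof (cases "n \<le> m")
  case True
  have "(\<lambda>t. cos ((\<omega> * real m - \<omega> * real n) * t)) = (\<lambda>t. cos (\<omega> * real (m - n) * t))"
    using True by (simp add: of_nat_diff algebra_simps)
  then show ?thesis using trig_poly.cos by metis
next
  case False
  have "(\<lambda>t. cos ((\<omega> * real m - \<omega> * real n) * t)) = (\<lambda>t. cos (\<omega> * real (n - m) * t))"
  proof
    fix t
    have "\<omega> * real (n - m) * t = - ((\<omega> * real m - \<omega> * real n) * t)"
      using False by (simp add: of_nat_diff algebra_simps)
    then show "cos ((\<omega> * real m - \<omega> * real n) * t) = cos (\<omega> * real (n - m) * t)"
      by (simp only: cos_minus)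
  qed
  then show ?thesis using trig_poly.cos by metis
qed

lemma trig_poly_sin_diff: "trig_poly \<omega> (\<lambda>t. sin ((\<omega> * real m - \<omega> * real n) * t))"
proof (cases "n \<le> m")
  case True
  have "(\<lambda>t. sin ((\<omega> * real m - \<omega> * real n) * t)) = (\<lambda>t. sin (\<omega> * real (m - n) * t))"
    using True by (simp add: of_nat_diff algebra_simps)
  then show ?thesis using trig_poly.sin by metis
next
  case False
  have "(\<lambda>t. sin ((\<omega> * real m - \<omega> * real n) * t)) = (\<lambda>t. (- 1) * sin (\<omega> * real (n - m) * t))"
  proof
    fix t
    have "\<omega> * real (n - m) * t = - ((\<omega> * real m - \<omega> * real n) * t)"
      using False by (simp add: of_nat_diff algebra_simps)
    then show "sin ((\<omega> * real m - \<omega> * real n) * t) = (- 1) * sin (\<omega> * real (n - m) * t)"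
      by (simp only: sin_minus)
  qed
  then show ?thesis using trig_poly.cmult[OF trig_poly.sin] by metis
qed

lemma trig_poly_sum_freq:
  "trig_poly \<omega> (\<lambda>t. cos ((\<omega> * real m + \<omega> * real n) * t))"
  "trig_poly \<omega> (\<lambda>t. sin ((\<omega> * real m + \<omega> * real n) * t))"
  using trig_poly.cos[of \<omega> "m + n"] trig_poly.sin[of \<omega> "m + n"] by (simp_all add: distrib_left)

lemma trig_poly_lin: "trig_poly \<omega> P \<Longrightarrow> trig_poly \<omega> Q \<Longrightarrow> trig_poly \<omega> (\<lambda>t. a * P t + b * Q t)"
  by (intro trig_poly.add trig_poly.cmult)

lemma trig_poly_mult_cos:
  assumes "trig_poly \<omega> P"
  shows "trig_poly \<omega> (\<lambda>t. P t * cos (\<omega> * real n * t))"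
  using assms
proof induction
  case (cos m)
  show ?case
    using trig_poly_lin[OF trig_poly_cos_diff[of \<omega> m n] trig_poly_sum_freq(1)[of \<omega> m n], of "1/2" "1/2"]
    by (simp add: cos_times_cos left_diff_distrib distrib_right add_divide_distrib)
next
  case (sin m)
  show ?case
    using trig_poly_lin[OF trig_poly_sin_diff[of \<omega> m n] trig_poly_sum_freq(2)[of \<omega> m n], of "1/2" "1/2"]
    by (simp add: sin_times_cos left_diff_distrib distrib_right add_divide_distrib add.commute)
next
  case (add P Q)
  then show ?case using trig_poly.add by (simp add: distrib_right)
next
  case (cmult P c)
  then show ?case using trig_poly.cmult[of \<omega> _ c] by (simp add: mult.assoc)
qed

lemma trig_poly_mult_sin:
  assumes "trig_poly \<omega> P"
  shows "trig_poly \<omega> (\<lambda>t. P t * sin (\<omega> * real n * t))"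
  using assms
proof induction
  case (cos m)
  show ?case
    using trig_poly_lin[OF trig_poly_sin_diff[of \<omega> m n] trig_poly_sum_freq(2)[of \<omega> m n], of "-1/2" "1/2"]
    by (simp add: cos_times_sin left_diff_distrib distrib_right diff_divide_distrib)
next
  case (sin m)
  show ?case
    using trig_poly_lin[OF trig_poly_cos_diff[of \<omega> m n] trig_poly_sum_freq(1)[of \<omega> m n], of "1/2" "-1/2"]
    by (simp add: sin_times_sin left_diff_distrib distrib_right diff_divide_distrib)
next
  case (add P Q)
  then show ?case using trig_poly.add by (simp add: distrib_right)
next
  case (cmult P c)
  then show ?case using trig_poly.cmult[of \<omega> _ c] by (simp add: mult.assoc)
qed

lemma trig_poly_mult:
  assumes "trig_poly \<omega> Q" "trig_poly \<omega> P"
  shows "trig_poly \<omega> (\<lambda>t. P t * Q t)"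
  using assms(1)
proof induction
  case (add Q1 Q2)
  then show ?case using trig_poly.add by (simp add: distrib_left)
next
  case (cmult Q c)
  then show ?case using trig_poly.cmult[of \<omega> _ c] by (simp add: mult.left_commute)
qed (rule trig_poly_mult_cos[OF assms(2)] trig_poly_mult_sin[OF assms(2)])+

text \<open>A periodic function factors through the circle, which carries the quotient topology because
  the interval is compact; there Stone--Weierstrass applies.\<close>
lemma trig_poly_dense:
  fixes c :: "real \<Rightarrow> real"
  assumes c: "continuous_on {0..T} c" "c 0 = c T" and T: "T > 0" and \<epsilon>: "\<epsilon> > 0"
  obtains P where "trig_poly (2 * pi / T) P" "\<And>t. t \<in> {0..T} \<Longrightarrow> \<bar>c t - P t\<bar> < \<epsilon>"
proof -
  define \<omega> where "\<omega> = 2 * pi / T"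
  have \<omega>T: "\<omega> * T = 2 * pi" and \<omega>0: "\<omega> > 0" using T by (simp_all add: \<omega>_def)
  define g where "g = (\<lambda>t. cis (\<omega> * t))"
  define F where "F = (\<lambda>z. c (Arg2pi z / \<omega>))"
  define S where "S = sphere (0::complex) 1"
  \<comment> \<open>\<open>Arg2pi\<close> gives the point g(T) the angle 0, so at t = T the identity
    rests on c 0 = c T.\<close>
  have Fg: "F (g t) = c t" if t: "t \<in> {0..T}" for t
  proof (cases "t = T")
    case True
    then have "g t = 1" by (simp add: g_def \<omega>T complex_eq_iff)
    moreover have "Arg2pi 1 = 0" using Arg2pi_unique[of 1 0 1] by simp
    ultimately show ?thesis using True c(2) by (simp add: F_def)
  next
    case False
    then have "\<omega> * t < \<omega> * T" using t \<omega>0 by (intro mult_strict_left_mono) auto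
    then have "Arg2pi (g t) = \<omega> * t"
      unfolding g_def using t \<omega>0 by (intro Arg2pi_unique[of 1]) (auto simp: cis_conv_exp \<omega>T)
    then show ?thesis using \<omega>0 by (simp add: F_def)
  qed
  have gS: "g ` {0..T} = S"
  proof
    show "g ` {0..T} \<subseteq> S" by (auto simp: g_def S_def)
    show "S \<subseteq> g ` {0..T}"
    proof
      fix z assume "z \<in> S"
      then have z: "cmod z = 1" by (simp add: S_def)
      have "z = g (Arg2pi z / \<omega>)"
        using Arg2pi_eq[of z] z \<omega>0 by (simp add: g_def cis_conv_exp)
      moreover have "Arg2pi z / \<omega> \<in> {0..T}"
        using Arg2pi_ge_0[of z] Arg2pi_lt_2pi[of z] \<omega>0 \<omega>T by (simp add: field_simps less_imp_le)
      ultimately show "z \<in> g ` {0..T}" by blast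
    qed
  qed
  have cg: "continuous_on A g" for A unfolding g_def by (intro continuous_intros)
  have cF: "continuous_on S F"
  proof (subst continuous_on_closed_vimage)
    show "closed S" by (simp add: S_def)
    show "\<forall>B. closed B \<longrightarrow> closed (F -` B \<inter> S)"
    proof (intro allI impI)
      fix B :: "real set" assume B: "closed B"
      have "closed (c -` B \<inter> {0..T})"
        using continuous_on_closed_vimage[of "{0..T}" c] c(1) B by simp
      moreover have "bounded (c -` B \<inter> {0..T})" by (rule bounded_subset[of "{0..T}"]) auto
      ultimately have "compact (c -` B \<inter> {0..T})" by (simp add: compact_eq_bounded_closed)
      then have "compact (g ` (c -` B \<inter> {0..T}))" by (rule compact_continuous_image[OF cg])
      moreover have "g ` (c -` B \<inter> {0..T}) = F -` B \<inter> S"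
        unfolding gS[symmetric] using Fg by (auto simp: image_iff)
      ultimately show "closed (F -` B \<inter> S)" by (simp add: compact_imp_closed)
    qed
  qed
  \<comment> \<open>Functions on the circle whose pullback is a trigonometric polynomial; the real
    and imaginary parts belong to it and separate points.\<close>
  define R where "R = {f. continuous_on S f \<and> trig_poly \<omega> (\<lambda>t. f (g t))}"
  interpret function_ring_on R S
  proof
    show "compact S" by (simp add: S_def)
    show "\<exists>f\<in>R. f x \<noteq> f y" if "x \<noteq> y" for x y
    proof (cases "Re x = Re y")
      case False
      have "Re \<in> R" using trig_poly.cos[of \<omega> 1] by (auto simp: R_def g_def intro: continuous_intros)
      with False show ?thesis by blast
    next
      case True
      then have "Im x \<noteq> Im y" using that by (simp add: complex_eq_iff)
      moreover have "Im \<in> R" using trig_poly.sin[of \<omega> 1] by (auto simp: R_def g_def intro: continuous_intros)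
      ultimately show ?thesis by blast
    qed
  qed (auto simp: R_def intro: continuous_intros trig_poly.add trig_poly_mult trig_poly_const)
  obtain f where f: "f \<in> R" "\<And>x. x \<in> S \<Longrightarrow> \<bar>F x - f x\<bar> < \<epsilon>"
    using Stone_Weierstrass_basic[OF cF \<epsilon>] by blast
  show ?thesis
  proof (rule that)
    show "trig_poly (2 * pi / T) (\<lambda>t. f (g t))" using f(1) by (simp add: R_def \<omega>_def)
    show "\<bar>c t - f (g t)\<bar> < \<epsilon>" if "t \<in> {0..T}" for t
      using f(2)[of "g t"] Fg[OF that] gS that by auto
  qed
qed

section \<open>The space-time modes\<close>

locale wave = SL_basis +
  fixes p q :: nat and T :: real
  assumes pq: "p > 0" "q > 0" "coprime p q" "even p"
    and T_def: "T = 2 * pi * real p / real q"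
begin

lemma T_pos: "T > 0" using pq by (simp add: T_def)

lemma odd_q: "odd q"
  using pq coprime_common_divisor_nat[of p q 2] by auto

definition \<omega> :: real where "\<omega> = 2 * pi / T"

lemma \<omega>T: "\<omega> * T = 2 * pi" using T_pos by (simp add: \<omega>_def)

lemma \<omega>_pos: "\<omega> > 0" using T_pos by (simp add: \<omega>_def)

lemma freq: "freq p q m = \<omega> * real m"
proof -
  have "2 * pi / T = real q / real p" using pq by (simp add: T_def)
  then show ?thesis by (simp only: freq_def \<omega>_def)
qed

abbreviation Om :: "(real \<times> real) set" where "Om \<equiv> Omega T"

abbreviation Rect :: "(real \<times> real) set" where "Rect \<equiv> cbox (0, 0) (T, pi)"

lemma Om_box: "Om = box (0, 0) (T, pi)"
  by (auto simp: Omega_def box_def Basis_prod_def)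

lemma Om_iff: "z \<in> Om \<longleftrightarrow> 0 < fst z \<and> fst z < T \<and> 0 < snd z \<and> snd z < pi"
  by (cases z) (auto simp: Omega_def)

lemma Rect_iff: "z \<in> Rect \<longleftrightarrow> fst z \<in> {0..T} \<and> snd z \<in> J"
  by (cases z) (auto simp: mem_box Basis_prod_def)

lemma Om_Rect: "Om \<subseteq> Rect" unfolding Om_box by (rule box_subset_cbox)

lemma open_Om: "open Om" unfolding Om_box by (rule open_box)

lemma Om_sets [measurable]: "Om \<in> sets borel" using open_Om by simp

text \<open>The cut-off removes the uncontrolled values of \<open>u\<close> outside the interval,
  which makes the density Borel measurable and nonnegative everywhere.\<close>

definition w :: "real \<times> real \<Rightarrow> real" where "w z = indicator Om z * u (snd z)"

definition V :: "(real \<times> real) measure" where "V = density lborel (\<lambda>z. ennreal (w z))"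

lemma cont_u_snd: "continuous_on Rect (\<lambda>z. u (snd z))"
  by (rule continuous_on_compose2[OF cont_u continuous_on_snd[OF continuous_on_id]]) (auto simp: Rect_iff)

lemma w_meas [measurable]: "w \<in> borel_measurable borel"
proof -
  have "(\<lambda>z. indicator Om z *\<^sub>R u (snd z)) \<in> borel_measurable borel"
    by (intro borel_measurable_continuous_on_indicator continuous_on_subset[OF cont_u_snd Om_Rect]) simp
  then show ?thesis by (simp add: w_def[abs_def])
qed

lemma w_nonneg: "w z \<ge> 0"
  using u_pos[of "snd z"] by (auto simp: w_def indicator_def Om_iff)

lemma space_V [simp]: "space V = UNIV" and sets_V [simp, measurable_cong]: "sets V = sets borel"
  by (simp_all add: V_def)

lemma meas_V: "borel_measurable V = borel_measurable borel"
  by (rule measurable_cong_sets) auto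

text \<open>Since \<open>u\<close> is positive on \<open>Om\<close>, \<open>V\<close> and Lebesgue
  measure restricted to \<open>Om\<close> have the same null sets.\<close>

lemma AE_V: "(AE z in V. P z) \<longleftrightarrow> (AE z in lborel. z \<in> Om \<longrightarrow> P z)"
proof -
  have "0 < ennreal (w z) \<longleftrightarrow> z \<in> Om" for z
    using u_pos[of "snd z"] by (auto simp: w_def indicator_def Om_iff ennreal_less_zero_iff)
  then show ?thesis unfolding V_def by (subst AE_density) auto
qed

lemma integrable_V:
  assumes "g \<in> borel_measurable borel"
  shows "integrable V g \<longleftrightarrow> set_integrable lborel Om (\<lambda>z. u (snd z) * g z)"
  unfolding V_def set_integrable_def using assms
  by (subst integrable_density) (auto simp: w_nonneg w_def[symmetric] mult.assoc[symmetric])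

lemma integral_V:
  assumes "g \<in> borel_measurable borel"
  shows "(LINT z|V. g z) = (LINT z:Om|lborel. u (snd z) * g z)"
  unfolding V_def set_lebesgue_integral_def using assms
  by (subst integral_density) (auto simp: w_nonneg w_def[symmetric] mult.assoc[symmetric])

text \<open>Cut-off functions such as the modes need not be continuous on the closed rectangle; a
  continuous \<open>G\<close> that agrees with them inside \<open>Om\<close> gives access to
  iterated integrals.\<close>

lemma integral_V_cont:
  assumes g: "g \<in> borel_measurable borel" and G: "continuous_on Rect G" and eq: "\<And>z. z \<in> Om \<Longrightarrow> g z = G z"
  shows "integrable V g" "(LINT z|V. g z) = integral {0..T} (\<lambda>t. integral J (\<lambda>x. u x * G (t, x)))"
proof -
  have c: "continuous_on Rect (\<lambda>z. u (snd z) * G z)" by (intro continuous_on_mult cont_u_snd G)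
  have "set_integrable lborel Rect (\<lambda>z. u (snd z) * G z)"
    unfolding set_integrable_def by (rule borel_integrable_compact[OF compact_cbox c])
  then have i: "set_integrable lborel Om (\<lambda>z. u (snd z) * G z)"
    by (rule set_integrable_subset) (simp, rule Om_Rect)
  have "set_integrable lborel Om (\<lambda>z. u (snd z) * g z) \<longleftrightarrow> set_integrable lborel Om (\<lambda>z. u (snd z) * G z)"
    by (rule set_integrable_cong) (auto simp: eq)
  with i show "integrable V g" by (simp add: integrable_V g)
  have "(LINT z|V. g z) = (LINT z:Om|lborel. u (snd z) * G z)"
    unfolding integral_V[OF g] by (intro set_lebesgue_integral_cong) (auto simp: eq)
  also have "\<dots> = integral Om (\<lambda>z. u (snd z) * G z)" by (rule set_borel_integral_eq_integral(2)[OF i])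
  also have "\<dots> = integral Rect (\<lambda>z. u (snd z) * G z)" unfolding Om_box by (rule integral_open_interval)
  also have "\<dots> = integral (cbox 0 T) (\<lambda>t. integral (cbox 0 pi) (\<lambda>x. u (snd (t, x)) * G (t, x)))"
    by (rule integral_prod_continuous[OF c])
  finally show "(LINT z|V. g z) = integral {0..T} (\<lambda>t. integral J (\<lambda>x. u x * G (t, x)))" by simp
qed

lemma sq_int_V: "sq_int V y \<longleftrightarrow> y \<in> borel_measurable borel \<and> set_integrable lborel Om (\<lambda>z. u (snd z) * (y z)\<^sup>2)"
  unfolding sq_int_def meas_V by (auto simp: integrable_V)

lemma sq_int_V_cont:
  assumes "g \<in> borel_measurable borel" "continuous_on Rect G" "\<And>z. z \<in> Om \<Longrightarrow> g z = G z"
  shows "sq_int V g"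
  unfolding sq_int_def meas_V
  using assms by (auto intro!: integral_V_cont(1)[where G = "\<lambda>z. (G z)\<^sup>2"] continuous_intros)

lemma ip_V_cont:
  assumes "g \<in> borel_measurable borel" "continuous_on Rect G" "\<And>z. z \<in> Om \<Longrightarrow> g z = G z"
    "h \<in> borel_measurable borel" "continuous_on Rect H" "\<And>z. z \<in> Om \<Longrightarrow> h z = H z"
  shows "ip V g h = integral {0..T} (\<lambda>t. ip W (\<lambda>x. G (t, x)) (\<lambda>x. H (t, x)))"
proof -
  have slice: "continuous_on J (\<lambda>x. F (t, x))" if "continuous_on Rect F" "t \<in> {0..T}" for F :: "real \<times> real \<Rightarrow> real" and t
    by (rule continuous_on_compose2[OF that(1)]) (use that(2) in \<open>auto simp: Rect_iff intro!: continuous_intros\<close>)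
  have "ip V g h = integral {0..T} (\<lambda>t. integral J (\<lambda>x. u x * (G (t, x) * H (t, x))))"
    unfolding ip_def using assms by (intro integral_V_cont(2)[where G = "\<lambda>z. G z * H z"] continuous_intros) auto
  also have "\<dots> = integral {0..T} (\<lambda>t. ip W (\<lambda>x. G (t, x)) (\<lambda>x. H (t, x)))"
    by (intro integral_cong) (simp add: ip_W slice assms)
  finally show ?thesis .
qed

sublocale V: finite_measure V
proof
  have "integrable V (\<lambda>z. 1 :: real)" by (rule integral_V_cont(1)) auto
  then show "emeasure V (space V) \<noteq> \<infinity>"
    by (simp add: integrable_iff_bounded less_top[symmetric])
qed

section \<open>Time factors and orthonormality of the modes\<close>

definition tb :: "bool \<Rightarrow> nat \<Rightarrow> real \<Rightarrow> real" where
  "tb b m t = (if b then cos (\<omega> * real m * t) else sin (\<omega> * real m * t))"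

lemma has_integral_cos_period: "((\<lambda>t. cos (\<omega> * of_int k * t)) has_integral (if k = 0 then T else 0)) {0..T}"
proof (cases "k = 0")
  case True
  then show ?thesis using has_integral_const_real[of "1::real" 0 T] T_pos by simp
next
  case False
  have "((\<lambda>t. cos (\<omega> * of_int k * t)) has_integral
    sin (\<omega> * of_int k * T) / (\<omega> * of_int k) - sin (\<omega> * of_int k * 0) / (\<omega> * of_int k)) {0..T}"
    using False \<omega>_pos T_pos
    by (intro fundamental_theorem_of_calculus)
      (auto simp flip: has_real_derivative_iff_has_vector_derivative intro!: derivative_eq_intros)
  moreover have "\<omega> * of_int k * T = 2 * pi * of_int k" using \<omega>T by (simp add: ac_simps)
  ultimately show ?thesis using False by (simp add: sin_int_2pin)
qed

lemma has_integral_sin_period: "((\<lambda>t. sin (\<omega> * of_int k * t)) has_integral 0) {0..T}"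
proof (cases "k = 0")
  case False
  have "((\<lambda>t. sin (\<omega> * of_int k * t)) has_integral
    - cos (\<omega> * of_int k * T) / (\<omega> * of_int k) - - cos (\<omega> * of_int k * 0) / (\<omega> * of_int k)) {0..T}"
    using False \<omega>_pos T_pos
    by (intro fundamental_theorem_of_calculus)
      (auto simp flip: has_real_derivative_iff_has_vector_derivative intro!: derivative_eq_intros)
  moreover have "\<omega> * of_int k * T = 2 * pi * of_int k" using \<omega>T by (simp add: ac_simps)
  ultimately show ?thesis using False by (simp add: cos_int_2pin)
qed simp

lemma integral_tb:
  assumes "b \<or> m \<ge> 1" "b' \<or> m' \<ge> 1"
  shows "integral {0..T} (\<lambda>t. tb b m t * tb b' m' t) = (if b = b' \<and> m = m' then if m = 0 then T else T / 2 else 0)"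
proof -
  define d s where "d = int m - int m'" and "s = int m + int m'"
  have ds: "\<omega> * real m * t - \<omega> * real m' * t = \<omega> * of_int d * t" "\<omega> * real m * t + \<omega> * real m' * t = \<omega> * of_int s * t" for t
    by (simp_all add: d_def s_def algebra_simps)
  note I = has_integral_add has_integral_diff has_integral_cos_period[of d] has_integral_cos_period[of s]
    has_integral_sin_period[of d] has_integral_sin_period[of s]
  consider "b" "b'" | "b" "\<not> b'" | "\<not> b" "b'" | "\<not> b" "\<not> b'" by blast
  then have "((\<lambda>t. tb b m t * tb b' m' t) has_integral (if b = b' \<and> m = m' then if m = 0 then T else T / 2 else 0)) {0..T}"
  proof cases
    case 1
    have "((\<lambda>t. (cos (\<omega> * of_int d * t) + cos (\<omega> * of_int s * t)) / 2) has_integral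
      ((if d = 0 then T else 0) + (if s = 0 then T else 0)) / 2) {0..T}"
      by (intro has_integral_divide I)
    then show ?thesis using 1 has_integral_const_real[of "1::real" 0 T] T_pos
      by (auto simp: tb_def cos_times_cos ds d_def s_def split: if_splits)
  next
    case 2
    have "((\<lambda>t. (sin (\<omega> * of_int s * t) - sin (\<omega> * of_int d * t)) / 2) has_integral (0 - 0) / 2) {0..T}"
      by (intro has_integral_divide I)
    then show ?thesis using 2 by (simp add: tb_def cos_times_sin ds)
  next
    case 3
    have "((\<lambda>t. (sin (\<omega> * of_int s * t) + sin (\<omega> * of_int d * t)) / 2) has_integral (0 + 0) / 2) {0..T}"
      by (intro has_integral_divide I)
    then show ?thesis using 3 by (simp add: tb_def sin_times_cos ds)
  next
    case 4
    have "((\<lambda>t. (cos (\<omega> * of_int d * t) - cos (\<omega> * of_int s * t)) / 2) has_integral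
      ((if d = 0 then T else 0) - (if s = 0 then T else 0)) / 2) {0..T}"
      by (intro has_integral_divide I)
    then show ?thesis using 4 assms by (auto simp: tb_def sin_times_sin ds d_def s_def split: if_splits)
  qed
  then show ?thesis by (rule integral_unique)
qed

text \<open>The eigenfunctions are arbitrary outside \<open>[0, pi]\<close>; the indicator keeps the modes Borel
  measurable on the plane.\<close>
definition mode :: "bool \<times> nat \<times> nat \<Rightarrow> real \<times> real \<Rightarrow> real" where
  "mode = (\<lambda>(b, m, n) z. indicator {0<..<pi} (snd z) * (Tcoef T m * phi n (snd z) * tb b m (fst z)))"

text \<open>The sine with \<open>m\<close> = 0 vanishes identically and is left out of the
  orthonormal system.\<close>

definition MI :: "(bool \<times> nat \<times> nat) set" where
  "MI = {(b, m, n). n \<ge> 1 \<and> (b \<or> m \<ge> 1)}"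

text \<open>The mode without cut-off, continuous up to the boundary.\<close>

definition mode_rect :: "bool \<times> nat \<times> nat \<Rightarrow> real \<times> real \<Rightarrow> real" where
  "mode_rect = (\<lambda>(b, m, n) z. Tcoef T m * phi n (snd z) * tb b m (fst z))"

lemma tb_meas [measurable]: "tb b m \<in> borel_measurable borel"
  unfolding tb_def[abs_def] by (cases b) auto

lemma tb_cont: "continuous_on A (tb b m)"
  unfolding tb_def[abs_def] by (cases b) (auto intro!: continuous_intros)

lemma mode_meas [measurable]: assumes "i \<in> MI" shows "mode i \<in> borel_measurable borel"
proof -
  obtain b m n where i: "i = (b, m, n)" "n \<ge> 1" using assms by (auto simp: MI_def)
  have "continuous_on {0<..<pi} (phi n)"
    by (rule continuous_on_subset[OF phi_cont[OF i(2)]]) auto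
  then have "(\<lambda>x. indicator {0<..<pi} x *\<^sub>R phi n x) \<in> borel_measurable borel"
    by (intro borel_measurable_continuous_on_indicator) auto
  then have *: "(\<lambda>x. indicator {0<..<pi} x * phi n x) \<in> borel_measurable borel" by simp
  have "mode i = (\<lambda>z. Tcoef T m * (indicator {0<..<pi} (snd z) * phi n (snd z)) * tb b m (fst z))"
    by (auto simp: mode_def i)
  moreover have "(\<lambda>z. indicator {0<..<pi} (snd z) * phi n (snd z)) \<in> borel_measurable (borel :: (real \<times> real) measure)"
    using measurable_compose[OF borel_measurable_continuous_onI[OF continuous_on_snd[OF continuous_on_id]] *] .
  moreover have "(\<lambda>z. tb b m (fst z)) \<in> borel_measurable (borel :: (real \<times> real) measure)"
    using measurable_compose[OF borel_measurable_continuous_onI[OF continuous_on_fst[OF continuous_on_id]] tb_meas] .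
  ultimately show ?thesis by (simp only: borel_measurable_times borel_measurable_const)
qed

lemma mode_rect_cont: assumes "i \<in> MI" shows "continuous_on Rect (mode_rect i)"
proof -
  obtain b m n where i: "i = (b, m, n)" "n \<ge> 1" using assms by (auto simp: MI_def)
  have "continuous_on Rect (\<lambda>z. phi n (snd z))"
    by (rule continuous_on_compose2[OF phi_cont[OF i(2)] continuous_on_snd[OF continuous_on_id]]) (auto simp: Rect_iff)
  moreover have "continuous_on Rect (\<lambda>z. tb b m (fst z))"
    by (rule continuous_on_compose2[OF tb_cont[of UNIV] continuous_on_fst[OF continuous_on_id]]) auto
  ultimately show ?thesis unfolding mode_rect_def i by (auto intro!: continuous_intros)
qed

lemma mode_eq: "z \<in> Om \<Longrightarrow> mode i z = mode_rect i z"
  by (cases i) (simp add: mode_def mode_rect_def Om_iff)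

lemma Tcoef_nz: "Tcoef T m \<noteq> 0"
  using T_pos by (simp add: Tcoef_def)

sublocale V: orthonormal V MI mode
proof
  show "sq_int V (mode i)" if "i \<in> MI" for i
    by (rule sq_int_V_cont[OF mode_meas[OF that] mode_rect_cont[OF that] mode_eq])
next
  fix i j assume ij: "i \<in> MI" "j \<in> MI"
  obtain b m n where i: "i = (b, m, n)" "n \<ge> 1" "b \<or> m \<ge> 1" using ij by (auto simp: MI_def)
  obtain b' m' n' where j: "j = (b', m', n')" "n' \<ge> 1" "b' \<or> m' \<ge> 1" using ij by (auto simp: MI_def)
  have "ip V (mode i) (mode j) = integral {0..T} (\<lambda>t. ip W (\<lambda>x. mode_rect i (t, x)) (\<lambda>x. mode_rect j (t, x)))"
    by (rule ip_V_cont) (simp_all add: ij mode_meas mode_rect_cont mode_eq)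
  also have "\<dots> = integral {0..T} (\<lambda>t. (Tcoef T m * Tcoef T m' * ip W (phi n) (phi n')) * (tb b m t * tb b' m' t))"
  proof (intro integral_cong)
    fix t
    have e: "(\<lambda>x. mode_rect i (t, x)) = (\<lambda>x. (Tcoef T m * tb b m t) * phi n x)"
      "(\<lambda>x. mode_rect j (t, x)) = (\<lambda>x. (Tcoef T m' * tb b' m' t) * phi n' x)"
      by (auto simp: mode_rect_def i j)
    show "ip W (\<lambda>x. mode_rect i (t, x)) (\<lambda>x. mode_rect j (t, x))
      = (Tcoef T m * Tcoef T m' * ip W (phi n) (phi n')) * (tb b m t * tb b' m' t)"
      unfolding e ip_cmult_left ip_cmult_right by simp
  qed
  also have "\<dots> = (Tcoef T m * Tcoef T m' * ip W (phi n) (phi n')) * integral {0..T} (\<lambda>t. tb b m t * tb b' m' t)"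
    by (rule integral_mult_right)
  also have "\<dots> = (if i = j then 1 else 0)"
    using integral_tb[OF i(3) j(3)] ip_e[of n n'] i j T_pos
    by (auto simp: Tcoef_def)
  finally show "ip V (mode i) (mode j) = (if i = j then 1 else 0)" .
qed

definition emu :: "bool \<times> nat \<times> nat \<Rightarrow> real" where
  "emu = (\<lambda>(b, m, n). mu lam2 p q m n)"

lemma emu: "emu (b, m, n) = lam2 n - (\<omega> * real m)\<^sup>2"
  by (simp add: emu_def mu_def freq)

section \<open>Half-period symmetry, Fourier coefficients and kernels\<close>

lemma tb_shift: "tb b m (t + T) = tb b m t"
proof -
  have "\<omega> * real m * (t + T) = \<omega> * real m * t + 2 * pi * real m"
    using \<omega>T by (simp add: algebra_simps)
  then show ?thesis
    by (simp add: tb_def sin_add cos_add cos_int_2pin[of "int m", simplified] sin_int_2pin[of "int m", simplified])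
qed

lemma tb_half_shift: "tb b m (t + T / 2) = (-1) ^ m * tb b m t"
proof -
  have "\<omega> * real m * (t + T / 2) = \<omega> * real m * t + real m * pi"
    using \<omega>T by (simp add: algebra_simps)
  then show ?thesis by (simp add: tb_def sin_add cos_add)
qed

lemma mode_shift: "mode i (t + T, x) = mode i (t, x)"
  by (cases i) (simp add: mode_def tb_shift)

lemma mode_half_shift: "mode (b, m, n) (t + T / 2, x) = (-1) ^ m * mode (b, m, n) (t, x)"
  by (simp add: mode_def tb_half_shift)

lemma coef_a_ip:
  assumes "y \<in> borel_measurable borel" "n \<ge> 1"
  shows "coef_a u p q T phi y m n = ip V y (mode (True, m, n))"
proof -
  have "(True, m, n) \<in> MI" using assms by (simp add: MI_def)
  then have "ip V y (mode (True, m, n)) = (LINT z:Om|lborel. u (snd z) * (y z * mode (True, m, n) z))"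
    unfolding ip_def using assms(1) by (intro integral_V borel_measurable_times mode_meas)
  also have "\<dots> = coef_a u p q T phi y m n"
    unfolding coef_a_def by (rule set_lebesgue_integral_cong) (auto simp: mode_def cosb_def tb_def freq Om_iff)
  finally show ?thesis ..
qed

lemma coef_b_ip:
  assumes "y \<in> borel_measurable borel" "n \<ge> 1"
  shows "coef_b u p q T phi y m n = (if m = 0 then 0 else ip V y (mode (False, m, n)))"
proof (cases "m = 0")
  case True
  then show ?thesis by (simp add: coef_b_def sinb_def freq set_lebesgue_integral_def)
next
  case False
  then have "(False, m, n) \<in> MI" using assms by (simp add: MI_def)
  then have "ip V y (mode (False, m, n)) = (LINT z:Om|lborel. u (snd z) * (y z * mode (False, m, n) z))"
    unfolding ip_def using assms(1) by (intro integral_V borel_measurable_times mode_meas)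
  also have "\<dots> = coef_b u p q T phi y m n"
    unfolding coef_b_def by (rule set_lebesgue_integral_cong) (auto simp: mode_def sinb_def tb_def freq Om_iff)
  finally show ?thesis using False by simp
qed

definition MO :: "(bool \<times> nat \<times> nat) set" where
  "MO = {(b, m, n). n \<ge> 1 \<and> odd m}"

lemma MO_MI: "MO \<subseteq> MI"
  by (auto simp: MO_def MI_def elim: oddE)

lemma comb_in_L2:
  assumes "E \<subseteq> MI" shows "V.comb E c \<in> L2 u T"
  using V.sq_comb[OF assms, of c]
  by (auto simp: L2_def sq_int_V V.comb_def mode_shift)

lemma comb_in_M_o:
  assumes "E \<subseteq> MO" shows "V.comb E c \<in> M_o u T"
proof -
  have "V.comb E c z = - V.comb E c (fst z + T / 2, snd z)" for z
    unfolding V.comb_def sum_negf[symmetric]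
  proof (rule sum.cong[OF refl])
    fix i assume "i \<in> E"
    with assms obtain b m n where "i = (b, m, n)" "odd m" by (auto simp: MO_def)
    then show "c i * mode i z = - (c i * mode i (fst z + T / 2, snd z))"
      using mode_half_shift[of b m n "fst z" "snd z"] by simp
  qed
  moreover have "V.comb E c \<in> L2 u T" using assms MO_MI by (intro comb_in_L2) blast
  ultimately show ?thesis unfolding M_o_def by blast
qed

text \<open>The nonresonance hypotheses speak of \<open>ker_Lo\<close>, the abstract problem of
  finite combinations of modes; this is the link. Finitely many nonzero coefficients make the domain
  condition trivial and the series of L eventually constant.\<close>

lemma comb_in_kernel:
  assumes E: "finite E" "E \<subseteq> MO" and ev: "\<And>i. i \<in> E \<Longrightarrow> emu i = lam"
  shows "V.comb E c \<in> ker_Lo u p q T lam2 phi lam"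
proof -
  let ?y = "V.comb E c"
  have EM: "E \<subseteq> MI" using E(2) MO_MI by blast
  have ym: "?y \<in> borel_measurable borel" using V.sq_comb[OF EM, of c] by (simp add: sq_int_V)
  define c' where "c' = (\<lambda>i. if i \<in> E then c i else 0)"
  define F0 where "F0 = snd ` E"
  have F0: "finite F0" "F0 \<subseteq> Idx" using E by (auto simp: F0_def Idx_def MO_def)
  have a: "coef_a u p q T phi ?y m n = c' (True, m, n)" if "n \<ge> 1" for m n
    using V.ip_comb_e[OF EM E(1), of "(True, m, n)" c] that
    by (simp add: coef_a_ip[OF ym that] c'_def MI_def)
  have b: "coef_b u p q T phi ?y m n = c' (False, m, n)" if "n \<ge> 1" for m n
  proof (cases "m = 0")
    case True
    then have "(False, m, n) \<notin> E" using E(2) by (auto simp: MO_def)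
    then show ?thesis using True by (simp add: coef_b_ip[OF ym that] c'_def)
  next
    case False
    then show ?thesis using V.ip_comb_e[OF EM E(1), of "(False, m, n)" c] that
      by (simp add: coef_b_ip[OF ym that] c'_def MI_def)
  qed
  have c'0: "c' (b, mn) = 0" if "mn \<notin> F0" for b mn
    using that by (force simp: c'_def F0_def)
  have mu: "mu lam2 p q m n * c' (b, m, n) = lam * c' (b, m, n)" for b m n
    using ev[of "(b, m, n)"] by (simp add: c'_def emu_def)
  have dom: "?y \<in> domL u p q T lam2 phi"
    unfolding domL_def
  proof (intro CollectI conjI comb_in_L2 EM)
    let ?g = "\<lambda>(m, n). (mu lam2 p q m n)\<^sup>2 * ((coef_a u p q T phi ?y m n)\<^sup>2 + (coef_b u p q T phi ?y m n)\<^sup>2)"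
    have "?g summable_on F0" by (rule summable_on_finite[OF F0(1)])
    moreover have "?g summable_on F0 \<longleftrightarrow> ?g summable_on Idx"
    proof (rule summable_on_cong_neutral)
      fix mn assume "mn \<in> Idx - F0"
      then show "?g mn = 0"
        using c'0[of mn] by (cases mn) (auto simp: a b Idx_def)
    qed (use F0 in auto)
    ultimately show "?g summable_on Idx" by simp
  qed
  have "L_eq u p q T lam2 phi ?y (\<lambda>z. lam * ?y z)"
    unfolding L_eq_def
  proof (intro conjI dom)
    show "series_L2 u p q T phi (\<lambda>m n. mu lam2 p q m n * coef_a u p q T phi ?y m n)
       (\<lambda>m n. mu lam2 p q m n * coef_b u p q T phi ?y m n) (\<lambda>z. lam * ?y z)"
      unfolding series_L2_def
    proof (rule tendsto_eventually)
      \<comment> \<open>Once the finite index set contains \<open>F0\<close>, the partial sum equals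
        lam y on \<open>Om\<close> and the integral is exactly 0.\<close>
      have ev: "\<forall>\<^sub>F F in finite_subsets_at_top Idx. finite F \<and> F0 \<subseteq> F \<and> F \<subseteq> Idx"
        unfolding eventually_finite_subsets_at_top using F0 by (intro exI[of _ F0]) auto
      show "\<forall>\<^sub>F F in finite_subsets_at_top Idx. (LINT z:Om|lborel. u (snd z) *
          (lam * ?y z - (\<Sum>(m,n)\<in>F. mu lam2 p q m n * coef_a u p q T phi ?y m n * cosb p q T phi m n z
             + mu lam2 p q m n * coef_b u p q T phi ?y m n * sinb p q T phi m n z))\<^sup>2) = 0"
        using ev
      proof eventually_elim
        case (elim F)
        have "(\<Sum>(m,n)\<in>F. mu lam2 p q m n * coef_a u p q T phi ?y m n * cosb p q T phi m n z
             + mu lam2 p q m n * coef_b u p q T phi ?y m n * sinb p q T phi m n z) = lam * ?y z" if z: "z \<in> Om" for z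
        proof -
          have "(\<Sum>(m,n)\<in>F. mu lam2 p q m n * coef_a u p q T phi ?y m n * cosb p q T phi m n z
             + mu lam2 p q m n * coef_b u p q T phi ?y m n * sinb p q T phi m n z)
            = (\<Sum>mn\<in>F. \<Sum>b\<in>UNIV. lam * c' (b, mn) * mode (b, mn) z)"
          proof (rule sum.cong[OF refl])
            fix mn assume mn: "mn \<in> F"
            obtain m n where [simp]: "mn = (m, n)" by (cases mn)
            have n: "n \<ge> 1" using mn elim by (auto simp: Idx_def)
            have "mode (True, m, n) z = cosb p q T phi m n z" "mode (False, m, n) z = sinb p q T phi m n z"
              using z by (auto simp: mode_def cosb_def sinb_def tb_def freq Om_iff)
            then show "(case mn of (m, n) \<Rightarrow> mu lam2 p q m n * coef_a u p q T phi ?y m n * cosb p q T phi m n z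
             + mu lam2 p q m n * coef_b u p q T phi ?y m n * sinb p q T phi m n z)
             = (\<Sum>b\<in>UNIV. lam * c' (b, mn) * mode (b, mn) z)"
              by (simp add: UNIV_bool a[OF n] b[OF n] mu)
          qed
          also have "\<dots> = (\<Sum>b\<in>UNIV. \<Sum>mn\<in>F. lam * c' (b, mn) * mode (b, mn) z)" by (rule sum.swap)
          also have "\<dots> = (\<Sum>i\<in>UNIV \<times> F. lam * c' i * mode i z)" by (simp add: sum.cartesian_product)
          also have "\<dots> = (\<Sum>i\<in>E. lam * c i * mode i z)"
          proof (rule sum.mono_neutral_cong_right)
            show "E \<subseteq> UNIV \<times> F"
            proof
              fix i assume "i \<in> E"
              then have "snd i \<in> F" using elim by (auto simp: F0_def)
              then show "i \<in> UNIV \<times> F" by (cases i) simp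
            qed
          qed (use elim in \<open>auto simp: c'_def\<close>)
          also have "\<dots> = lam * ?y z" by (simp add: V.comb_def sum_distrib_left mult.assoc)
          finally show ?thesis .
        qed
        then have "(LINT z:Om|lborel. u (snd z) *
          (lam * ?y z - (\<Sum>(m,n)\<in>F. mu lam2 p q m n * coef_a u p q T phi ?y m n * cosb p q T phi m n z
             + mu lam2 p q m n * coef_b u p q T phi ?y m n * sinb p q T phi m n z))\<^sup>2)
          = (LINT z:Om|lborel. 0)"
          by (intro set_lebesgue_integral_cong) auto
        then show ?case by simp
      qed
    qed
  qed
  then show ?thesis unfolding ker_Lo_def using dom comb_in_M_o[OF E(2)] by blast
qed

text \<open>The nonresonance hypotheses integrate without the weight; the positive lower bound of \<open>u\<close>
  carries them over to \<open>V\<close>.\<close>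
lemma weighted_positive:
  assumes k: "k \<in> borel_measurable borel" "AE z in V. 0 \<le> k z" "AE z in V. k z \<le> K"
    and y: "sq_int V y" and pos: "0 < (LINT z:Om|lborel. k z * (y z)\<^sup>2)"
  shows "0 < (LINT z|V. k z * (y z)\<^sup>2)"
proof -
  obtain c where c: "c > 0" "\<And>x. x \<in> J \<Longrightarrow> c \<le> u x" using umin by blast
  have ym: "y \<in> borel_measurable borel" using y by (simp add: sq_int_V)
  have kb: "AE z in V. \<bar>k z\<bar> \<le> \<bar>K\<bar>" using k(2,3) by eventually_elim simp
  have "integrable V (\<lambda>z. k z * (y z)\<^sup>2)"
  proof (rule Bochner_Integration.integrable_bound[of V "\<lambda>z. \<bar>K\<bar> * (y z)\<^sup>2"])
    show "integrable V (\<lambda>z. \<bar>K\<bar> * (y z)\<^sup>2)" using y by (simp add: sq_int_def)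
    show "(\<lambda>z. k z * (y z)\<^sup>2) \<in> borel_measurable V" unfolding meas_V using k(1) ym by measurable
    show "AE z in V. norm (k z * (y z)\<^sup>2) \<le> norm (\<bar>K\<bar> * (y z)\<^sup>2)"
      using kb by eventually_elim (auto simp: abs_mult intro!: mult_right_mono)
  qed
  then have i: "set_integrable lborel Om (\<lambda>z. u (snd z) * (k z * (y z)\<^sup>2))"
    using k ym by (subst (asm) integrable_V) auto
  have "c * (LINT z:Om|lborel. k z * (y z)\<^sup>2) = (LINT z:Om|lborel. c * (k z * (y z)\<^sup>2))" by simp
  also have "\<dots> \<le> (LINT z:Om|lborel. u (snd z) * (k z * (y z)\<^sup>2))"
    unfolding set_lebesgue_integral_def
  proof (rule integral_mono_AE')
    show "integrable lborel (\<lambda>z. indicator Om z *\<^sub>R (u (snd z) * (k z * (y z)\<^sup>2)))"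
      using i by (simp add: set_integrable_def)
    show "AE z in lborel. indicator Om z *\<^sub>R (c * (k z * (y z)\<^sup>2)) \<le> indicator Om z *\<^sub>R (u (snd z) * (k z * (y z)\<^sup>2))"
      using k(2) unfolding AE_V
    proof eventually_elim
      case (elim z)
      then show ?case using c(2)[of "snd z"] by (auto simp: indicator_def Om_iff intro!: mult_right_mono)
    qed
    show "AE z in lborel. 0 \<le> indicator Om z *\<^sub>R (u (snd z) * (k z * (y z)\<^sup>2))"
      using k(2) unfolding AE_V
    proof eventually_elim
      case (elim z)
      then show ?case using u_pos[of "snd z"] by (auto simp: indicator_def Om_iff less_imp_le)
    qed
  qed
  also have "\<dots> = (LINT z|V. k z * (y z)\<^sup>2)" using k ym by (subst integral_V) auto
  finally show ?thesis using mult_pos_pos[OF c(1) pos] by linarith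
qed

text \<open>A nontrivial combination is not null, because its inner product with
  \<open>mode i0\<close> returns the nonzero coefficient \<open>c i0\<close>.\<close>

lemma nonresonance:
  assumes k: "k \<in> borel_measurable borel" "AE z in V. 0 \<le> k z" "AE z in V. k z \<le> K"
    and nr: "\<forall>v\<in>ker_Lo u p q T lam2 phi lam. L2_nonzero T v \<longrightarrow> (LINT z:Om|lborel. k z * (v z)\<^sup>2) > 0"
    and E: "finite E" "E \<subseteq> MO" "\<And>i. i \<in> E \<Longrightarrow> emu i = lam" and c: "i0 \<in> E" "c i0 \<noteq> 0"
  shows "0 < (LINT z|V. k z * (V.comb E c z)\<^sup>2)"
proof (rule weighted_positive[OF k])
  have EM: "E \<subseteq> MI" using E MO_MI by blast
  show sq: "sq_int V (V.comb E c)" by (rule V.sq_comb[OF EM])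
  have "L2_nonzero T (V.comb E c)"
    unfolding L2_nonzero_def AE_V[symmetric]
  proof
    assume "AE z in V. V.comb E c z = 0"
    then have "ip V (V.comb E c) (mode i0) = (LINT z|V. 0)"
      unfolding ip_def using sq mode_meas[of i0] EM c(1)
      by (intro integral_cong_AE) (auto simp: sq_int_def meas_V)
    moreover have "ip V (V.comb E c) (mode i0) = c i0"
      using V.ip_comb_e[OF EM E(1), of i0 c] c EM by auto
    ultimately show False using c by simp
  qed
  with nr comb_in_kernel[OF E] show "0 < (LINT z:Om|lborel. k z * (V.comb E c z)\<^sup>2)" by blast
qed

text \<open>Translation by T/2 carries the left half of \<open>Om\<close> onto the right half and
  preserves the weight, which depends on x alone. The two halves cancel, and the line between them
  is null.\<close>

lemma integral_antiperiodic:
  fixes g :: "real \<times> real \<Rightarrow> real"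
  assumes g: "integrable V g"
    and anti: "\<And>t x. 0 < t \<Longrightarrow> t < T / 2 \<Longrightarrow> 0 < x \<Longrightarrow> x < pi \<Longrightarrow> g (t + T / 2, x) = - g (t, x)"
  shows "(LINT z|V. g z) = 0"
proof -
  have gm: "g \<in> borel_measurable borel" using borel_measurable_integrable[OF g] by (simp add: meas_V)
  define k where "k = (\<lambda>z. indicator Om z *\<^sub>R (u (snd z) * g z))"
  have k: "integrable lborel k" using g gm by (simp add: k_def integrable_V set_integrable_def)
  define A B where "A = {0<..<T/2} \<times> {0<..<pi}" and "B = {T/2<..<T} \<times> {0<..<pi}"
  have AB [measurable]: "A \<in> sets borel" "B \<in> sets borel"
    unfolding A_def B_def by (auto intro!: borel_open open_Times)
  have iA: "integrable lborel (\<lambda>z. indicator A z *\<^sub>R k z)" and iB: "integrable lborel (\<lambda>z. indicator B z *\<^sub>R k z)"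
    by (rule integrable_mult_indicator[OF _ k], simp)+
  have null: "AE z in lborel. z \<notin> {T/2} \<times> (UNIV::real set)"
  proof (rule AE_not_in)
    have "emeasure lborel ({T/2} \<times> (UNIV::real set)) = emeasure (lborel \<Otimes>\<^sub>M lborel) ({T/2} \<times> (UNIV::real set))"
      by (simp add: lborel_prod)
    also have "\<dots> = 0" by (subst lborel.emeasure_pair_measure_Times) auto
    finally show "{T/2} \<times> (UNIV::real set) \<in> null_sets lborel"
      by (intro null_setsI) (auto intro!: borel_closed closed_Times)
  qed
  have "(LINT z|V. g z) = integral\<^sup>L lborel k"
    unfolding integral_V[OF gm] set_lebesgue_integral_def k_def ..
  also have "\<dots> = (LINT z|lborel. indicator A z *\<^sub>R k z + indicator B z *\<^sub>R k z)"
  proof (rule integral_cong_AE)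
    show "AE z in lborel. k z = indicator A z *\<^sub>R k z + indicator B z *\<^sub>R k z"
      using null
    proof eventually_elim
      case (elim z)
      then show ?case by (cases z) (auto simp: k_def A_def B_def indicator_def Omega_def)
    qed
  qed (use k in auto)
  also have "\<dots> = (LINT z|lborel. indicator A z *\<^sub>R k z) + (LINT z|lborel. indicator B z *\<^sub>R k z)"
    by (rule Bochner_Integration.integral_add[OF iA iB])
  also have "(LINT z|lborel. indicator B z *\<^sub>R k z) = (LINT z|lborel. indicator B ((T/2, 0) + z) *\<^sub>R k ((T/2, 0) + z))"
    using borel_measurable_integrable[OF k]
    by (subst lborel_distr_plus[of "(T/2, 0::real)", symmetric], subst integral_distr) auto
  also have "\<dots> = (LINT z|lborel. - (indicator A z *\<^sub>R k z))"
  proof (rule Bochner_Integration.integral_cong[OF refl])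
    fix z :: "real \<times> real"
    show "indicator B ((T/2, 0) + z) *\<^sub>R k ((T/2, 0) + z) = - (indicator A z *\<^sub>R k z)"
    proof (cases "z \<in> A")
      case True
      then have "(T/2, 0) + z \<in> B" "z \<in> Om" "(T/2, 0) + z \<in> Om"
        using T_pos by (auto simp: A_def B_def Omega_def)
      moreover have "g ((T/2, 0) + z) = - g z"
        using anti[of "fst z" "snd z"] True by (cases z) (auto simp: A_def add.commute)
      ultimately show ?thesis using True by (simp add: k_def)
    next
      case False
      then have "(T/2, 0) + z \<notin> B" by (cases z) (auto simp: A_def B_def)
      with False show ?thesis by simp
    qed
  qed
  finally show ?thesis using iA by simp
qed

end

section \<open>Test functions\<close>

text \<open>Identifies the \<open>deriv\<close>-based partials of the test functions with the
  witnesses of the coinductive rule, which can be differentiated again.\<close>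

lemma smooth2_partials:
  assumes "smooth2 \<psi>"
  obtains \<psi>t \<psi>x where "smooth2 \<psi>t" "smooth2 \<psi>x" "continuous_on UNIV \<psi>" "pdt \<psi> = \<psi>t" "pdx \<psi> = \<psi>x"
    "\<And>t x. ((\<lambda>s. \<psi> (s, x)) has_real_derivative \<psi>t (t, x)) (at t)"
    "\<And>t x. ((\<lambda>s. \<psi> (t, s)) has_real_derivative \<psi>x (t, x)) (at x)"
  using assms
proof (cases rule: smooth2.cases)
  case (1 ft fx)
  have t: "((\<lambda>s. \<psi> (s, x)) has_real_derivative ft (t, x)) (at t)" for t x
  proof -
    have "((\<lambda>s. (s, x)) has_derivative (\<lambda>h. (h, 0))) (at t)"
      by (auto intro!: derivative_eq_intros)
    from has_derivative_compose[OF this 1(2)[of "(t, x)"]] show ?thesis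
      by (simp add: has_field_derivative_def mult.commute[of _ "ft (t, x)"])
  qed
  have x: "((\<lambda>s. \<psi> (t, s)) has_real_derivative fx (t, x)) (at x)" for t x
  proof -
    have "((\<lambda>s. (t, s)) has_derivative (\<lambda>h. (0, h))) (at x)"
      by (auto intro!: derivative_eq_intros)
    from has_derivative_compose[OF this 1(2)[of "(t, x)"]] show ?thesis
      by (simp add: has_field_derivative_def mult.commute[of _ "fx (t, x)"])
  qed
  have "pdt \<psi> = ft" unfolding pdt_def using DERIV_imp_deriv[OF t] by auto
  moreover have "pdx \<psi> = fx" unfolding pdx_def using DERIV_imp_deriv[OF x] by auto
  ultimately show ?thesis using that 1 t x by blast
qed

lemma smooth2_continuous: "smooth2 \<psi> \<Longrightarrow> continuous_on A \<psi>"
  using smooth2_partials continuous_on_subset by (metis subset_UNIV)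

lemma trig_poly_cont: "trig_poly c P \<Longrightarrow> continuous_on A P"
  by (induction rule: trig_poly.induct) (auto intro!: continuous_intros)

context wave
begin

lemma slice_cont:
  assumes "continuous_on Rect F" "t \<in> {0..T}"
  shows "continuous_on J (\<lambda>x. F (t, x))"
  by (rule continuous_on_compose2[OF assms(1)]) (use assms(2) in \<open>auto simp: Rect_iff intro!: continuous_intros\<close>)

lemma phi_snd_cont: "n \<ge> 1 \<Longrightarrow> continuous_on Rect (\<lambda>z. phi n (snd z))"
  by (rule continuous_on_compose2[OF phi_cont continuous_on_snd[OF continuous_on_id]]) (auto simp: Rect_iff)

lemma fst_cont: "continuous_on UNIV P \<Longrightarrow> continuous_on Rect (\<lambda>z. P (fst z))"
  by (rule continuous_on_compose2[OF _ continuous_on_fst[OF continuous_on_id]]) auto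

lemma snd_cont: "continuous_on J P \<Longrightarrow> continuous_on Rect (\<lambda>z. P (snd z))"
  by (rule continuous_on_compose2[OF _ continuous_on_snd[OF continuous_on_id]]) (auto simp: Rect_iff)

lemma ip_slice_cont:
  assumes F: "continuous_on Rect F" and G: "continuous_on Rect G"
  shows "continuous_on {0..T} (\<lambda>t. ip W (\<lambda>x. F (t, x)) (\<lambda>x. G (t, x)))"
proof -
  have "continuous_on Rect (\<lambda>z. u (snd z) * (F z * G z))" by (intro continuous_intros snd_cont cont_u F G)
  moreover have "Rect = {0..T} \<times> cbox 0 pi" by (auto simp: Rect_iff)
  ultimately have "continuous_on ({0..T} \<times> cbox 0 pi) (\<lambda>(t, x). u x * (F (t, x) * G (t, x)))"
    by (simp add: case_prod_beta')
  then have "continuous_on {0..T} (\<lambda>t. integral (cbox 0 pi) (\<lambda>x. u x * (F (t, x) * G (t, x))))"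
    by (rule integral_continuous_on_param)
  then show ?thesis
    by (rule continuous_on_eq) (simp add: ip_W[OF slice_cont[OF F] slice_cont[OF G]])
qed

text \<open>With the time integral inside, integration by parts in t can be done for each fixed x,
  without differentiating under the integral in x.\<close>

lemma swap_integrals:
  assumes F: "continuous_on Rect F" and n: "n \<ge> 1"
  shows "integral {0..T} (\<lambda>t. tb b m t * ip W (\<lambda>x. F (t, x)) (phi n))
    = integral J (\<lambda>x. u x * phi n x * integral {0..T} (\<lambda>t. tb b m t * F (t, x)))"
proof -
  have "continuous_on Rect (\<lambda>z. tb b m (fst z) * (u (snd z) * (F z * phi n (snd z))))"
    by (intro continuous_intros fst_cont tb_cont snd_cont cont_u F phi_cont n)
  then have c: "continuous_on (cbox (0, 0) (T, pi)) (\<lambda>(t, x). tb b m t * (u x * (F (t, x) * phi n x)))"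
    by (simp add: case_prod_beta')
  have "integral {0..T} (\<lambda>t. tb b m t * ip W (\<lambda>x. F (t, x)) (phi n))
    = integral (cbox 0 T) (\<lambda>t. integral (cbox 0 pi) (\<lambda>x. tb b m t * (u x * (F (t, x) * phi n x))))"
    by (simp, intro integral_cong) (simp add: ip_W[OF slice_cont[OF F] phi_cont[OF n]])
  also have "\<dots> = integral (cbox 0 pi) (\<lambda>x. integral (cbox 0 T) (\<lambda>t. tb b m t * (u x * (F (t, x) * phi n x))))"
    by (rule integral_swap_continuous[OF c])
  also have "\<dots> = integral J (\<lambda>x. u x * phi n x * integral {0..T} (\<lambda>t. tb b m t * F (t, x)))"
  proof -
    have "integral {0..T} (\<lambda>t. tb b m t * (u x * (F (t, x) * phi n x)))
      = u x * phi n x * integral {0..T} (\<lambda>t. tb b m t * F (t, x))" for x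
    proof -
      have "(\<lambda>t. tb b m t * (u x * (F (t, x) * phi n x))) = (\<lambda>t. u x * phi n x * (tb b m t * F (t, x)))"
        by (simp add: ac_simps)
      then show ?thesis by (simp only: integral_mult_right)
    qed
    then show ?thesis by simp
  qed
  finally show ?thesis .
qed

text \<open>Two integrations by parts in one: tb g1 - tb' g has derivative tb g2 + k^2 tb g with k =
  \<omega> m, and equal values at 0 and T.\<close>

lemma integral_tb_second_derivative:
  assumes d1: "\<And>t. (g has_real_derivative g1 t) (at t)" and d2: "\<And>t. (g1 has_real_derivative g2 t) (at t)"
    and per: "g 0 = g T" "g1 0 = g1 T"
    and c: "continuous_on {0..T} g" "continuous_on {0..T} g2"
  shows "integral {0..T} (\<lambda>t. tb b m t * g2 t) = - (\<omega> * real m)\<^sup>2 * integral {0..T} (\<lambda>t. tb b m t * g t)"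
proof -
  define k where "k = \<omega> * real m"
  define tb1 where "tb1 = (\<lambda>t. k * (if b then - sin (k * t) else cos (k * t)))"
  have dtb: "(tb b m has_real_derivative tb1 t) (at t within A)" for t A
    unfolding tb_def[abs_def] tb1_def k_def[symmetric] by (cases b) (auto intro!: derivative_eq_intros)
  have dtb1: "(tb1 has_real_derivative - k\<^sup>2 * tb b m t) (at t within A)" for t A
    unfolding tb_def[abs_def] tb1_def k_def[symmetric]
    by (cases b) (auto intro!: derivative_eq_intros simp: power2_eq_square)
  have tbT: "tb b m T = tb b m 0" using tb_shift[of b m 0] by simp
  have tb1T: "tb1 T = tb1 0"
  proof -
    have "k * T = 2 * pi * real m" using \<omega>T by (simp add: k_def ac_simps)
    then show ?thesis
      using cos_int_2pin[of "int m"] sin_int_2pin[of "int m"] by (simp add: tb1_def)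
  qed
  have "((\<lambda>t. tb b m t * g2 t + k\<^sup>2 * (tb b m t * g t)) has_integral
    (tb b m T * g1 T - tb1 T * g T) - (tb b m 0 * g1 0 - tb1 0 * g 0)) {0..T}"
  proof (rule fundamental_theorem_of_calculus)
    fix t
    have "((\<lambda>t. tb b m t * g1 t - tb1 t * g t) has_real_derivative
      (tb b m t * g2 t + tb1 t * g1 t) - (tb1 t * g1 t + - k\<^sup>2 * tb b m t * g t)) (at t within {0..T})"
      by (intro DERIV_diff DERIV_mult' dtb dtb1 DERIV_subset[OF d1 subset_UNIV] DERIV_subset[OF d2 subset_UNIV])
    then show "((\<lambda>t. tb b m t * g1 t - tb1 t * g t) has_vector_derivative
      tb b m t * g2 t + k\<^sup>2 * (tb b m t * g t)) (at t within {0..T})"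
      by (simp add: has_real_derivative_iff_has_vector_derivative[symmetric] algebra_simps)
  qed (use T_pos in simp)
  then have "integral {0..T} (\<lambda>t. tb b m t * g2 t + k\<^sup>2 * (tb b m t * g t)) = 0"
    by (simp add: integral_unique tbT tb1T per)
  moreover have "integral {0..T} (\<lambda>t. tb b m t * g2 t + k\<^sup>2 * (tb b m t * g t))
    = integral {0..T} (\<lambda>t. tb b m t * g2 t) + k\<^sup>2 * integral {0..T} (\<lambda>t. tb b m t * g t)"
    by (subst Henstock_Kurzweil_Integration.integral_add)
      (auto intro!: integrable_continuous_real continuous_intros tb_cont c)
  ultimately show ?thesis by (simp add: k_def)
qed

text \<open>Divided by \<open>u\<close> because the inner product of \<open>V\<close> carries the
  factor \<open>u\<close>: pairing with \<open>wv \<psi>\<close> in \<open>V\<close> is the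
  unweighted pairing with the wave operator.\<close>

definition wv :: "(real \<times> real \<Rightarrow> real) \<Rightarrow> real \<times> real \<Rightarrow> real" where
  "wv \<psi> z = indicator Om z * (wave_op u \<psi> z / u (snd z))"

text \<open>The choice is h = -(u \<psi>_x)_x / u, continuous on the closed rectangle. Each time
  slice of \<psi> is then the Green image of the slice of \<open>h\<close>, which opens it to the
  theory in x.\<close>

lemma test_fun_structure:
  assumes \<psi>: "test_fun T \<psi>"
  obtains \<psi>t \<psi>tt h where
    "continuous_on UNIV \<psi>" "continuous_on UNIV \<psi>tt" "continuous_on Rect h"
    "\<And>t x. ((\<lambda>s. \<psi> (s, x)) has_real_derivative \<psi>t (t, x)) (at t)"
    "\<And>t x. ((\<lambda>s. \<psi>t (s, x)) has_real_derivative \<psi>tt (t, x)) (at t)"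
    "\<And>x. x \<in> J \<Longrightarrow> \<psi> (0, x) = \<psi> (T, x) \<and> \<psi>t (0, x) = \<psi>t (T, x)"
    "\<And>t. t \<in> {0..T} \<Longrightarrow> sol (\<lambda>x. h (t, x)) (\<lambda>x. \<psi> (t, x))"
    "\<And>z. z \<in> Om \<Longrightarrow> wv \<psi> z = \<psi>tt z + h z"
proof -
  from \<psi> have s: "smooth2 \<psi>" by (simp add: test_fun_def)
  obtain \<psi>t \<psi>x where 1: "smooth2 \<psi>t" "smooth2 \<psi>x" "continuous_on UNIV \<psi>" "pdt \<psi> = \<psi>t" "pdx \<psi> = \<psi>x"
    and dt: "\<And>t x. ((\<lambda>s. \<psi> (s, x)) has_real_derivative \<psi>t (t, x)) (at t)"
    and dx: "\<And>t x. ((\<lambda>s. \<psi> (t, s)) has_real_derivative \<psi>x (t, x)) (at x)"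
    by (rule smooth2_partials[OF s]) blast
  obtain \<psi>tt where 2: "smooth2 \<psi>tt" "pdt \<psi>t = \<psi>tt"
    and dtt: "\<And>t x. ((\<lambda>s. \<psi>t (s, x)) has_real_derivative \<psi>tt (t, x)) (at t)"
    by (rule smooth2_partials[OF 1(1)]) blast
  obtain \<psi>xx where 3: "smooth2 \<psi>xx"
    and dxx: "\<And>t x. ((\<lambda>s. \<psi>x (t, s)) has_real_derivative \<psi>xx (t, x)) (at x)"
    by (rule smooth2_partials[OF 1(2)]) blast
  define h where "h = (\<lambda>z. - (u (snd z) * \<psi>xx z + u' (snd z) * \<psi>x z) / u (snd z))"
  have hc: "continuous_on Rect h"
    unfolding h_def using u_nz
    by (intro continuous_intros snd_cont cont_u cont_u' smooth2_continuous 1 3) (auto simp: Rect_iff)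
  have dflux: "((\<lambda>s. u s * \<psi>x (t, s)) has_real_derivative - (u x * h (t, x))) (at x within J)" if x: "x \<in> J" for t x
  proof -
    have "((\<lambda>s. u s * \<psi>x (t, s)) has_real_derivative u x * \<psi>xx (t, x) + u' x * \<psi>x (t, x)) (at x within J)"
      by (intro DERIV_mult' du x DERIV_subset[OF dxx subset_UNIV])
    then show ?thesis using u_nz[OF x] by (simp add: h_def add.commute)
  qed
  have "sol (\<lambda>x. h (t, x)) (\<lambda>x. \<psi> (t, x))" if t: "t \<in> {0..T}" for t
    unfolding sol_def SLd_def
  proof (intro conjI exI[of _ "\<lambda>x. \<psi>x (t, x)"] ballI)
    show "((\<lambda>x. \<psi> (t, x)) has_real_derivative \<psi>x (t, x)) (at x within J)" for x
      by (rule DERIV_subset[OF dx subset_UNIV])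
  qed (use \<psi> t dflux in \<open>auto simp: test_fun_def intro: slice_cont[OF hc t]\<close>)
  moreover have "wv \<psi> z = \<psi>tt z + h z" if z: "z \<in> Om" for z
  proof -
    have x: "snd z \<in> J" "0 < snd z" "snd z < pi" using z by (auto simp: Om_iff)
    have "((\<lambda>s. u s * \<psi>x (fst z, s)) has_real_derivative - (u (snd z) * h z)) (at (snd z))"
      using dflux[OF x(1), of "fst z"] x by (simp add: at_within_Icc_at)
    then have "deriv (\<lambda>s. u s * \<psi>x (fst z, s)) (snd z) = - (u (snd z) * h z)" by (rule DERIV_imp_deriv)
    then show ?thesis
      using z u_nz[OF x(1)] by (simp add: wv_def wave_op_def 1 2 add_divide_distrib)
  qed
  moreover have "\<psi> (0, x) = \<psi> (T, x) \<and> \<psi>t (0, x) = \<psi>t (T, x)" if "x \<in> J" for x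
    using \<psi> that by (auto simp: test_fun_def 1)
  ultimately show ?thesis
    using that[OF 1(3) smooth2_continuous[OF 2(1)] hc dt dtt] by blast
qed

lemma test_fun_meas: "test_fun T \<psi> \<Longrightarrow> \<psi> \<in> borel_measurable borel"
  by (intro borel_measurable_continuous_onI smooth2_continuous) (simp add: test_fun_def)

lemma test_fun_sq_int: "test_fun T \<psi> \<Longrightarrow> sq_int V \<psi>"
  by (rule sq_int_V_cont[OF test_fun_meas smooth2_continuous]) (auto simp: test_fun_def)

lemma wv_meas:
  assumes "test_fun T \<psi>" shows "wv \<psi> \<in> borel_measurable borel"
proof (rule test_fun_structure[OF assms])
  fix \<psi>t \<psi>tt h
  assume c: "continuous_on UNIV \<psi>tt" "continuous_on Rect h" and eq: "\<And>z. z \<in> Om \<Longrightarrow> wv \<psi> z = \<psi>tt z + h z"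
  have "(\<lambda>z. indicator Om z *\<^sub>R (\<psi>tt z + h z)) \<in> borel_measurable borel"
    using c Om_Rect
    by (intro borel_measurable_continuous_on_indicator continuous_on_add) (auto intro: continuous_on_subset)
  moreover have "(\<lambda>z. indicator Om z *\<^sub>R (\<psi>tt z + h z)) = wv \<psi>"
    using eq by (auto simp: wv_def indicator_def)
  ultimately show ?thesis by simp
qed

lemma wv_sq_int:
  assumes "test_fun T \<psi>" shows "sq_int V (wv \<psi>)"
proof (rule test_fun_structure[OF assms])
  fix \<psi>t \<psi>tt h
  assume c: "continuous_on UNIV \<psi>tt" "continuous_on Rect h" and eq: "\<And>z. z \<in> Om \<Longrightarrow> wv \<psi> z = \<psi>tt z + h z"
  show ?thesis
    by (rule sq_int_V_cont[OF wv_meas[OF assms] continuous_on_add[OF continuous_on_subset[OF c(1)] c(2)] eq]) auto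
qed

text \<open>The time part contributes -(\<omega> m)^2 by parts, the space part \<open>lam2 n\<close>
  by symmetry of the Green operator; together they make \<open>emu\<close>.\<close>

lemma ip_wv_mode:
  assumes \<psi>: "test_fun T \<psi>" and i: "i \<in> MI"
  shows "ip V (wv \<psi>) (mode i) = emu i * ip V \<psi> (mode i)"
proof (rule test_fun_structure[OF \<psi>])
  fix \<psi>t \<psi>tt h
  assume c: "continuous_on UNIV \<psi>" "continuous_on UNIV \<psi>tt" "continuous_on Rect h"
    and dt: "\<And>t x. ((\<lambda>s. \<psi> (s, x)) has_real_derivative \<psi>t (t, x)) (at t)"
    and dtt: "\<And>t x. ((\<lambda>s. \<psi>t (s, x)) has_real_derivative \<psi>tt (t, x)) (at t)"
    and per: "\<And>x. x \<in> J \<Longrightarrow> \<psi> (0, x) = \<psi> (T, x) \<and> \<psi>t (0, x) = \<psi>t (T, x)"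
    and s: "\<And>t. t \<in> {0..T} \<Longrightarrow> sol (\<lambda>x. h (t, x)) (\<lambda>x. \<psi> (t, x))"
    and eq: "\<And>z. z \<in> Om \<Longrightarrow> wv \<psi> z = \<psi>tt z + h z"
  obtain b m n where i': "i = (b, m, n)" "n \<ge> 1" using i by (auto simp: MI_def)
  have c\<psi>: "continuous_on Rect \<psi>" and c\<psi>tt: "continuous_on Rect \<psi>tt" using c continuous_on_subset by blast+
  let ?A = "\<lambda>t. ip W (\<lambda>x. \<psi> (t, x)) (phi n)" and ?B = "\<lambda>t. ip W (\<lambda>x. \<psi>tt (t, x)) (phi n)"
  have slice: "(\<lambda>x. mode_rect i (t, x)) = (\<lambda>x. (Tcoef T m * tb b m t) * phi n x)" for t
    by (auto simp: mode_rect_def i')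
  have cA: "continuous_on {0..T} ?A" and cB: "continuous_on {0..T} ?B"
    using ip_slice_cont[OF c\<psi> phi_snd_cont[OF i'(2)]] ip_slice_cont[OF c\<psi>tt phi_snd_cont[OF i'(2)]] by simp_all
  have AB: "integral {0..T} (\<lambda>t. tb b m t * ?B t) = - (\<omega> * real m)\<^sup>2 * integral {0..T} (\<lambda>t. tb b m t * ?A t)"
  proof -
    have "integral {0..T} (\<lambda>t. tb b m t * ?B t)
      = integral J (\<lambda>x. u x * phi n x * integral {0..T} (\<lambda>t. tb b m t * \<psi>tt (t, x)))"
      by (rule swap_integrals[OF c\<psi>tt i'(2)])
    also have "\<dots> = integral J (\<lambda>x. - (\<omega> * real m)\<^sup>2 * (u x * phi n x * integral {0..T} (\<lambda>t. tb b m t * \<psi> (t, x))))"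
    proof (intro integral_cong)
      fix x assume x: "x \<in> J"
      have "integral {0..T} (\<lambda>t. tb b m t * \<psi>tt (t, x)) = - (\<omega> * real m)\<^sup>2 * integral {0..T} (\<lambda>t. tb b m t * \<psi> (t, x))"
        using per[OF x]
        by (intro integral_tb_second_derivative[OF dt dtt])
          (auto intro!: continuous_on_compose2[OF c(1)] continuous_on_compose2[OF c(2)] continuous_intros)
      then show "u x * phi n x * integral {0..T} (\<lambda>t. tb b m t * \<psi>tt (t, x))
        = - (\<omega> * real m)\<^sup>2 * (u x * phi n x * integral {0..T} (\<lambda>t. tb b m t * \<psi> (t, x)))" by simp
    qed
    also have "\<dots> = - (\<omega> * real m)\<^sup>2 * integral J (\<lambda>x. u x * phi n x * integral {0..T} (\<lambda>t. tb b m t * \<psi> (t, x)))"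
      by (rule integral_mult_right)
    also have "integral J (\<lambda>x. u x * phi n x * integral {0..T} (\<lambda>t. tb b m t * \<psi> (t, x)))
      = integral {0..T} (\<lambda>t. tb b m t * ?A t)"
      by (rule swap_integrals[OF c\<psi> i'(2), symmetric])
    finally show ?thesis .
  qed
  have "ip V (wv \<psi>) (mode i) = integral {0..T} (\<lambda>t. ip W (\<lambda>x. \<psi>tt (t, x) + h (t, x)) (\<lambda>x. mode_rect i (t, x)))"
    by (rule ip_V_cont[OF wv_meas[OF \<psi>] continuous_on_add[OF c\<psi>tt c(3)] eq mode_meas[OF i] mode_rect_cont[OF i] mode_eq])
  also have "\<dots> = integral {0..T} (\<lambda>t. Tcoef T m * (tb b m t * ?B t + lam2 n * (tb b m t * ?A t)))"
  proof (intro integral_cong)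
    fix t assume t: "t \<in> {0..T}"
    have "ip W (\<lambda>x. \<psi>tt (t, x) + h (t, x)) (phi n) = ?B t + ip W (\<lambda>x. h (t, x)) (phi n)"
      by (intro ip_add_left sq_W slice_cont c\<psi>tt c(3) t phi_cont i')
    also have "ip W (\<lambda>x. h (t, x)) (phi n) = lam2 n * ?A t"
      by (rule ip_sol_phi[OF s[OF t] i'(2)])
    finally show "ip W (\<lambda>x. \<psi>tt (t, x) + h (t, x)) (\<lambda>x. mode_rect i (t, x))
      = Tcoef T m * (tb b m t * ?B t + lam2 n * (tb b m t * ?A t))"
      unfolding slice ip_cmult_right by (simp add: algebra_simps)
  qed
  also have "\<dots> = Tcoef T m * (integral {0..T} (\<lambda>t. tb b m t * ?B t) + lam2 n * integral {0..T} (\<lambda>t. tb b m t * ?A t))"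
    unfolding integral_mult_right
    by (subst Henstock_Kurzweil_Integration.integral_add)
      (auto intro!: integrable_continuous_real continuous_intros tb_cont cA cB)
  also have "\<dots> = emu i * (Tcoef T m * integral {0..T} (\<lambda>t. tb b m t * ?A t))"
    unfolding AB i' emu by (simp add: algebra_simps)
  also have "Tcoef T m * integral {0..T} (\<lambda>t. tb b m t * ?A t)
    = integral {0..T} (\<lambda>t. ip W (\<lambda>x. \<psi> (t, x)) (\<lambda>x. mode_rect i (t, x)))"
    unfolding slice ip_cmult_right mult.assoc by (rule integral_mult_right[symmetric])
  also have "\<dots> = ip V \<psi> (mode i)"
    by (rule ip_V_cont[OF test_fun_meas[OF \<psi>] c\<psi> refl mode_meas[OF i] mode_rect_cont[OF i] mode_eq, symmetric])
  finally show ?thesis .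
qed

text \<open>Induction over the generators, each being a mode up to the factor \<open>Tcoef\<close>;
  the sine with \<open>m\<close> = 0 is the empty combination.\<close>

lemma trig_poly_phi_lincomb:
  assumes "trig_poly \<omega> P" "n \<ge> 1"
  shows "(\<lambda>z. indicator {0<..<pi} (snd z) * (P (fst z) * phi n (snd z))) \<in> V.lincombs"
  using assms(1)
proof induction
  case (cos m)
  have "(\<lambda>z. 1 / Tcoef T m * mode (True, m, n) z) \<in> V.lincombs"
    using assms(2) by (intro V.lincombs_cmult V.lincombs_e) (simp add: MI_def)
  then show ?case using Tcoef_nz[of m] by (simp add: mode_def tb_def ac_simps)
next
  case (sin m)
  show ?case
  proof (cases "m = 0")
    case False
    then have "(\<lambda>z. 1 / Tcoef T m * mode (False, m, n) z) \<in> V.lincombs"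
      using assms(2) by (intro V.lincombs_cmult V.lincombs_e) (simp add: MI_def)
    then show ?thesis using Tcoef_nz[of m] by (simp add: mode_def tb_def ac_simps)
  qed (simp add: V.lincombs_zero)
next
  case (add P Q)
  from V.lincombs_add[OF add.IH] show ?case by (simp add: algebra_simps)
next
  case (cmult P c)
  from V.lincombs_cmult[OF cmult.IH, of c] show ?case by (simp add: algebra_simps)
qed

text \<open>The spatial truncation order can be chosen uniformly in t because \<open>h\<close> is
  bounded on the closed rectangle; then finitely many continuous periodic coefficient functions of t
  remain.\<close>

lemma test_fun_dense:
  assumes \<psi>: "test_fun T \<psi>" and \<epsilon>: "\<epsilon> > 0"
  obtains g where "g \<in> V.lincombs" "nrm V (\<lambda>z. \<psi> z - g z) \<le> \<epsilon>"
proof (rule test_fun_structure[OF \<psi>])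
  fix \<psi>t \<psi>tt h
  assume c: "continuous_on UNIV \<psi>" "continuous_on Rect h"
    and per: "\<And>x. x \<in> J \<Longrightarrow> \<psi> (0, x) = \<psi> (T, x) \<and> \<psi>t (0, x) = \<psi>t (T, x)"
    and s: "\<And>t. t \<in> {0..T} \<Longrightarrow> sol (\<lambda>x. h (t, x)) (\<lambda>x. \<psi> (t, x))"
  have c\<psi>: "continuous_on Rect \<psi>" using c continuous_on_subset by blast
  have "bounded (h ` Rect)" by (intro compact_imp_bounded compact_continuous_image c compact_cbox)
  then obtain Hm where Hm: "Hm > 0" "\<And>z. z \<in> Rect \<Longrightarrow> \<bar>h z\<bar> \<le> Hm"
    unfolding bounded_pos by auto
  define H1 where "H1 = Hm * nrm W (\<lambda>x. 1)"
  have nh: "nrm W (\<lambda>x. h (t, x)) \<le> H1" if t: "t \<in> {0..T}" for t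
  proof -
    have "nrm W (\<lambda>x. h (t, x)) \<le> nrm W (\<lambda>x. Hm * 1)"
      using Hm t
      by (intro nrm_mono sq_W continuous_intros meas_W slice_cont c AE_I2) (auto simp: W_def space_restrict_space Rect_iff)
    then show ?thesis using Hm(1) by (simp only: nrm_cmult abs_of_pos H1_def)
  qed
  \<comment> \<open>Each slice costs at most 2 \<epsilon>1, and integrating the square over a period
    multiplies the norm bound by sqrt T.\<close>
  define \<epsilon>1 where "\<epsilon>1 = \<epsilon> / (2 * sqrt T)"
  have \<epsilon>1: "\<epsilon>1 > 0" using \<epsilon> T_pos by (simp add: \<epsilon>1_def)
  obtain c0 where c0: "c0 > 0" "\<And>n. n \<ge> 1 \<Longrightarrow> c0 * n \<le> lam2 n" using lam2_growth by blast
  \<comment> \<open>Linear growth of \<open>lam2\<close> turns the expansion rate into an explicit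
    truncation order.\<close>
  define N where "N = nat \<lceil>H1 / (c0 * \<epsilon>1)\<rceil>"
  have HN: "H1 / lam2 (Suc N) \<le> \<epsilon>1"
  proof -
    have "H1 / (c0 * \<epsilon>1) \<le> Suc N" unfolding N_def by linarith
    then have "H1 \<le> \<epsilon>1 * (c0 * Suc N)" using c0 \<epsilon>1 by (simp add: field_simps)
    also have "\<dots> \<le> \<epsilon>1 * lam2 (Suc N)" using c0(2)[of "Suc N"] \<epsilon>1 by (intro mult_left_mono) auto
    finally show ?thesis using lam2_pos[of "Suc N"] by (simp add: field_simps)
  qed
  define cf where "cf = (\<lambda>n t. ip W (\<lambda>x. \<psi> (t, x)) (phi n))"
  \<comment> \<open>The tolerance is such that the N squared coefficient errors of a slice sum to at
    most \<epsilon>1^2, also when N = 0.\<close>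
  have "\<exists>P. trig_poly \<omega> P \<and> (\<forall>t\<in>{0..T}. \<bar>cf n t - P t\<bar> < \<epsilon>1 / (real N + 1))" if n: "n \<in> {1..N}" for n
  proof -
    have n1: "n \<ge> 1" using n by simp
    have 1: "continuous_on {0..T} (cf n)"
      unfolding cf_def using ip_slice_cont[OF c\<psi> phi_snd_cont[OF n1]] by simp
    have 2: "cf n 0 = cf n T"
      unfolding cf_def using per T_pos n1
      by (intro ip_W_cong slice_cont c\<psi> phi_cont) auto
    have 3: "\<epsilon>1 / (real N + 1) > 0" using \<epsilon>1 by simp
    show ?thesis
    proof (rule trig_poly_dense[OF 1 2 T_pos 3])
      fix P assume "trig_poly (2 * pi / T) P"
        "\<And>t. t \<in> {0..T} \<Longrightarrow> \<bar>cf n t - P t\<bar> < \<epsilon>1 / (real N + 1)"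
      then show ?thesis unfolding \<omega>_def by (intro exI[of _ P] conjI ballI)
    qed
  qed
  then have "\<forall>n\<in>{1..N}. \<exists>P. trig_poly \<omega> P \<and> (\<forall>t\<in>{0..T}. \<bar>cf n t - P t\<bar> < \<epsilon>1 / (real N + 1))" ..
  from bchoice[OF this] obtain P where P: "\<And>n. n \<in> {1..N} \<Longrightarrow> trig_poly \<omega> (P n)"
    "\<And>n t. n \<in> {1..N} \<Longrightarrow> t \<in> {0..T} \<Longrightarrow> \<bar>cf n t - P n t\<bar> < \<epsilon>1 / (real N + 1)"
    by blast
  define g where "g = (\<lambda>z. \<Sum>n\<in>{1..N}. indicator {0<..<pi} (snd z) * (P n (fst z) * phi n (snd z)))"
  define G where "G = (\<lambda>z. \<Sum>n\<in>{1..N}. P n (fst z) * phi n (snd z))"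
  have g: "g \<in> V.lincombs"
    unfolding g_def by (intro V.lincombs_sum trig_poly_phi_lincomb P) auto
  have gm: "g \<in> borel_measurable borel"
  proof -
    have "sq_int V g" using g V.sq_comb by (auto simp: V.lincombs_def)
    then show ?thesis by (simp add: sq_int_V)
  qed
  have Gc: "continuous_on Rect G"
    unfolding G_def by (intro continuous_intros fst_cont phi_snd_cont trig_poly_cont[OF P(1)]) auto
  have gG: "g z = G z" if "z \<in> Om" for z
    unfolding g_def G_def using that by (intro sum.cong refl) (simp add: Om_iff)
  let ?D = "\<lambda>z. \<psi> z - G z"
  have Dc: "continuous_on Rect ?D" by (intro continuous_intros c\<psi> Gc)
  have slice: "nrm W (\<lambda>x. ?D (t, x)) \<le> 2 * \<epsilon>1" if t: "t \<in> {0..T}" for t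
  proof -
    let ?c = "\<lambda>n. cf n t"
    let ?r = "\<lambda>x. \<psi> (t, x) - comb {1..N} ?c x" and ?d = "comb {1..N} (\<lambda>n. cf n t - P n t)"
    have cc: "continuous_on J (comb {1..N} d)" for d
      unfolding comb_def by (intro continuous_intros phi_cont) auto
    have "(\<lambda>x. ?D (t, x)) = (\<lambda>x. ?r x + ?d x)"
      by (auto simp: G_def comb_def left_diff_distrib sum_subtractf)
    then have "nrm W (\<lambda>x. ?D (t, x)) \<le> nrm W ?r + nrm W ?d"
      by (simp only:) (intro nrm_triangle sq_W continuous_intros cc slice_cont[OF c\<psi> t])
    moreover have "nrm W ?r \<le> \<epsilon>1"
    proof -
      have "nrm W ?r \<le> nrm W (\<lambda>x. h (t, x)) / lam2 (Suc N)"
        unfolding cf_def by (rule eigenfunction_expansion[OF s[OF t]])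
      also have "\<dots> \<le> H1 / lam2 (Suc N)"
        using nh[OF t] lam2_pos[of "Suc N"] by (intro divide_right_mono) auto
      finally show ?thesis using HN by linarith
    qed
    moreover have "nrm W ?d \<le> \<epsilon>1"
    proof (rule power2_le_imp_le)
      have "(nrm W ?d)\<^sup>2 = (\<Sum>n\<in>{1..N}. (cf n t - P n t)\<^sup>2)" by (rule nrm_comb) auto
      also have "\<dots> \<le> (\<Sum>n\<in>{1..N}. (\<epsilon>1 / (real N + 1))\<^sup>2)"
      proof (rule sum_mono)
        fix n assume n: "n \<in> {1..N}"
        have "\<bar>cf n t - P n t\<bar>\<^sup>2 \<le> (\<epsilon>1 / (real N + 1))\<^sup>2"
          using P(2)[OF n t] by (intro power_mono) auto
        then show "(cf n t - P n t)\<^sup>2 \<le> (\<epsilon>1 / (real N + 1))\<^sup>2" by simp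
      qed
      also have "\<dots> = \<epsilon>1\<^sup>2 * (real N / (real N + 1)\<^sup>2)" by (simp add: power_divide)
      also have "\<dots> \<le> \<epsilon>1\<^sup>2 * 1"
        by (intro mult_left_mono) (auto simp: divide_le_eq power2_eq_square algebra_simps)
      finally show "(nrm W ?d)\<^sup>2 \<le> \<epsilon>1\<^sup>2" by simp
    qed (use \<epsilon>1 in simp)
    ultimately show ?thesis by linarith
  qed
  have "(nrm V (\<lambda>z. \<psi> z - g z))\<^sup>2 = integral {0..T} (\<lambda>t. ip W (\<lambda>x. ?D (t, x)) (\<lambda>x. ?D (t, x)))"
    unfolding nrm_square using test_fun_meas[OF \<psi>] gm gG
    by (intro ip_V_cont Dc) auto
  also have "\<dots> \<le> integral {0..T} (\<lambda>t. (2 * \<epsilon>1)\<^sup>2)"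
  proof (rule integral_le)
    show "(\<lambda>t. ip W (\<lambda>x. ?D (t, x)) (\<lambda>x. ?D (t, x))) integrable_on {0..T}"
      by (intro integrable_continuous_real ip_slice_cont Dc)
    show "ip W (\<lambda>x. ?D (t, x)) (\<lambda>x. ?D (t, x)) \<le> (2 * \<epsilon>1)\<^sup>2" if "t \<in> {0..T}" for t
      unfolding nrm_square[symmetric] using slice[OF that] by (intro power_mono) auto
  qed (auto intro: integrable_const_ivl)
  also have "\<dots> = \<epsilon>\<^sup>2" using T_pos by (simp add: \<epsilon>1_def power_divide power_mult_distrib)
  finally have "nrm V (\<lambda>z. \<psi> z - g z) \<le> \<epsilon>" by (rule power2_le_imp_le) (use \<epsilon> in simp)
  with g show ?thesis by (rule that)
qed

end

section \<open>Existence of a weak solution\<close>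

context wave
begin

text \<open>Projecting y and \<psi> on the same finite set of modes makes both sides equal term by
  term; what remains are two projection errors, paired with \<open>wv \<psi>\<close> and
  \<open>F\<close>.\<close>

lemma weak_equation:
  assumes y: "sq_int V y" and F: "sq_int V F"
    and appr: "\<And>\<epsilon>. \<epsilon> > 0 \<Longrightarrow> \<exists>g\<in>V.lincombs. nrm V (\<lambda>z. y z - g z) \<le> \<epsilon>"
    and modes: "\<And>i. i \<in> MI \<Longrightarrow> emu i * ip V y (mode i) = ip V F (mode i)"
    and \<psi>: "test_fun T \<psi>"
  shows "ip V y (wv \<psi>) = ip V F \<psi>"
proof -
  note sq\<psi> = test_fun_sq_int[OF \<psi>] and sqw = wv_sq_int[OF \<psi>]
  define K where "K = nrm V (wv \<psi>) + nrm V F"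
  have K: "K \<ge> 0" by (simp add: K_def)
  have "\<bar>ip V y (wv \<psi>) - ip V F \<psi>\<bar> \<le> K * \<epsilon>" if \<epsilon>: "\<epsilon> > 0" for \<epsilon>
  proof -
    obtain g1 where "g1 \<in> V.lincombs" and n1: "nrm V (\<lambda>z. \<psi> z - g1 z) \<le> \<epsilon>"
      by (rule test_fun_dense[OF \<psi> \<epsilon>])
    then obtain F1 c1 where F1: "finite F1" "F1 \<subseteq> MI" "g1 = V.comb F1 c1" by (auto simp: V.lincombs_def)
    obtain g2 where "g2 \<in> V.lincombs" and n2: "nrm V (\<lambda>z. y z - g2 z) \<le> \<epsilon>"
      using appr[OF \<epsilon>] by blast
    then obtain F2 c2 where F2: "finite F2" "F2 \<subseteq> MI" "g2 = V.comb F2 c2" by (auto simp: V.lincombs_def)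
    \<comment> \<open>Projections on the union are at least as close as the given
      approximants.\<close>
    let ?F = "F1 \<union> F2"
    have FM: "?F \<subseteq> MI" "finite ?F" using F1 F2 by auto
    define py where "py = V.comb ?F (\<lambda>i. ip V y (mode i))"
    define p\<psi> where "p\<psi> = V.comb ?F (\<lambda>i. ip V \<psi> (mode i))"
    have sqp: "sq_int V py" "sq_int V p\<psi>" unfolding py_def p\<psi>_def by (intro V.sq_comb FM)+
    have n1': "nrm V (\<lambda>z. \<psi> z - p\<psi> z) \<le> \<epsilon>"
      using V.best_approximation[OF _ FM sq\<psi>, of F1 c1] n1 by (simp add: p\<psi>_def F1(3))
    have n2': "nrm V (\<lambda>z. y z - py z) \<le> \<epsilon>"
      using V.best_approximation[OF _ FM y, of F2 c2] n2 by (simp add: py_def F2(3))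
    have "ip V py (wv \<psi>) = (\<Sum>i\<in>?F. ip V y (mode i) * ip V (mode i) (wv \<psi>))"
      unfolding py_def by (rule V.ip_comb_left[OF FM(1) sqw])
    also have "\<dots> = (\<Sum>i\<in>?F. ip V \<psi> (mode i) * ip V (mode i) F)"
    proof (rule sum.cong[OF refl])
      fix i assume "i \<in> ?F"
      then have i: "i \<in> MI" using FM by blast
      show "ip V y (mode i) * ip V (mode i) (wv \<psi>) = ip V \<psi> (mode i) * ip V (mode i) F"
        by (simp add: ip_commute[of V "mode i"] ip_wv_mode[OF \<psi> i] modes[OF i, symmetric])
    qed
    also have "\<dots> = ip V p\<psi> F"
      unfolding p\<psi>_def by (rule V.ip_comb_left[OF FM(1) F, symmetric])
    finally have eq: "ip V py (wv \<psi>) = ip V p\<psi> F" .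
    have "\<bar>ip V (\<lambda>z. y z - py z) (wv \<psi>)\<bar> \<le> nrm V (\<lambda>z. y z - py z) * nrm V (wv \<psi>)"
      by (intro Cauchy_Schwarz_ip sq_int_diff y sqp sqw)
    also have "\<dots> \<le> \<epsilon> * nrm V (wv \<psi>)" using n2' by (intro mult_right_mono) auto
    finally have 1: "\<bar>ip V y (wv \<psi>) - ip V py (wv \<psi>)\<bar> \<le> \<epsilon> * nrm V (wv \<psi>)"
      by (simp add: ip_diff_left y sqp sqw)
    have "\<bar>ip V (\<lambda>z. \<psi> z - p\<psi> z) F\<bar> \<le> nrm V (\<lambda>z. \<psi> z - p\<psi> z) * nrm V F"
      by (intro Cauchy_Schwarz_ip sq_int_diff sq\<psi> sqp F)
    also have "\<dots> \<le> \<epsilon> * nrm V F" using n1' by (intro mult_right_mono) auto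
    finally have 2: "\<bar>ip V \<psi> F - ip V p\<psi> F\<bar> \<le> \<epsilon> * nrm V F"
      by (simp add: ip_diff_left sq\<psi> sqp F)
    have "K * \<epsilon> = \<epsilon> * nrm V (wv \<psi>) + \<epsilon> * nrm V F" by (simp add: K_def algebra_simps)
    with 1 2 eq show ?thesis unfolding ip_commute[of V F \<psi>] by linarith
  qed
  note bound = this
  show ?thesis
  proof (rule ccontr)
    assume "ip V y (wv \<psi>) \<noteq> ip V F \<psi>"
    then have d: "\<bar>ip V y (wv \<psi>) - ip V F \<psi>\<bar> > 0" (is "?d > 0") by simp
    have "?d \<le> K * (?d / (2 * (K + 1)))" using d K by (intro bound) simp
    also have "\<dots> \<le> (K + 1) * (?d / (2 * (K + 1)))" using d K by (intro mult_right_mono) auto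
    also have "\<dots> = ?d / 2"
    proof -
      have "L * (d / (2 * L)) = d / 2" if "L > 0" for L d :: real using that by simp
      from this[of "K + 1" ?d] show ?thesis using K by (simp only: add_nonneg_pos zero_less_one)
    qed
    finally show False using d by simp
  qed
qed

lemma existence:
  fixes f f1 f2 :: "real \<Rightarrow> real \<Rightarrow> real \<Rightarrow> real"
  assumes f_cont: "continuous_on ({0<..<T} \<times> {0<..<pi} \<times> UNIV) (\<lambda>(t, x, y). f t x y)"
    and f_bound: "\<forall>R>0. \<exists>h\<in>L2 u T. \<forall>z\<in>Omega T. \<forall>y. \<bar>y\<bar> \<le> R \<longrightarrow>
                      \<bar>f (fst z) (snd z) y / u (snd z)\<bar> \<le> h z"
    and lamlohi: "lamlo < lamhi"
    and lam_consec: "\<forall>\<mu>\<in>spec_Lo lam2 p q. \<not> (lamlo < \<mu> \<and> \<mu> < lamhi)"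
    and \<alpha>_meas: "\<alpha> \<in> borel_measurable borel" and \<beta>_meas: "\<beta> \<in> borel_measurable borel"
    and \<alpha>\<beta>: "AE z in lborel. z \<in> Omega T \<longrightarrow> lamlo \<le> \<alpha> z \<and> \<alpha> z \<le> \<beta> z \<and> \<beta> z \<le> lamhi"
    and \<alpha>_nonres: "\<forall>v\<in>ker_Lo u p q T lam2 phi lamlo. L2_nonzero T v \<longrightarrow>
                     (LINT z:Omega T|lborel. (\<alpha> z - lamlo) * (v z)\<^sup>2) > 0"
    and \<beta>_nonres: "\<forall>v\<in>ker_Lo u p q T lam2 phi lamhi. L2_nonzero T v \<longrightarrow>
                     (LINT z:Omega T|lborel. (lamhi - \<beta> z) * (v z)\<^sup>2) > 0"
    and f_split: "\<forall>t. \<forall>x\<in>{0<..<pi}. \<forall>y. f t x y / u x = f1 t x y + f2 t x y"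
    and f1_sym: "\<forall>t. \<forall>x\<in>{0<..<pi}. \<forall>y. f1 t x y = f1 (t + T/2) x y \<and> f1 t x y = - f1 t x (- y)"
    and f2_sym: "\<forall>t. \<forall>x\<in>{0<..<pi}. \<forall>y. f2 t x y = - f2 (t + T/2) x y \<and> f2 t x y = f2 t x (- y)"
    and f2_lim: "\<forall>\<epsilon>>0. \<exists>R. AE z in lborel. z \<in> Omega T \<longrightarrow>
                   (\<forall>y. \<bar>y\<bar> \<ge> R \<longrightarrow> \<bar>f2 (fst z) (snd z) y / y\<bar> \<le> \<epsilon>)"
    and f1_lim: "\<forall>\<epsilon>>0. \<exists>R. AE z in lborel. z \<in> Omega T \<longrightarrow>
                   (\<forall>y. \<bar>y\<bar> \<ge> R \<longrightarrow> \<alpha> z - \<epsilon> \<le> f1 (fst z) (snd z) y / y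
                                    \<and> f1 (fst z) (snd z) y / y \<le> \<beta> z + \<epsilon>)"
  shows "\<exists>y\<in>M_o u T. weak_solution u T f y"
proof -
  define en where "en = from_nat_into MO"
  have "infinite MO"
  proof
    assume "finite MO"
    moreover have "range (\<lambda>k. (True, 2 * k + 1, 1)) \<subseteq> MO" by (auto simp: MO_def)
    moreover have "inj (\<lambda>k::nat. (True, 2 * k + 1, 1::nat))" by (auto simp: inj_on_def)
    ultimately show False using finite_imageD finite_subset infinite_UNIV_nat by metis
  qed
  then have bij: "bij_betw en UNIV MO" unfolding en_def by (intro bij_betw_from_nat_into) auto
  have inj: "inj en" and ran: "range en = MO" using bij by (auto simp: bij_betw_def)
  have ranI: "range en \<subseteq> MI" using ran MO_MI by simp
  define eo where "eo = (\<lambda>i. mode (en i))"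
  define nu where "nu = (\<lambda>i. emu (en i))"
  interpret O: orthonormal V UNIV eo
    unfolding eo_def by (rule V.orthonormal_reindex[OF inj ranI])
  have comb: "O.comb E c = V.comb (en ` E) (\<lambda>j. c (inv en j))" for E c
    unfolding eo_def by (rule V.comb_reindex[OF inj ranI])
  \<comment> \<open>The cut-off makes the superposition Borel measurable on the plane, as f is
    controlled only over \<open>Om\<close>.\<close>
  define Nl where "Nl = (\<lambda>z y. indicator Om z * (f (fst z) (snd z) y / u (snd z)))"
  have Nl_app: "Nl z v = indicator Om z * (f (fst z) (snd z) v / u (snd z))" for z v by (simp add: Nl_def)
  have AE\<alpha>\<beta>: "AE z in V. lamlo \<le> \<alpha> z \<and> \<alpha> z \<le> \<beta> z \<and> \<beta> z \<le> lamhi" using \<alpha>\<beta> by (simp only: AE_V)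
  have nonres: "0 < (LINT z|V. k z * (O.comb E c z)\<^sup>2)"
    if k: "k \<in> borel_measurable borel" "AE z in V. 0 \<le> k z" "AE z in V. k z \<le> lamhi - lamlo"
      and nr: "\<forall>v\<in>ker_Lo u p q T lam2 phi lam. L2_nonzero T v \<longrightarrow> (LINT z:Om|lborel. k z * (v z)\<^sup>2) > 0"
      and E: "finite E" "\<forall>i\<in>E. nu i = lam" "\<exists>i\<in>E. c i \<noteq> 0" for k lam E c
  proof -
    obtain i0 where i0: "i0 \<in> E" "c i0 \<noteq> 0" using E(3) by blast
    show ?thesis
      unfolding comb
    proof (rule nonresonance[OF k nr])
      show "en ` E \<subseteq> MO" using ran by blast
      show "en i0 \<in> en ` E" "c (inv en (en i0)) \<noteq> 0" using i0 inj by auto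
    qed (use E in \<open>auto simp: nu_def\<close>)
  qed
  interpret A: asymptotically_linear V eo nu lamlo lamhi \<alpha> \<beta> Nl
  proof
    show "finite {i. \<bar>nu i\<bar> \<le> K}" for K
    proof -
      let ?S = "{(m, n). odd m \<and> n \<ge> 1 \<and> \<bar>mu lam2 p q m n\<bar> \<le> K}"
      have "{i. \<bar>nu i\<bar> \<le> K} \<subseteq> en -` (UNIV \<times> ?S)"
      proof
        fix i assume i: "i \<in> {i. \<bar>nu i\<bar> \<le> K}"
        have "en i \<in> MO" using ran by blast
        with i show "i \<in> en -` (UNIV \<times> ?S)" by (cases "en i") (auto simp: nu_def emu_def MO_def)
      qed
      moreover have "finite (en -` (UNIV \<times> ?S))"
        using finite_small_mu[OF pq(1,2,4) odd_q, of K] inj by (intro finite_vimageI finite_cartesian_product) auto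
      ultimately show ?thesis by (rule finite_subset)
    qed
    show "lamlo < lamhi" by (rule lamlohi)
    show "nu i \<le> lamlo \<or> lamhi \<le> nu i" for i
    proof -
      have "en i \<in> MO" using ran by blast
      then have "nu i \<in> spec_Lo lam2 p q" by (cases "en i") (auto simp: nu_def emu_def MO_def spec_Lo_def)
      with lam_consec show ?thesis by force
    qed
    show "\<alpha> \<in> borel_measurable V" "\<beta> \<in> borel_measurable V" using \<alpha>_meas \<beta>_meas by (simp_all add: meas_V)
    show "AE z in V. lamlo \<le> \<alpha> z \<and> \<alpha> z \<le> \<beta> z \<and> \<beta> z \<le> lamhi" by (rule AE\<alpha>\<beta>)
    show "0 < (LINT z|V. (\<alpha> z - lamlo) * (O.comb E c z)\<^sup>2)"
      if "finite E" "\<forall>i\<in>E. nu i = lamlo" "\<exists>i\<in>E. c i \<noteq> 0" for E c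
    proof (rule nonres[OF _ _ _ \<alpha>_nonres that])
      show "AE z in V. 0 \<le> \<alpha> z - lamlo" "AE z in V. \<alpha> z - lamlo \<le> lamhi - lamlo"
        using AE\<alpha>\<beta> by (auto elim: eventually_mono)
    qed (use \<alpha>_meas in measurable)
    show "0 < (LINT z|V. (lamhi - \<beta> z) * (O.comb E c z)\<^sup>2)"
      if "finite E" "\<forall>i\<in>E. nu i = lamhi" "\<exists>i\<in>E. c i \<noteq> 0" for E c
    proof (rule nonres[OF _ _ _ \<beta>_nonres that])
      show "AE z in V. 0 \<le> lamhi - \<beta> z" "AE z in V. lamhi - \<beta> z \<le> lamhi - lamlo"
        using AE\<alpha>\<beta> by (auto elim: eventually_mono)
    qed (use \<beta>_meas in measurable)
    show "(\<lambda>z. Nl z (y z)) \<in> borel_measurable V" if "y \<in> borel_measurable V" for y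
    proof -
      have ym: "y \<in> borel_measurable borel" using that by (simp add: meas_V)
      let ?S = "{0<..<T} \<times> {0<..<pi} \<times> (UNIV :: real set)"
      have "open ?S" by (intro open_Times) auto
      then have c1: "(\<lambda>v. indicator ?S v *\<^sub>R (case v of (t, x, y) \<Rightarrow> f t x y)) \<in> borel_measurable borel"
        by (intro borel_measurable_continuous_on_indicator f_cont) simp
      have c2: "(\<lambda>z. (fst z, snd z, y z)) \<in> borel_measurable borel"
        by (intro borel_measurable_Pair ym borel_measurable_continuous_onI[of fst] borel_measurable_continuous_onI[of snd] continuous_intros)
      have m1: "(\<lambda>z. indicator ?S (fst z, snd z, y z) *\<^sub>R f (fst z) (snd z) (y z)) \<in> borel_measurable borel"
        using measurable_compose[OF c2 c1] by (simp only: prod.case)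
      have "continuous_on Om (\<lambda>z. 1 / u (snd z))"
        using u_nz by (intro continuous_intros continuous_on_subset[OF cont_u_snd Om_Rect]) (auto simp: Om_iff)
      then have m2: "(\<lambda>z. indicator Om z *\<^sub>R (1 / u (snd z))) \<in> borel_measurable borel"
        by (intro borel_measurable_continuous_on_indicator) simp_all
      have "(\<lambda>z. Nl z (y z)) = (\<lambda>z. (indicator ?S (fst z, snd z, y z) *\<^sub>R f (fst z) (snd z) (y z))
          * (indicator Om z *\<^sub>R (1 / u (snd z))))"
        by (auto simp: Nl_def indicator_def Om_iff)
      then show ?thesis using borel_measurable_times[OF m1 m2] by (simp only: meas_V)
    qed
    show "AE z in V. continuous_on UNIV (Nl z)"
    proof (rule AE_I2)
      fix z :: "real \<times> real"
      show "continuous_on UNIV (Nl z)"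
      proof (cases "z \<in> Om")
        case True
        have "continuous_on UNIV (\<lambda>y. (\<lambda>(t, x, y). f t x y) (fst z, snd z, y))"
          using True by (intro continuous_on_compose2[OF f_cont] continuous_intros) (auto simp: Om_iff)
        then show ?thesis using True u_nz[of "snd z"] by (auto simp: Nl_def Om_iff intro!: continuous_intros)
      next
        case False
        then have "Nl z = (\<lambda>y. 0)" by (simp add: Nl_def)
        then show ?thesis by simp
      qed
    qed
    show "\<exists>h. sq_int V h \<and> (AE z in V. \<forall>y. \<exists>a. \<alpha> z - \<epsilon> \<le> a \<and> a \<le> \<beta> z + \<epsilon> \<and> \<bar>Nl z y - a * y\<bar> \<le> h z)"
      if \<epsilon>: "\<epsilon> > 0" for \<epsilon>
    proof -
      \<comment> \<open>Half of the tolerance goes to the slope of \<open>f1\<close>, half to the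
        perturbation \<open>f2\<close>.\<close>
      obtain R1 where R1: "AE z in V. \<forall>y. \<bar>y\<bar> \<ge> R1 \<longrightarrow> \<alpha> z - \<epsilon> / 2 \<le> f1 (fst z) (snd z) y / y
          \<and> f1 (fst z) (snd z) y / y \<le> \<beta> z + \<epsilon> / 2"
        using f1_lim[rule_format, of "\<epsilon> / 2"] \<epsilon> by (auto simp: AE_V)
      obtain R2 where R2: "AE z in V. \<forall>y. \<bar>y\<bar> \<ge> R2 \<longrightarrow> \<bar>f2 (fst z) (snd z) y / y\<bar> \<le> \<epsilon> / 2"
        using f2_lim[rule_format, of "\<epsilon> / 2"] \<epsilon> by (auto simp: AE_V)
      \<comment> \<open>At least 1, so that beyond it division by y is legitimate.\<close>
      define R where "R = max 1 (max R1 R2)"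
      have R: "R \<ge> 1" "R \<ge> R1" "R \<ge> R2" by (auto simp: R_def)
      obtain h0 where h0: "h0 \<in> L2 u T" "\<And>z y. z \<in> Om \<Longrightarrow> \<bar>y\<bar> \<le> R \<Longrightarrow> \<bar>f (fst z) (snd z) y / u (snd z)\<bar> \<le> h0 z"
        using f_bound[rule_format, of R] R by auto
      define C where "C = (\<bar>lamlo\<bar> + \<bar>lamhi\<bar>) * R"
      have C0: "C \<ge> 0" using R by (simp add: C_def)
      have sqh: "sq_int V (\<lambda>z. h0 z + C)"
      proof (rule sq_int_add)
        show "sq_int V h0" using h0(1) by (simp add: sq_int_V L2_def)
        show "sq_int V (\<lambda>z. C)" by (rule V.sq_int_bounded[of _ C]) (use C0 in auto)
      qed
      have "AE z in V. z \<in> Om" unfolding AE_V by simp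
      then have "AE z in V. \<forall>y. \<exists>a. \<alpha> z - \<epsilon> \<le> a \<and> a \<le> \<beta> z + \<epsilon> \<and> \<bar>Nl z y - a * y\<bar> \<le> h0 z + C"
        using R1 R2 AE\<alpha>\<beta>
      proof eventually_elim
        case (elim z)
        have x: "snd z \<in> {0<..<pi}" using elim(1) by (auto simp: Om_iff)
        have h00: "0 \<le> h0 z" by (rule order_trans[OF abs_ge_zero h0(2)[OF elim(1), of 0]]) (use R in simp)
        show ?case
        proof
          fix y
          show "\<exists>a. \<alpha> z - \<epsilon> \<le> a \<and> a \<le> \<beta> z + \<epsilon> \<and> \<bar>Nl z y - a * y\<bar> \<le> h0 z + C"
          \<comment> \<open>For bounded y the slope is \<open>\<alpha>\<close> and the error at most
            h0 + C; for large y the slope is the quotient N(y)/y itself and the error is 0.\<close>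
          proof (cases "\<bar>y\<bar> \<le> R")
            case True
            have "\<bar>Nl z y\<bar> \<le> h0 z" using h0(2)[OF elim(1) True] elim(1) by (simp add: Nl_def)
            moreover have "\<bar>\<alpha> z * y\<bar> \<le> C"
              unfolding abs_mult C_def using elim(4) True by (intro mult_mono) auto
            ultimately show ?thesis using elim(4) \<epsilon> by (intro exI[of _ "\<alpha> z"]) auto
          next
            case False
            then have y: "y \<noteq> 0" "\<bar>y\<bar> \<ge> R1" "\<bar>y\<bar> \<ge> R2" using R by auto
            have "Nl z y / y = f1 (fst z) (snd z) y / y + f2 (fst z) (snd z) y / y"
              using f_split x elim(1) by (simp add: Nl_def add_divide_distrib)
            moreover have "\<alpha> z - \<epsilon> / 2 \<le> f1 (fst z) (snd z) y / y" "f1 (fst z) (snd z) y / y \<le> \<beta> z + \<epsilon> / 2"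
              "\<bar>f2 (fst z) (snd z) y / y\<bar> \<le> \<epsilon> / 2"
              using elim(2,3) y by blast+
            ultimately have "\<alpha> z - \<epsilon> \<le> Nl z y / y \<and> Nl z y / y \<le> \<beta> z + \<epsilon>" by linarith
            moreover have "Nl z y - Nl z y / y * y = 0" using y by simp
            ultimately show ?thesis using h00 C0 by (intro exI[of _ "Nl z y / y"]) simp
          qed
        qed
      qed
      with sqh show ?thesis by blast
    qed
  qed
  obtain Y y where Y: "\<And>k. \<exists>n c. Y k = O.comb {..<n} c"
    and yd: "y = (\<lambda>x. if convergent (\<lambda>k. Y k x) then lim (\<lambda>k. Y k x) else 0)"
    and sqy: "sq_int V y" and lim: "(\<lambda>k. nrm V (\<lambda>x. y x - Y k x)) \<longlonglongrightarrow> 0"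
    and sol: "\<And>i. nu i * ip V y (eo i) = ip V (A.Nem y) (eo i)"
    by (rule A.galerkin_limit) blast
  have ym: "y \<in> borel_measurable borel" using sqy by (simp add: sq_int_V)
  have eo_shift: "eo i (t + T, x) = eo i (t, x)" for i t x by (simp add: eo_def mode_shift)
  have eo_half: "eo i (t + T / 2, x) = - eo i (t, x)" for i t x
  proof -
    have "en i \<in> MO" using ran by blast
    then obtain b m n where "en i = (b, m, n)" "odd m" by (auto simp: MO_def)
    then show ?thesis using mode_half_shift[of b m n t x] by (simp add: eo_def)
  qed
  have Y_shift: "Y k (t + T, x) = Y k (t, x)" and Y_half: "Y k (t + T / 2, x) = - Y k (t, x)" for k t x
    using Y[of k] by (auto simp: O.comb_def eo_shift eo_half sum_negf)
  have y_shift: "y (t + T, x) = y (t, x)" for t x by (simp add: yd Y_shift)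
  have y_half: "y (t + T / 2, x) = - y (t, x)" for t x
  proof (cases "convergent (\<lambda>k. Y k (t, x))")
    case True
    then have "(\<lambda>k. - Y k (t, x)) \<longlonglongrightarrow> - lim (\<lambda>k. Y k (t, x))"
      by (intro tendsto_minus) (simp add: convergent_LIMSEQ_iff)
    then have "convergent (\<lambda>k. - Y k (t, x))" "lim (\<lambda>k. - Y k (t, x)) = - lim (\<lambda>k. Y k (t, x))"
      by (auto simp: convergent_def limI)
    then show ?thesis using True by (simp add: yd Y_half)
  next
    case False
    then have "\<not> convergent (\<lambda>k. - Y k (t, x))" by (simp add: convergent_minus_iff[symmetric])
    then show ?thesis using False by (simp add: yd Y_half)
  qed
  have yL2: "y \<in> L2 u T" using sqy by (simp add: L2_def sq_int_V y_shift)
  have yM: "y \<in> M_o u T"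
    unfolding M_o_def using yL2 y_half by (intro CollectI conjI AE_I2 impI) auto
  have sqF: "sq_int V (A.Nem y)" by (rule A.sq_Nem[OF sqy])
  \<comment> \<open>Shifting by T/2 and reflecting v changes the sign of \<open>f1\<close> through
    its oddness in v and that of \<open>f2\<close> through its antiperiodicity in t. Hence the
    superposition of an antiperiodic y is antiperiodic.\<close>
  have f_half: "f (t + T / 2) x (- v) / u x = - (f t x v / u x)" if "x \<in> {0<..<pi}" for t x v
  proof -
    have "f1 (t + T / 2) x (- v) = - f1 t x v" using f1_sym that by (metis minus_equation_iff)
    moreover have "f2 (t + T / 2) x (- v) = - f2 t x v" using f2_sym that by (metis minus_equation_iff)
    ultimately show ?thesis using f_split that by simp
  qed
  have modes: "emu i * ip V y (mode i) = ip V (A.Nem y) (mode i)" if i: "i \<in> MI" for i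
  proof (cases "i \<in> MO")
    case True
    then obtain j where "i = en j" using ran by blast
    then show ?thesis using sol[of j] by (simp add: nu_def eo_def)
  next
    case False
    then obtain b m n where bmn: "i = (b, m, n)" "even m" using i by (auto simp: MO_def MI_def)
    have mode_half: "mode i (t + T / 2, x) = mode i (t, x)" for t x
      using mode_half_shift[of b m n t x] bmn by simp
    have "ip V y (mode i) = 0"
      unfolding ip_def
    proof (rule integral_antiperiodic)
      show "integrable V (\<lambda>x. y x * mode i x)" by (rule integrable_mult_sq_int[OF sqy V.sq_e[OF i]])
    qed (simp add: y_half mode_half)
    moreover have "ip V (A.Nem y) (mode i) = 0"
      unfolding ip_def
    proof (rule integral_antiperiodic)
      show "integrable V (\<lambda>x. A.Nem y x * mode i x)" by (rule integrable_mult_sq_int[OF sqF V.sq_e[OF i]])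
      fix t x assume t: "0 < t" "t < T / 2" "0 < x" "x < pi"
      then have "(t, x) \<in> Om" "(t + T / 2, x) \<in> Om" by (auto simp: Om_iff)
      then show "A.Nem y (t + T / 2, x) * mode i (t + T / 2, x) = - (A.Nem y (t, x) * mode i (t, x))"
        using f_half[of x t "y (t, x)"] t by (simp add: A.Nem_def Nl_app y_half mode_half)
    qed
    ultimately show ?thesis by simp
  qed
  have appr: "\<exists>g\<in>V.lincombs. nrm V (\<lambda>z. y z - g z) \<le> \<epsilon>" if \<epsilon>: "\<epsilon> > 0" for \<epsilon>
  proof -
    obtain k where k: "nrm V (\<lambda>x. y x - Y k x) < \<epsilon>"
      using order_tendstoD(2)[OF lim \<epsilon>] by (auto simp: eventually_sequentially)
    obtain n c where "Y k = O.comb {..<n} c" using Y[of k] by blast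
    then have "Y k = V.comb (en ` {..<n}) (\<lambda>j. c (inv en j))" by (simp only: comb)
    then have "Y k \<in> V.lincombs" unfolding V.lincombs_def using ranI by blast
    with k show ?thesis by (intro bexI[of _ "Y k"]) auto
  qed
  have "weak_solution u T f y"
    unfolding weak_solution_def
  proof (intro conjI yL2 allI impI)
    fix \<psi> assume \<psi>: "test_fun T \<psi>"
    have Fm: "A.Nem y \<in> borel_measurable borel" using sqF by (simp add: sq_int_V)
    have eqF: "u (snd z) * (A.Nem y z * \<psi> z) = f (fst z) (snd z) (y z) * \<psi> z" if "z \<in> Om" for z
      using that u_nz[of "snd z"] by (simp add: A.Nem_def Nl_app Om_iff)
    have m: "(\<lambda>z. A.Nem y z * \<psi> z) \<in> borel_measurable borel" "(\<lambda>z. y z * wv \<psi> z) \<in> borel_measurable borel"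
      using Fm ym test_fun_meas[OF \<psi>] wv_meas[OF \<psi>] by auto
    have "integrable V (\<lambda>z. A.Nem y z * \<psi> z)" by (rule integrable_mult_sq_int[OF sqF test_fun_sq_int[OF \<psi>]])
    then have "set_integrable lborel Om (\<lambda>z. u (snd z) * (A.Nem y z * \<psi> z))" by (simp add: integrable_V m)
    moreover have "set_integrable lborel Om (\<lambda>z. u (snd z) * (A.Nem y z * \<psi> z))
      \<longleftrightarrow> set_integrable lborel Om (\<lambda>z. f (fst z) (snd z) (y z) * \<psi> z)"
      by (rule set_integrable_cong) (auto simp: eqF)
    ultimately show "set_integrable lborel Om (\<lambda>z. f (fst z) (snd z) (y z) * \<psi> z)" by simp
    have "ip V (A.Nem y) \<psi> = (LINT z:Om|lborel. f (fst z) (snd z) (y z) * \<psi> z)"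
      unfolding ip_def integral_V[OF m(1)] by (rule set_lebesgue_integral_cong) (auto simp: eqF)
    moreover have "ip V y (wv \<psi>) = (LINT z:Om|lborel. y z * wave_op u \<psi> z)"
      unfolding ip_def integral_V[OF m(2)]
      using u_nz by (intro set_lebesgue_integral_cong) (auto simp: wv_def Om_iff)
    moreover have "ip V y (wv \<psi>) = ip V (A.Nem y) \<psi>"
      by (rule weak_equation[OF sqy sqF appr modes \<psi>])
    ultimately show "(LINT z:Om|lborel. y z * wave_op u \<psi> z)
      - (LINT z:Om|lborel. f (fst z) (snd z) (y z) * \<psi> z) = 0" by simp
  qed
  with yM show ?thesis by blast
qed

end

theorem theorem4p1:
  fixes u :: "real \<Rightarrow> real" and p q :: nat and T :: real
    and f f1 f2 :: "real \<Rightarrow> real \<Rightarrow> real \<Rightarrow> real"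
    and lam2 :: "nat \<Rightarrow> real" and phi :: "nat \<Rightarrow> real \<Rightarrow> real"
    and lamlo lamhi :: real and \<alpha> \<beta> :: "real \<times> real \<Rightarrow> real"
  assumes u_C2: "C2_on {0..pi} u"
    and u_pos: "\<forall>x\<in>{0..pi}. u x > 0"
    and pq: "p > 0" "q > 0" "coprime p q" "even p"
    and T_def: "T = 2 * pi * real p / real q"
    and SL: "SL_system u lam2 phi"
    and f_cont: "continuous_on ({0<..<T} \<times> {0<..<pi} \<times> UNIV) (\<lambda>(t, x, y). f t x y)"
    and f_per: "\<forall>t x y. f (t + T) x y = f t x y"
    and f_bound: "\<forall>R>0. \<exists>h\<in>L2 u T. \<forall>z\<in>Omega T. \<forall>y. \<bar>y\<bar> \<le> R \<longrightarrow>
                      \<bar>f (fst z) (snd z) y / u (snd z)\<bar> \<le> h z"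
    and lam_in: "lamlo \<in> spec_Lo lam2 p q" "lamhi \<in> spec_Lo lam2 p q" "lamlo < lamhi"
    and lam_consec: "\<forall>\<mu>\<in>spec_Lo lam2 p q. \<not> (lamlo < \<mu> \<and> \<mu> < lamhi)"
    and \<alpha>_in: "\<alpha> \<in> M_e u T \<inter> Linfty T"
    and \<beta>_in: "\<beta> \<in> M_e u T \<inter> Linfty T"
    and \<alpha>\<beta>: "AE z in lborel. z \<in> Omega T \<longrightarrow> lamlo \<le> \<alpha> z \<and> \<alpha> z \<le> \<beta> z \<and> \<beta> z \<le> lamhi"
    and \<alpha>_nonres: "\<forall>v\<in>ker_Lo u p q T lam2 phi lamlo. L2_nonzero T v \<longrightarrow>
                     (LINT z:Omega T|lborel. (\<alpha> z - lamlo) * (v z)\<^sup>2) > 0"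
    and \<beta>_nonres: "\<forall>w\<in>ker_Lo u p q T lam2 phi lamhi. L2_nonzero T w \<longrightarrow>
                     (LINT z:Omega T|lborel. (lamhi - \<beta> z) * (w z)\<^sup>2) > 0"
    and f_split: "\<forall>t. \<forall>x\<in>{0<..<pi}. \<forall>y. f t x y / u x = f1 t x y + f2 t x y"
    and f1_sym: "\<forall>t. \<forall>x\<in>{0<..<pi}. \<forall>y. f1 t x y = f1 (t + T/2) x y \<and> f1 t x y = - f1 t x (- y)"
    and f2_sym: "\<forall>t. \<forall>x\<in>{0<..<pi}. \<forall>y. f2 t x y = - f2 (t + T/2) x y \<and> f2 t x y = f2 t x (- y)"
    and f2_lim: "\<forall>\<epsilon>>0. \<exists>R. AE z in lborel. z \<in> Omega T \<longrightarrow>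
                   (\<forall>y. \<bar>y\<bar> \<ge> R \<longrightarrow> \<bar>f2 (fst z) (snd z) y / y\<bar> \<le> \<epsilon>)"
    and f1_lim: "\<forall>\<epsilon>>0. \<exists>R. AE z in lborel. z \<in> Omega T \<longrightarrow>
                   (\<forall>y. \<bar>y\<bar> \<ge> R \<longrightarrow> \<alpha> z - \<epsilon> \<le> f1 (fst z) (snd z) y / y
                                    \<and> f1 (fst z) (snd z) y / y \<le> \<beta> z + \<epsilon>)"
  shows "\<exists>y\<in>M_o u T. weak_solution u T f y"
proof -
  obtain u' u'' where
    "\<forall>x\<in>{0..pi}. (u has_real_derivative u' x) (at x within {0..pi})"
    "\<forall>x\<in>{0..pi}. (u' has_real_derivative u'' x) (at x within {0..pi})"
    "continuous_on {0..pi} u''"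
    using u_C2 unfolding C2_on_def by blast
  then interpret wave u u' u'' lam2 phi p q T
    using u_pos SL pq T_def by unfold_locales auto
  show ?thesis
    by (rule existence[OF f_cont f_bound lam_in(3) lam_consec _ _ \<alpha>\<beta> \<alpha>_nonres \<beta>_nonres
          f_split f1_sym f2_sym f2_lim f1_lim])
      (use \<alpha>_in \<beta>_in in \<open>auto simp: Linfty_def\<close>)
qed

end
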